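(* Let $q>2$ and consider the $q$-state Potts model with Hamiltonian $H$ on the $K\times L$ torus $\Lambda$. Let $\mathbf r,\mathbf s\in\mathcal X^s$ with $\mathbf r\ne\mathbf s$. Then each of the following sets is a minimal gate for the transition $\mathbf r\to\mathbf s$: (a) $\bigcup_{\mathbf t\in\mathcal X^s\setminus\{\mathbf r\}}\overline{\mathcal P}(\mathbf r,\mathbf t)$, $\bigcup_{\mathbf t\in\mathcal X^s\setminus\{\mathbf s\}}\overline{\mathcal P}(\mathbf t,\mathbf s)$, $\bigcup_{\mathbf t\in\mathcal X^s\setminus\{\mathbf r\}}\widetilde{\mathcal P}(\mathbf r,\mathbf t)$, $\bigcup_{\mathbf t\in\mathcal X^s\setminus\{\mathbf s\}}\widetilde{\mathcal P}(\mathbf t,\mathbf s)$; (b) $\bigcup_{\mathbf t\in\mathcal X^s\setminus\{\mathbf r\}}\overline{\mathcal Q}(\mathbf r,\mathbf t)$, $\bigcup_{\mathbf t\in\mathcal X^s\setminus\{\mathbf s\}}\overline{\mathcal Q}(\mathbf t,\mathbf s)$, $\bigcup_{\mathbf t\in\mathcal X^s\setminus\{\mathbf r\}}\widetilde{\mathcal Q}(\mathbf r,\mathbf t)$, $\bigcup_{\mathbf t\in\mathcal X^s\setminus\{\mathbf s\}}\widetilde{\mathcal Q}(\mathbf t,\mathbf s)$; (c) $\bigcup_{\mathbf t\in\mathcal X^s\setminus\{\mathbf r\}}\overline{\mathcal H}_i(\mathbf r,\mathbf t)$, $\bigcup_{\mathbf t\in\mathcal X^s\setminus\{\mathbf s\}}\overline{\mathcal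 H}_i(\mathbf t,\mathbf s)$, $\bigcup_{\mathbf t\in\mathcal X^s\setminus\{\mathbf r\}}\widetilde{\mathcal H}_i(\mathbf r,\mathbf t)$, $\bigcup_{\mathbf t\in\mathcal X^s\setminus\{\mathbf s\}}\widetilde{\mathcal H}_i(\mathbf t,\mathbf s)$, for any $i=1,\dots,K-3$; (d) $\bigcup_{\mathbf t\in\mathcal X^s\setminus\{\mathbf r\}}\mathcal W_j^{(h)}(\mathbf r,\mathbf t)$, $\bigcup_{\mathbf t\in\mathcal X^s\setminus\{\mathbf s\}}\mathcal W_j^{(h)}(\mathbf t,\mathbf s)$, for any $j=2,\dots,L-3$ and any $h=1,\dots,K-1$.
   Context: Model. Fix integers $q$, $K<L$, $L\ge 3$. $\Lambda=(V,E)$ is the two-dimensional torus with $V=\{0,\dots,K-1\}\times\{0,\dots,L-1\}$ (vertex $(i,j)$ lies in row $i$ and column $j$; there are $K$ rows and $L$ columns) and $E$ the set of nearest-neighbour pairs with periodic boundary conditions. $S=\{1,\dots,q\}$, $\mathcal X=S^V$, $H(\sigma)=-\sum_{(v,w)\in E}1_{\{\sigma(v)=\sigma(w)\}}$. $Q(\sigma,\sigma')=1/(q|V|)$ if $\sigma,\sigma'$ differ at exactly one vertex, and $Q(\sigma,\sigma')=0$ if they differ at more than one vertex. For $s\in S$, bold $\mathbf s\in\mathcal X$ is the configuration constantly equal to $s$; $\mathcal X^s=\{\mathbf 1,\dots,\mathbf q\}$ is the set of global minima of $H$ (stable configurations). Paths, saddles, gates. A path $\omega:\sigma\to\sigma'$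 is a finite sequence $\omega_0=\sigma,\dots,\omega_n=\sigma'$ in $\mathcal X$ with $Q(\omega_i,\omega_{i+1})>0$; $\Omega_{\sigma,\sigma'}$ is the set of such paths; $\Phi_\omega=\max_i H(\omega_i)$; $\Phi(\sigma,\sigma')=\min_{\omega:\sigma\to\sigma'}\Phi_\omega$; $\Omega^{opt}_{\sigma,\sigma'}=\{\omega\in\Omega_{\sigma,\sigma'}:\Phi_\omega=\Phi(\sigma,\sigma')\}$ (optimal paths). $\mathcal S(\sigma,\sigma')$ is the set of $\xi\in\mathcal X$ such that there is $\omega\in\Omega^{opt}_{\sigma,\sigma'}$ with $\xi\in\omega$ and $H(\xi)=\max_{\eta\in\omega}H(\eta)$ (minimal saddles). A gate for $\sigma\to\sigma'$ is a subset $\mathcal W\subseteq\mathcal S(\sigma,\sigma')$ such that $\omega\cap\mathcal W\ne\varnothing$ for all $\omega\in\Omega^{opt}_{\sigma,\sigma'}$. A gate $\mathcal W$ is a minimal gate if for every proper subset $\mathcal W'\subset\mathcal W$ there is $\omega'\in\Omega^{opt}_{\sigma,\sigma'}$ with $\omega'\cap\mathcal W'=\varnothing$. Sets of configurations. For distinct spins $r,s$: $\bar R_{a,b}(r,s)$ is the set of configurations in which all spins are $r$ except those, equal to $s$, in a rectangle $a\times b$ of $\Lambda$ ($a$ = horizontal length, i.e. number of columns; $b$ = vertical length, i.e. number of rows). $\bar B^h_{a,b}(r,s)$, $1\le h\le b-1$, is the set of configurations in which all spins are $r$ except those, equal to $s$, in a rectangle $a\times b$ together with a bar $1\times h$ (one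 column wide, $h$ consecutive rows) adjacent to one of the sides of length $b$. $\tilde R_{a,b}(r,s)$, $\tilde B^h_{a,b}(r,s)$ are the same with the roles of $r$ and $s$ interchanged. Put $\overline{\mathcal P}(\mathbf r,\mathbf s)=\bar B^{K-1}_{1,K}(r,s)$; $\overline{\mathcal Q}(\mathbf r,\mathbf s)=\bar R_{2,K-1}(r,s)\cup\bar B^{K-2}_{1,K}(r,s)$; $\overline{\mathcal H}_i(\mathbf r,\mathbf s)=\bar B^i_{1,K}(r,s)\cup\bigcup_{h=i+1}^{K-2}\bar B^h_{1,K-1}(r,s)$ for $i=1,\dots,K-3$; and $\widetilde{\mathcal P},\widetilde{\mathcal Q},\widetilde{\mathcal H}_i$ by the same formulas with $\tilde R,\tilde B$ in place of $\bar R,\bar B$. Finally $\mathcal W_j^{(h)}(\mathbf r,\mathbf s)=\bar B^h_{j,K}(r,s)=\tilde B^{K-h}_{L-j-1,K}(r,s)$ for $j=2,\dots,L-3$, $h=1,\dots,K-1$.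
   Formalization: K ≥ 3 is assumed: for K ≤ 2 the set Q uses the undefined B^{K-2}_{1,K}, and for K = 2, L = 3 part (a) already fails because growing a full row first gives a lower communication height. *)

theory Defs
  imports Complex_Main "HOL-Library.FuncSet"
begin

section \<open>The Potts model on the \<open>K \<times> L\<close> torus\<close>

type_synonym vertex = "nat \<times> nat"
type_synonym config = "vertex \<Rightarrow> nat"

text \<open>A vertex \<open>(i, j)\<close> lies in row \<open>i < K\<close> and column \<open>j < L\<close>.\<close>

definition verts :: "nat \<Rightarrow> nat \<Rightarrow> vertex set" where
  "verts K L = {0..<K} \<times> {0..<L}"

definition nearest_neighbour :: "nat \<Rightarrow> nat \<Rightarrow> vertex \<Rightarrow> vertex \<Rightarrow> bool" where
  "nearest_neighbour K L v w \<longleftrightarrow>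
     (fst v = fst w \<and> (snd w = (snd v + 1) mod L \<or> snd v = (snd w + 1) mod L)) \<or>
     (snd v = snd w \<and> (fst w = (fst v + 1) mod K \<or> fst v = (fst w + 1) mod K))"

definition edges :: "nat \<Rightarrow> nat \<Rightarrow> vertex set set" where
  "edges K L = {{v, w} | v w. v \<in> verts K L \<and> w \<in> verts K L \<and> nearest_neighbour K L v w}"

definition spins :: "nat \<Rightarrow> nat set" where
  "spins q = {1..q}"

definition configs :: "nat \<Rightarrow> nat \<Rightarrow> nat \<Rightarrow> config set" where
  "configs q K L = verts K L \<rightarrow>\<^sub>E spins q"

text \<open>An edge is an unordered pair; its two endpoints carry the same spin iff the
  configuration is constant on it.\<close>

definition energy :: "nat \<Rightarrow> nat \<Rightarrow> config \<Rightarrow> int" where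
  "energy K L \<sigma> = - (\<Sum>e\<in>edges K L. of_bool (\<forall>v\<in>e. \<forall>w\<in>e. \<sigma> v = \<sigma> w))"

definition disagreement :: "nat \<Rightarrow> nat \<Rightarrow> config \<Rightarrow> config \<Rightarrow> vertex set" where
  "disagreement K L \<sigma> \<eta> = {v \<in> verts K L. \<sigma> v \<noteq> \<eta> v}"

text \<open>Each configuration has \<open>(q - 1) * |V|\<close> neighbours, so the diagonal value
  \<open>1 / q\<close> is the one that makes the rows of the connectivity matrix sum to \<open>1\<close>.\<close>

definition connectivity :: "nat \<Rightarrow> nat \<Rightarrow> nat \<Rightarrow> config \<Rightarrow> config \<Rightarrow> real" where
  "connectivity q K L \<sigma> \<eta> =
     (if card (disagreement K L \<sigma> \<eta>) = 1 then 1 / (real q * real (card (verts K L)))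
      else if card (disagreement K L \<sigma> \<eta>) > 1 then 0
      else 1 / real q)"

text \<open>The stable configurations, i.e. the global minima of the energy, are the constant
  ones; \<open>s \<mapsto> const_config K L s\<close> identifies them with the spins, and below
  they are indexed that way.\<close>

definition const_config :: "nat \<Rightarrow> nat \<Rightarrow> nat \<Rightarrow> config" where
  "const_config K L s = (\<lambda>v\<in>verts K L. s)"

section \<open>Optimal paths, minimal saddles and gates\<close>

definition paths :: "nat \<Rightarrow> nat \<Rightarrow> nat \<Rightarrow> config \<Rightarrow> config \<Rightarrow> config list set" where
  "paths q K L \<sigma> \<sigma>' =
     {\<omega>. \<omega> \<noteq> [] \<and> set \<omega> \<subseteq> configs q K L \<and> hd \<omega> = \<sigma> \<and> last \<omega> = \<sigma>' \<and>
         successively (\<lambda>\<xi> \<eta>. connectivity q K L \<xi> \<eta> > 0) \<omega>}"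

definition path_height :: "nat \<Rightarrow> nat \<Rightarrow> config list \<Rightarrow> int" where
  "path_height K L \<omega> = Max (energy K L ` set \<omega>)"

definition comm_height :: "nat \<Rightarrow> nat \<Rightarrow> nat \<Rightarrow> config \<Rightarrow> config \<Rightarrow> int" where
  "comm_height q K L \<sigma> \<sigma>' = Min (path_height K L ` paths q K L \<sigma> \<sigma>')"

definition opt_paths :: "nat \<Rightarrow> nat \<Rightarrow> nat \<Rightarrow> config \<Rightarrow> config \<Rightarrow> config list set" where
  "opt_paths q K L \<sigma> \<sigma>' =
     {\<omega> \<in> paths q K L \<sigma> \<sigma>'. path_height K L \<omega> = comm_height q K L \<sigma> \<sigma>'}"

definition saddles :: "nat \<Rightarrow> nat \<Rightarrow> nat \<Rightarrow> config \<Rightarrow> config \<Rightarrow> config set" where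
  "saddles q K L \<sigma> \<sigma>' =
     {\<xi> \<in> configs q K L. \<exists>\<omega>\<in>opt_paths q K L \<sigma> \<sigma>'.
        \<xi> \<in> set \<omega> \<and> energy K L \<xi> = Max (energy K L ` set \<omega>)}"

definition gate :: "nat \<Rightarrow> nat \<Rightarrow> nat \<Rightarrow> config \<Rightarrow> config \<Rightarrow> config set \<Rightarrow> bool" where
  "gate q K L \<sigma> \<sigma>' W \<longleftrightarrow>
     W \<subseteq> saddles q K L \<sigma> \<sigma>' \<and> (\<forall>\<omega>\<in>opt_paths q K L \<sigma> \<sigma>'. set \<omega> \<inter> W \<noteq> {})"

definition minimal_gate :: "nat \<Rightarrow> nat \<Rightarrow> nat \<Rightarrow> config \<Rightarrow> config \<Rightarrow> config set \<Rightarrow> bool" where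
  "minimal_gate q K L \<sigma> \<sigma>' W \<longleftrightarrow>
     gate q K L \<sigma> \<sigma>' W \<and>
     (\<forall>W'. W' \<subset> W \<longrightarrow> (\<exists>\<omega>\<in>opt_paths q K L \<sigma> \<sigma>'. set \<omega> \<inter> W' = {}))"

section \<open>Rectangles with and without an attached bar\<close>

text \<open>The \<open>a \<times> b\<close> rectangle has \<open>a\<close> columns and \<open>b\<close> rows; \<open>(i, j)\<close> is the
  corner from which it extends in the increasing directions, wrapping around the torus.\<close>

definition rectangle :: "nat \<Rightarrow> nat \<Rightarrow> nat \<Rightarrow> nat \<Rightarrow> nat \<Rightarrow> nat \<Rightarrow> vertex set" where
  "rectangle K L i j a b = {((i + x) mod K, (j + y) mod L) | x y. x < b \<and> y < a}"

definition two_spin_config :: "nat \<Rightarrow> nat \<Rightarrow> nat \<Rightarrow> nat \<Rightarrow> vertex set \<Rightarrow> config" where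
  "two_spin_config K L r s A = (\<lambda>v\<in>verts K L. if v \<in> A then s else r)"

definition R_bar :: "nat \<Rightarrow> nat \<Rightarrow> nat \<Rightarrow> nat \<Rightarrow> nat \<Rightarrow> nat \<Rightarrow> config set" where
  "R_bar K L a b r s =
     {two_spin_config K L r s (rectangle K L i j a b) | i j. i < K \<and> j < L}"

text \<open>The \<open>1 \<times> h\<close> bar occupies \<open>h\<close> consecutive rows of the rectangle, starting
  \<open>m\<close> rows from the corner, in the column \<open>c\<close> directly after (\<open>j + a\<close>) or directly
  before (\<open>j - 1\<close>, modulo \<open>L\<close>) the rectangle. When \<open>b = K\<close> the corner row \<open>i\<close> is
  arbitrary, so every cyclic interval of \<open>h\<close> rows occurs.\<close>

definition B_bar :: "nat \<Rightarrow> nat \<Rightarrow> nat \<Rightarrow> nat \<Rightarrow> nat \<Rightarrow> nat \<Rightarrow> nat \<Rightarrow> config set" where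
  "B_bar K L h a b r s =
     {two_spin_config K L r s (rectangle K L i j a b \<union> rectangle K L (i + m) c 1 h) | i j m c.
        i < K \<and> j < L \<and> m + h \<le> b \<and> (c = j + a \<or> c = j + L - 1)}"

definition R_tilde :: "nat \<Rightarrow> nat \<Rightarrow> nat \<Rightarrow> nat \<Rightarrow> nat \<Rightarrow> nat \<Rightarrow> config set" where
  "R_tilde K L a b r s = R_bar K L a b s r"

definition B_tilde :: "nat \<Rightarrow> nat \<Rightarrow> nat \<Rightarrow> nat \<Rightarrow> nat \<Rightarrow> nat \<Rightarrow> nat \<Rightarrow> config set" where
  "B_tilde K L h a b r s = B_bar K L h a b s r"

section \<open>The candidate gates\<close>

definition P_bar :: "nat \<Rightarrow> nat \<Rightarrow> nat \<Rightarrow> nat \<Rightarrow> config set" where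
  "P_bar K L r s = B_bar K L (K - 1) 1 K r s"

definition P_tilde :: "nat \<Rightarrow> nat \<Rightarrow> nat \<Rightarrow> nat \<Rightarrow> config set" where
  "P_tilde K L r s = B_tilde K L (K - 1) 1 K r s"

definition Q_bar :: "nat \<Rightarrow> nat \<Rightarrow> nat \<Rightarrow> nat \<Rightarrow> config set" where
  "Q_bar K L r s = R_bar K L 2 (K - 1) r s \<union> B_bar K L (K - 2) 1 K r s"

definition Q_tilde :: "nat \<Rightarrow> nat \<Rightarrow> nat \<Rightarrow> nat \<Rightarrow> config set" where
  "Q_tilde K L r s = R_tilde K L 2 (K - 1) r s \<union> B_tilde K L (K - 2) 1 K r s"

definition H_bar :: "nat \<Rightarrow> nat \<Rightarrow> nat \<Rightarrow> nat \<Rightarrow> nat \<Rightarrow> config set" where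
  "H_bar K L i r s = B_bar K L i 1 K r s \<union> (\<Union>h\<in>{i+1..K-2}. B_bar K L h 1 (K - 1) r s)"

definition H_tilde :: "nat \<Rightarrow> nat \<Rightarrow> nat \<Rightarrow> nat \<Rightarrow> nat \<Rightarrow> config set" where
  "H_tilde K L i r s = B_tilde K L i 1 K r s \<union> (\<Union>h\<in>{i+1..K-2}. B_tilde K L h 1 (K - 1) r s)"

text \<open>For \<open>j\<close> and \<open>h\<close> in the relevant ranges this set also equals
  \<open>B_tilde K L (K - h) (L - j - 1) K r s\<close>.\<close>

definition W_gate :: "nat \<Rightarrow> nat \<Rightarrow> nat \<Rightarrow> nat \<Rightarrow> nat \<Rightarrow> nat \<Rightarrow> config set" where
  "W_gate K L j h r s = B_bar K L h j K r s"

end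

theory Submission
  imports Defs
begin

text \<open>Up to the additive constant \<open>- 2 * K * L\<close> the energy is the number of disagreeing
edges, called the \<open>defect\<close> below: the total number of changes met when every row and
every column is read cyclically. A word that is not constant changes at least twice, so a
configuration with \<open>\<rho>\<close> nonconstant rows and \<open>\<kappa>\<close> nonconstant
columns has defect at least \<open>2 * \<rho> + 2 * \<kappa>\<close>. The critical defect turns out
to be \<open>2 * K + 2\<close>, which leaves room for \<open>\<rho> + \<kappa> \<le> K + 1\<close>
only. Configurations and paths of defect at most \<open>2 * K + 2\<close> are called low.

\<^bold>\<open>The bottleneck.\<close> Fix a set \<open>M\<close> of spins and let the area of a
configuration be the number of vertices with spin in \<open>M\<close>. Taking \<open>M = {s}\<close>
or \<open>M = - {r}\<close>, the area grows from \<open>0\<close> to \<open>K * L\<close> along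
every path from \<open>r\<close> to \<open>s\<close>, in steps of at most one. If a low
configuration has a constant row and a constant column, these share their spin, and all other spins
sit in a product of \<open>\<rho>\<close> rows and \<open>\<kappa>\<close> columns, so on at most
\<open>(K + 1)\<^sup>2 / 4\<close> vertices; hence at a suitable intermediate area no row is
constant (\<open>rows_mixed_if_medium_area\<close>). But \<open>K\<close> nonconstant rows leave at
most one nonconstant column, and then the configuration is a vertical strip of one spin in a sea of
another, with at most one bar attached (\<open>strip_shape\<close>): this is where
\<open>B_bar\<close> comes from. Third spins cannot occur there, although they may before and after.
If the area is not a multiple of \<open>K\<close>, such a configuration has defect exactly \<open>2
* K + 2\<close>, which gives the communication height.

\<^bold>\<open>Every low path meets each gate.\<close> Before reaching the intermediate area a path
must leave the configurations with a constant row for good. It can do so only at an area below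
\<open>2 * K\<close> (\<open>entering_area\<close>). If it enters at a full column with a bar, the
last configuration with a constant row is a column of length \<open>K - 1\<close> with the same bar
beside it (\<open>entering_from_B\<close>); for the longest bar this is a rectangle
\<open>R_bar\<close>, which in turn is reached only from a shorter bar beside such a column or from
a configuration without constant rows (\<open>entering_R\<close>). So a path that enters late has
passed one of the configurations with a short column that the gates \<open>Q_bar\<close> and
\<open>H_bar\<close> contain, and a path that enters early runs afterwards through strips of all
areas in between. This is organised as an invariant (\<open>low_walk_hits\<close>).

\<^bold>\<open>Minimality.\<close> For each element \<open>\<xi>\<close> of a gate there is an
optimal path that meets the gate in \<open>\<xi>\<close> alone. If \<open>\<xi>\<close> is a strip
with a bar, growing one spin inside another column by column will do: the area increases, and all
elements of a gate that contain a full column have the same area. To pass a short column with a bar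
of height \<open>h\<close> while avoiding those with shorter bars, the bar is grown beside a column
of length \<open>K - 2\<close>, which is lengthened only afterwards
(\<open>linked_through_short_column\<close>). If \<open>\<xi>\<close> involves a spin
\<open>t\<close> besides \<open>r\<close>, the path is continued from \<open>t\<close> to
\<open>s\<close> by configurations without \<open>r\<close>; if it involves \<open>t\<close> besides
\<open>s\<close>, it is preceded by a path from \<open>r\<close> to \<open>t\<close> without
\<open>s\<close>. These parts do not meet the gate.

\<^bold>\<open>Symmetry.\<close> Reversing paths exchanges \<open>r\<close> and \<open>s\<close>,
and the tilde sets are the bar sets with the spins exchanged; so only the gates built from bar sets
have to be treated (\<open>gate_family_minimal\<close>).\<close>

section \<open>Cyclic words and arcs\<close>

text \<open>A row or a column of the torus is read as a cyclic word \<open>f 0, \<dots>, f (n - 1)\<close>, closed up by the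
  step from \<open>f (n - 1)\<close> back to \<open>f 0\<close>.\<close>

definition cyclic_changes :: "nat \<Rightarrow> (nat \<Rightarrow> 'a) \<Rightarrow> nat" where
  "cyclic_changes n f = card {k. k < n \<and> f k \<noteq> f (Suc k mod n)}"

definition arc :: "nat \<Rightarrow> nat \<Rightarrow> nat \<Rightarrow> nat set" where
  "arc n p h = {(p + x) mod n | x. x < h}"

lemma rotation_eq_iff:
  fixes n p x y :: nat
  assumes "x < n" "y < n"
  shows "(p + x) mod n = (p + y) mod n \<longleftrightarrow> x = y"
proof
  assume eq: "(p + x) mod n = (p + y) mod n"
  show "x = y"
  proof (rule ccontr)
    assume "x \<noteq> y"
    then consider "x < y" | "y < x" by linarith
    then show False
    proof cases
      case 1
      with eq have "n dvd (p + y) - (p + x)" by (metis add_le_cancel_left less_imp_le mod_eq_dvd_iff_nat)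
      with 1 assms show False by (auto dest: dvd_imp_le)
    next
      case 2
      with eq have "n dvd (p + x) - (p + y)" by (metis add_le_cancel_left less_imp_le mod_eq_dvd_iff_nat)
      with 2 assms show False by (auto dest: dvd_imp_le)
    qed
  qed
qed simp

lemma bij_betw_rotation:
  fixes n p :: nat
  assumes "0 < n"
  shows "bij_betw (\<lambda>x. (p + x) mod n) {..<n} {..<n}"
proof -
  have inj: "inj_on (\<lambda>x. (p + x) mod n) {..<n}"
    by (auto simp: inj_on_def rotation_eq_iff)
  moreover have "(\<lambda>x. (p + x) mod n) ` {..<n} \<subseteq> {..<n}" using assms by auto
  ultimately show ?thesis
    by (simp add: bij_betw_def endo_inj_surj)
qed

lemma rotation_surj:
  fixes n p y :: nat
  assumes "y < n"
  obtains x where "x < n" "y = (p + x) mod n"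
proof -
  have "y \<in> (\<lambda>x. (p + x) mod n) ` {..<n}"
    using bij_betw_rotation[of n p] assms by (auto simp: bij_betw_def)
  then show ?thesis using that by auto
qed

lemma cyclic_changes_rotate:
  assumes "0 < n"
  shows "cyclic_changes n (\<lambda>x. f ((p + x) mod n)) = cyclic_changes n f"
proof -
  have suc: "(p + Suc x mod n) mod n = Suc ((p + x) mod n) mod n" for x
    by (metis add_Suc_right mod_Suc_eq mod_add_right_eq)
  have "{k. k < n \<and> f k \<noteq> f (Suc k mod n)} =
      (\<lambda>x. (p + x) mod n) ` {x. x < n \<and> f ((p + x) mod n) \<noteq> f ((p + Suc x mod n) mod n)}"
    (is "?L = ?g ` ?R")
  proof (intro subset_antisym subsetI)
    fix k assume k: "k \<in> ?L"
    then obtain x where "x < n" "k = ?g x" using rotation_surj[of k n p] by auto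
    with k show "k \<in> ?g ` ?R" by (auto simp: suc)
  next
    fix k assume "k \<in> ?g ` ?R"
    with assms show "k \<in> ?L" by (auto simp: suc)
  qed
  moreover have "inj_on ?g ?R" by (auto simp: inj_on_def rotation_eq_iff)
  ultimately show ?thesis unfolding cyclic_changes_def by (simp add: card_image)
qed

lemma cyclic_closed_all:
  assumes "k < n" "P k" and step: "\<And>k. k < n \<Longrightarrow> P k \<Longrightarrow> P (Suc k mod n)" and "y < n"
  shows "P y"
proof -
  have "P ((k + x) mod n)" for x
  proof (induction x)
    case 0 then show ?case using assms by simp
  next
    case (Suc x)
    have "P (Suc ((k + x) mod n) mod n)" using Suc step assms by simp
    then show ?case by (simp add: mod_Suc_eq)
  qed
  then show ?thesis using rotation_surj[OF \<open>y < n\<close>, of k] by metis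
qed

text \<open>Every letter that occurs is followed somewhere by a different one, since otherwise it would fill
  the word; choosing such a change for each letter is injective.\<close>

lemma card_image_le_cyclic_changes:
  assumes "i < n" "j < n" "f i \<noteq> f j"
  shows "card (f ` {..<n}) \<le> cyclic_changes n f"
proof -
  let ?C = "{k. k < n \<and> f k \<noteq> f (Suc k mod n)}"
  have "f ` {..<n} \<subseteq> f ` ?C"
  proof
    fix u assume "u \<in> f ` {..<n}"
    then obtain k where k: "k < n" "f k = u" by auto
    have "\<exists>k<n. f k = u \<and> f (Suc k mod n) \<noteq> u"
    proof (rule ccontr)
      assume "\<not> ?thesis"
      then have "f y = u" if "y < n" for y
        using cyclic_closed_all[of k n "\<lambda>k. f k = u" y] k that by blast
      then show False using assms by metis
    qed
    then show "u \<in> f ` ?C" by force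
  qed
  then have "card (f ` {..<n}) \<le> card (f ` ?C)" by (intro card_mono) auto
  also have "\<dots> \<le> card ?C" by (rule card_image_le) simp
  finally show ?thesis by (simp add: cyclic_changes_def)
qed

lemma cyclic_changes_ge_2:
  assumes "i < n" "j < n" "f i \<noteq> f j"
  shows "2 \<le> cyclic_changes n f"
proof -
  have "card {f i, f j} \<le> card (f ` {..<n})" using assms by (intro card_mono) auto
  with assms card_image_le_cyclic_changes[of i n j f] show ?thesis by simp
qed

lemma cyclic_changes_ge_3:
  assumes "i < n" "j < n" "k < n" "f i \<noteq> f j" "f j \<noteq> f k" "f i \<noteq> f k"
  shows "3 \<le> cyclic_changes n f"
proof -
  have "card {f i, f j, f k} \<le> card (f ` {..<n})" using assms by (intro card_mono) auto
  with assms card_image_le_cyclic_changes[of i n j f] show ?thesis by simp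
qed

lemma cyclic_changes_cong:
  assumes "\<And>k. k < n \<Longrightarrow> f k = g k"
  shows "cyclic_changes n f = cyclic_changes n g"
proof -
  have "{k. k < n \<and> f k \<noteq> f (Suc k mod n)} = {k. k < n \<and> g k \<noteq> g (Suc k mod n)}"
    using assms by (auto simp: mod_less_divisor)
  then show ?thesis by (simp add: cyclic_changes_def)
qed

lemma cyclic_changes_const:
  assumes "\<And>k. k < n \<Longrightarrow> f k = c"
  shows "cyclic_changes n f = 0"
  using assms cyclic_changes_cong[of n f "\<lambda>_. c"] by (simp add: cyclic_changes_def)

lemma cyclic_changes_comp_le: "cyclic_changes n (\<lambda>k. g (f k)) \<le> cyclic_changes n f"
  unfolding cyclic_changes_def by (rule card_mono) auto

lemma arc_mono: "h \<le> h' \<Longrightarrow> arc n p h \<subseteq> arc n p h'"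
  by (auto simp: arc_def)

lemma arc_subset: "0 < n \<Longrightarrow> arc n p h \<subseteq> {..<n}"
  by (auto simp: arc_def)

lemma finite_arc [simp]: "finite (arc n p h)"
  by (simp add: arc_def)

lemma arc_0 [simp]: "arc n p 0 = {}"
  by (simp add: arc_def)

lemma arc_1 [simp]: "arc n p (Suc 0) = {p mod n}"
  by (simp add: arc_def)

lemma arc_Suc: "arc n p (Suc h) = insert ((p + h) mod n) (arc n p h)"
  by (auto simp: arc_def less_Suc_eq)

lemma arc_mod [simp]: "arc n (p mod n) h = arc n p h"
  by (simp add: arc_def mod_add_left_eq)

lemma rotation_in_arc_iff:
  assumes "x < n" "h \<le> n"
  shows "(p + x) mod n \<in> arc n p h \<longleftrightarrow> x < h"
  using assms by (auto simp: arc_def rotation_eq_iff)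

lemma arc_eq_image: "arc n p h = (\<lambda>x. (p + x) mod n) ` {..<h}"
  by (auto simp: arc_def)

lemma card_arc:
  assumes "h \<le> n"
  shows "card (arc n p h) = h"
proof -
  have "inj_on (\<lambda>x. (p + x) mod n) {..<h}" using assms by (auto simp: inj_on_def rotation_eq_iff)
  then show ?thesis by (simp add: arc_eq_image card_image)
qed

lemma arc_full:
  assumes "0 < n"
  shows "arc n p n = {..<n}"
  using arc_subset[OF assms, of p n] card_arc[of n n p] by (intro card_subset_eq) auto

lemma cyclic_changes_arc_le_2:
  assumes "0 < n" "h \<le> n"
  shows "cyclic_changes n (\<lambda>x. if x \<in> arc n p h then b else a) \<le> 2"
proof -
  have "cyclic_changes n (\<lambda>x. if x \<in> arc n p h then b else a) =
      cyclic_changes n (\<lambda>x. if (p + x) mod n \<in> arc n p h then b else a)"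
    using cyclic_changes_rotate[OF assms(1), of "\<lambda>x. if x \<in> arc n p h then b else a" p] by simp
  also have "\<dots> = cyclic_changes n (\<lambda>x. if x < h then b else a)"
    using assms by (intro cyclic_changes_cong) (simp add: rotation_in_arc_iff)
  also have "\<dots> \<le> card {h - 1, n - 1}"
    unfolding cyclic_changes_def by (rule card_mono) (auto simp: mod_Suc split: if_splits)
  also have "\<dots> \<le> 2" by (simp add: card_insert_if)
  finally show ?thesis .
qed

text \<open>Going round, one enters \<open>B\<close> at some \<open>p\<close> and leaves it again; a second entry would be a third
  change.\<close>

lemma arc_if_cyclic_changes_le_2:
  assumes "0 < n" "B \<subseteq> {..<n}" and changes: "cyclic_changes n (\<lambda>x. x \<in> B) \<le> 2"
  obtains p where "p < n" "B = arc n p (card B)"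
proof -
  consider "B = {}" | "B = {..<n}" | i j where "i \<in> B" "j < n" "j \<notin> B" using assms(2) by blast
  then have "\<exists>p<n. B = arc n p (card B)"
  proof cases
    case 1 with assms(1) show ?thesis by auto
  next
    case 2 then show ?thesis using assms(1) by (auto simp: arc_full)
  next
    case 3
    have "\<exists>k<n. k \<notin> B \<and> Suc k mod n \<in> B"
      using cyclic_closed_all[of j n "\<lambda>k. k \<notin> B" i] 3 assms(2) by blast
    then obtain k where k: "k < n" "k \<notin> B" "Suc k mod n \<in> B" by blast
    define p where "p = Suc k mod n"
    define g where "g x \<longleftrightarrow> (p + x) mod n \<in> B" for x
    have p: "p < n" using assms(1) by (simp add: p_def)
    have g0: "g 0" using k p by (simp add: g_def p_def)
    have "(p + (n - 1)) mod n = (Suc k + (n - 1)) mod n" unfolding p_def by (rule mod_add_left_eq)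
    also have "\<dots> = k" using k by simp
    finally have gn: "\<not> g (n - 1)" using k by (simp add: g_def)
    define h where "h = (LEAST x. \<not> g x)"
    have h: "\<not> g h" unfolding h_def using gn by (rule LeastI)
    have hn: "h \<le> n - 1" unfolding h_def using gn by (rule Least_le)
    have less_h: "g x" if "x < h" for x using not_less_Least[of x "\<lambda>x. \<not> g x"] that by (auto simp: h_def)
    have h0: "0 < h" using g0 h by (cases h) auto
    have ge_h: "\<not> g x" if "h \<le> x" "x < n" for x
      using that
    proof (induction x rule: dec_induct)
      case base show ?case by (rule h)
    next
      case (step x)
      show ?case
      proof
        assume "g (Suc x)"
        with step h hn h0 less_h g0 gn
        have "{h - 1, x, n - 1} \<subseteq> {k. k < n \<and> g k \<noteq> g (Suc k mod n)}"
          by (auto simp: mod_Suc)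
        then have "card {h - 1, x, n - 1} \<le> cyclic_changes n g"
          unfolding cyclic_changes_def by (intro card_mono) auto
        moreover have "h - 1 \<noteq> x" "h - 1 \<noteq> n - 1" "x \<noteq> n - 1" using step h0 by auto
        then have "card {h - 1, x, n - 1} = 3" by simp
        moreover have "cyclic_changes n g \<le> 2"
          using changes cyclic_changes_rotate[OF assms(1), of "\<lambda>x. x \<in> B" p] by (simp add: g_def[abs_def])
        ultimately show False by simp
      qed
    qed
    have "B = arc n p h"
    proof (intro subset_antisym subsetI)
      fix y assume y: "y \<in> B"
      then obtain x where x: "x < n" "y = (p + x) mod n" using rotation_surj[of y n p] assms(2) by auto
      with y ge_h have "x < h" by (metis g_def not_le)
      with x show "y \<in> arc n p h" by (auto simp: arc_def)
    next
      fix y assume "y \<in> arc n p h" then show "y \<in> B" using less_h by (auto simp: arc_def g_def)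
    qed
    moreover have "h \<le> n" using hn by simp
    ultimately show ?thesis using p card_arc by metis
  qed
  then show ?thesis using that by blast
qed

section \<open>The energy counts the changes along rows and columns\<close>

definition defect :: "nat \<Rightarrow> nat \<Rightarrow> config \<Rightarrow> nat" where
  "defect K L \<sigma> = (\<Sum>i<K. cyclic_changes L (\<lambda>j. \<sigma> (i, j))) + (\<Sum>j<L. cyclic_changes K (\<lambda>i. \<sigma> (i, j)))"

lemma card_verts: "card (verts K L) = K * L"
  by (simp add: verts_def)

lemma finite_verts [simp]: "finite (verts K L)"
  by (simp add: verts_def)

lemma in_verts [simp]: "(i, j) \<in> verts K L \<longleftrightarrow> i < K \<and> j < L"
  by (auto simp: verts_def)

lemma verts_eq: "verts K L = {..<K} \<times> {..<L}"
  by (auto simp: verts_def)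

lemma card_eq_sum_of_bool: "(\<Sum>k<n. of_bool (P k)) = int (card {k. k < (n::nat) \<and> P k})"
proof -
  have "(\<Sum>k<n. of_bool (P k)) = (\<Sum>k\<in>{k \<in> {..<n}. P k}. 1::int)"
    by (simp only: sum.inter_filter[OF finite_lessThan] of_bool_def)
  then show ?thesis by simp
qed

text \<open>With at least three rows and columns, sending a vertex to the edge towards its right neighbour,
  or to the one towards its lower neighbour, is injective and the two images are disjoint; so
  each of the \<open>2 * K * L\<close> edges is counted once as a step in a cyclic row or column.\<close>

lemma energy_eq_defect:
  assumes "3 \<le> K" "3 \<le> L"
  shows "energy K L \<sigma> = int (defect K L \<sigma>) - 2 * int (K * L)"
proof -
  define hr where "hr = (\<lambda>v::vertex. (fst v, Suc (snd v) mod L))"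
  define vr where "vr = (\<lambda>v::vertex. (Suc (fst v) mod K, snd v))"
  let ?V = "verts K L"
  let ?h = "\<lambda>v. {v, hr v}" and ?v = "\<lambda>v. {v, vr v}"
  have E: "edges K L = ?h ` ?V \<union> ?v ` ?V"
  proof (intro subset_antisym subsetI)
    fix e assume "e \<in> edges K L"
    then obtain v w where e: "e = {v, w}" "v \<in> ?V" "w \<in> ?V" "nearest_neighbour K L v w"
      by (auto simp: edges_def)
    from e(4) consider "w = hr v" | "v = hr w" | "w = vr v" | "v = vr w"
      by (auto simp: nearest_neighbour_def hr_def vr_def prod_eq_iff)
    then show "e \<in> ?h ` ?V \<union> ?v ` ?V" using e by cases (auto simp: insert_commute)
  next
    fix e assume "e \<in> ?h ` ?V \<union> ?v ` ?V"
    then obtain v where v: "v \<in> ?V" "e = {v, hr v} \<or> e = {v, vr v}" by auto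
    moreover have "hr v \<in> ?V" "vr v \<in> ?V" using v assms by (auto simp: hr_def vr_def verts_def)
    moreover have "nearest_neighbour K L v (hr v)" "nearest_neighbour K L v (vr v)"
      by (auto simp: nearest_neighbour_def hr_def vr_def)
    ultimately show "e \<in> edges K L" unfolding edges_def by blast
  qed
  have two_steps: "Suc (Suc j mod n) mod n \<noteq> j" "j \<noteq> Suc (Suc j mod n) mod n" "Suc j mod n \<noteq> j" "j \<noteq> Suc j mod n" if "3 \<le> n" "j < n" for j n :: nat
    using that by (auto simp: mod_Suc)
  have injh: "inj_on ?h ?V"
    using two_steps(2)[OF assms(2)] by (auto simp: inj_on_def doubleton_eq_iff hr_def)
  have injv: "inj_on ?v ?V"
    using two_steps(2)[OF assms(1)] by (auto simp: inj_on_def doubleton_eq_iff vr_def)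
  have disj: "?h ` ?V \<inter> ?v ` ?V = {}"
    using two_steps(3,4)[OF assms(1)] two_steps(3,4)[OF assms(2)]
    by (auto simp: doubleton_eq_iff hr_def vr_def)
  define a :: "vertex set \<Rightarrow> int" where "a e = of_bool (\<forall>v\<in>e. \<forall>w\<in>e. \<sigma> v = \<sigma> w)" for e
  have a_pair: "a {v, w} = 1 - of_bool (\<sigma> v \<noteq> \<sigma> w)" for v w
    unfolding a_def by (cases "\<sigma> v = \<sigma> w") auto
  have "(\<Sum>e\<in>edges K L. a e) = (\<Sum>e\<in>?h ` ?V. a e) + (\<Sum>e\<in>?v ` ?V. a e)"
    unfolding E using disj by (intro sum.union_disjoint) auto
  also have "\<dots> = (\<Sum>v\<in>?V. a (?h v)) + (\<Sum>v\<in>?V. a (?v v))"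
    by (simp add: sum.reindex[OF injh] sum.reindex[OF injv])
  also have "(\<Sum>v\<in>?V. a (?h v)) = (\<Sum>v\<in>?V. 1 - of_bool (\<sigma> v \<noteq> \<sigma> (hr v)))"
    by (simp only: a_pair)
  also have "(\<Sum>v\<in>?V. a (?v v)) = (\<Sum>v\<in>?V. 1 - of_bool (\<sigma> v \<noteq> \<sigma> (vr v)))"
    by (simp only: a_pair)
  also have "(\<Sum>v\<in>?V. 1 - of_bool (\<sigma> v \<noteq> \<sigma> (hr v)) :: int) =
      int (K * L) - int (\<Sum>i<K. cyclic_changes L (\<lambda>j. \<sigma> (i, j)))"
  proof -
    have "(\<Sum>v\<in>?V. of_bool (\<sigma> v \<noteq> \<sigma> (hr v)) :: int) =
        (\<Sum>i<K. \<Sum>j<L. of_bool (\<sigma> (i, j) \<noteq> \<sigma> (i, Suc j mod L)))"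
      unfolding verts_eq by (subst sum.cartesian_product) (rule sum.cong, auto simp: hr_def)
    then show ?thesis
      by (simp add: sum_subtractf card_verts card_eq_sum_of_bool cyclic_changes_def)
  qed
  also have "(\<Sum>v\<in>?V. 1 - of_bool (\<sigma> v \<noteq> \<sigma> (vr v)) :: int) =
      int (K * L) - int (\<Sum>j<L. cyclic_changes K (\<lambda>i. \<sigma> (i, j)))"
  proof -
    have "(\<Sum>v\<in>?V. of_bool (\<sigma> v \<noteq> \<sigma> (vr v)) :: int) =
        (\<Sum>i<K. \<Sum>j<L. of_bool (\<sigma> (i, j) \<noteq> \<sigma> (Suc i mod K, j)))"
      unfolding verts_eq by (subst sum.cartesian_product) (rule sum.cong, auto simp: vr_def)
    also have "\<dots> = (\<Sum>j<L. \<Sum>i<K. of_bool (\<sigma> (i, j) \<noteq> \<sigma> (Suc i mod K, j)))"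
      by (rule sum.swap)
    finally show ?thesis
      by (simp add: sum_subtractf card_verts card_eq_sum_of_bool cyclic_changes_def)
  qed
  finally show ?thesis by (simp add: energy_def defect_def a_def)
qed

section \<open>Mixed rows and columns\<close>

definition mixed :: "nat \<Rightarrow> (nat \<Rightarrow> 'a) \<Rightarrow> bool" where
  "mixed n f \<longleftrightarrow> (\<exists>i<n. \<exists>j<n. f i \<noteq> f j)"

abbreviation row :: "config \<Rightarrow> nat \<Rightarrow> nat \<Rightarrow> nat" where
  "row \<sigma> i \<equiv> \<lambda>j. \<sigma> (i, j)"

abbreviation col :: "config \<Rightarrow> nat \<Rightarrow> nat \<Rightarrow> nat" where
  "col \<sigma> j \<equiv> \<lambda>i. \<sigma> (i, j)"

definition area :: "nat \<Rightarrow> nat \<Rightarrow> nat set \<Rightarrow> config \<Rightarrow> nat" where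
  "area K L M \<sigma> = card {v \<in> verts K L. \<sigma> v \<in> M}"

lemma mixedI: "i < n \<Longrightarrow> j < n \<Longrightarrow> f i \<noteq> f j \<Longrightarrow> mixed n f"
  unfolding mixed_def by blast

lemma not_mixedD: "\<not> mixed n f \<Longrightarrow> i < n \<Longrightarrow> j < n \<Longrightarrow> f i = f j"
  unfolding mixed_def by blast

lemma mixed_changes: "mixed n f \<Longrightarrow> 2 \<le> cyclic_changes n f"
  by (auto simp: mixed_def intro: cyclic_changes_ge_2)

lemma sum_ge_card:
  fixes F :: "nat \<Rightarrow> nat"
  assumes "\<And>i. i < n \<Longrightarrow> P i \<Longrightarrow> 2 \<le> F i"
  shows "2 * card {i. i < n \<and> P i} \<le> (\<Sum>i<n. F i)"
proof -
  have "2 * card {i. i < n \<and> P i} = (\<Sum>i\<in>{i. i < n \<and> P i}. 2)" by simp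
  also have "\<dots> \<le> (\<Sum>i\<in>{i. i < n \<and> P i}. F i)" using assms by (intro sum_mono) auto
  also have "\<dots> \<le> (\<Sum>i<n. F i)" by (intro sum_mono2) auto
  finally show ?thesis .
qed

lemma defect_ge:
  "2 * card {i. i < K \<and> mixed L (row \<sigma> i)} + 2 * card {j. j < L \<and> mixed K (col \<sigma> j)} \<le> defect K L \<sigma>"
  unfolding defect_def by (intro add_mono sum_ge_card mixed_changes)

lemma area_rows: "area K L M \<sigma> = (\<Sum>i<K. card {j. j < L \<and> \<sigma> (i, j) \<in> M})"
proof -
  have "{v \<in> verts K L. \<sigma> v \<in> M} = Sigma {..<K} (\<lambda>i. {j. j < L \<and> \<sigma> (i, j) \<in> M})"
    by auto
  then show ?thesis by (simp add: area_def)
qed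

lemma area_cols: "area K L M \<sigma> = (\<Sum>j<L. card {i. i < K \<and> \<sigma> (i, j) \<in> M})"
proof -
  have "{v \<in> verts K L. \<sigma> v \<in> M} = prod.swap ` Sigma {..<L} (\<lambda>j. {i. i < K \<and> \<sigma> (i, j) \<in> M})"
    by (auto simp: image_iff)
  then show ?thesis by (simp add: area_def card_image)
qed

lemma area_compl: "area K L (- M) \<sigma> = K * L - area K L M \<sigma>"
proof -
  have "{v \<in> verts K L. \<sigma> v \<in> - M} = verts K L - {v \<in> verts K L. \<sigma> v \<in> M}" by auto
  then show ?thesis unfolding area_def
    by (metis (no_types, lifting) card_Diff_subset card_verts finite_subset finite_verts mem_Collect_eq subsetI)
qed

lemma area_le: "area K L M \<sigma> \<le> K * L"
  unfolding area_def by (metis (no_types, lifting) card_mono card_verts finite_verts mem_Collect_eq subsetI)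

section \<open>Low configurations of intermediate area are strips\<close>

locale torus =
  fixes K L :: nat
  assumes K_ge_3: "3 \<le> K" and K_less_L: "K < L"
begin

abbreviation "rows_mixed \<sigma> \<equiv> \<forall>i<K. mixed L (row \<sigma> i)"

lemma L_ge_4: "4 \<le> L" using K_ge_3 K_less_L by simp

text \<open>If there is a constant row, either some column is constant as well, and then a single spin covers
  everything outside a product of few rows and few columns; or no column is constant, and then
  \<open>L = K + 1\<close>, all rows are constant and the area is a multiple of \<open>L\<close>.\<close>

lemma rows_mixed_if_medium_area:
  assumes low: "defect K L \<sigma> \<le> 2 * K + 2"
    and lower: "(K + 1) ^ 2 < 4 * area K L M \<sigma>"
    and upper: "(K + 1) ^ 2 < 4 * (K * L - area K L M \<sigma>)"
    and no_rows: "L = K + 1 \<Longrightarrow> \<not> L dvd area K L M \<sigma>"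
  shows "rows_mixed \<sigma>"
proof (rule ccontr)
  assume "\<not> rows_mixed \<sigma>"
  then obtain i0 where i0: "i0 < K" "\<not> mixed L (row \<sigma> i0)" by auto
  define R where "R = {i. i < K \<and> mixed L (row \<sigma> i)}"
  define C where "C = {j. j < L \<and> mixed K (col \<sigma> j)}"
  have RC: "card R + card C \<le> K + 1" using defect_ge[of K L \<sigma>] low by (simp add: R_def C_def)
  show False
  proof (cases "\<exists>j<L. \<not> mixed K (col \<sigma> j)")
    case True
    then obtain j0 where j0: "j0 < L" "\<not> mixed K (col \<sigma> j0)" by auto
    define c where "c = \<sigma> (i0, j0)"
    have other: "{v \<in> verts K L. \<sigma> v \<noteq> c} \<subseteq> R \<times> C"
    proof clarify
      fix i j assume v: "(i, j) \<in> verts K L" "\<sigma> (i, j) \<noteq> c"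
      have "\<sigma> (i, j0) = c" "\<sigma> (i0, j) = c"
        using not_mixedD[OF j0(2), of i i0] not_mixedD[OF i0(2), of j j0] v i0 j0 by (auto simp: c_def)
      then show "i \<in> R \<and> j \<in> C" using v i0 j0 by (auto simp: R_def C_def intro: mixedI)
    qed
    have "card {v \<in> verts K L. \<sigma> v \<noteq> c} \<le> card (R \<times> C)"
      by (intro card_mono other) (simp add: R_def C_def)
    then have few: "card {v \<in> verts K L. \<sigma> v \<noteq> c} \<le> card R * card C" by (simp add: card_cartesian_product)
    \<comment> \<open>The area of a box of given perimeter is largest for the square.\<close>
    have "int (4 * (card R * card C)) \<le> (int (card R + card C)) ^ 2"
      using zero_le_power2[of "int (card R) - int (card C)"] by (simp add: power2_eq_square algebra_simps)
    also have "\<dots> \<le> (int (K + 1)) ^ 2" using RC by (intro power_mono) auto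
    finally have prod: "4 * (card R * card C) \<le> (K + 1) ^ 2" by (metis of_nat_le_iff of_nat_power)
    have "area K L N \<sigma> \<le> card R * card C" if "c \<notin> N" for N
      unfolding area_def using that by (intro order_trans[OF card_mono few]) auto
    from this[of M] this[of "- M"] show False
      using lower upper prod by (cases "c \<in> M") (auto simp: area_compl)
  next
    case False
    then have "C = {..<L}" by (auto simp: C_def)
    with RC K_less_L have "card R = 0" and L: "L = K + 1" by auto
    then have R: "R = {}" by (simp add: R_def)
    have "L dvd card {j. j < L \<and> \<sigma> (i, j) \<in> M}" if "i < K" for i
    proof -
      have "\<not> mixed L (row \<sigma> i)" using R that by (auto simp: R_def)
      then obtain d where d: "\<sigma> (i, j) = d" if "j < L" for j
        unfolding mixed_def by blast
      show ?thesis
      proof (cases "d \<in> M")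
        case True
        with d have "{j. j < L \<and> \<sigma> (i, j) \<in> M} = {..<L}" by auto
        then show ?thesis by simp
      next
        case False
        with d have "{j. j < L \<and> \<sigma> (i, j) \<in> M} = {}" by auto
        then show ?thesis by (simp only: card.empty dvd_0_right)
      qed
    qed
    then have "L dvd area K L M \<sigma>" unfolding area_rows by (intro dvd_sum) auto
    with no_rows L show False by blast
  qed
qed

text \<open>The \<open>K\<close> rows use up a defect of \<open>2 * K\<close>, so the nonconstant column \<open>c0\<close> is the only one and all
  words change exactly twice. Outside \<open>c0\<close> all rows agree; according to the number of changes that
  lie there, \<open>c0\<close> is an exception in a constant torus (excluded by the area), or its spins
  are taken from the two spins on its sides, or it is constant (excluded by assumption).\<close>

lemma strip_shape:
  assumes low: "defect K L \<sigma> \<le> 2 * K + 2" and rows: "rows_mixed \<sigma>"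
    and lower: "K < area K L M \<sigma>" and upper: "area K L M \<sigma> < K * (L - 1)"
    and col: "c0 < L" "mixed K (col \<sigma> c0)"
  obtains a b j w p h c where "a \<notin> M" "b \<in> M" "j < L" "0 < w" "w + 2 \<le> L" "p < K" "0 < h" "h < K"
    "c = j + w \<or> c = j + L - 1" "area K L M \<sigma> = w * K + h"
    "\<And>x y. x < K \<Longrightarrow> y < L \<Longrightarrow>
       \<sigma> (x, y) = (if (x, y) \<in> {..<K} \<times> arc L j w \<union> arc K p h \<times> {c mod L} then b else a)"
proof -
  note obt = that
  have K0: "0 < K" and L0: "0 < L" using K_ge_3 K_less_L by auto
  let ?r = "\<lambda>i. cyclic_changes L (row \<sigma> i)" and ?c = "\<lambda>j. cyclic_changes K (col \<sigma> j)"
  have row_ge: "2 \<le> ?r i" if "i < K" for i using that rows by (intro mixed_changes) auto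
  have rs: "2 * K \<le> (\<Sum>i<K. ?r i)"
    using sum_mono[of "{..<K}" "\<lambda>_. 2" ?r] row_ge by simp
  have c0: "2 \<le> ?c c0" using col by (intro mixed_changes) auto
  have cs: "?c c0 + (\<Sum>j\<in>{..<L} - {c0}. ?c j) = (\<Sum>j<L. ?c j)"
    using col by (simp add: sum.remove[of "{..<L}" c0])
  have sums: "(\<Sum>i<K. ?r i) + (\<Sum>j<L. ?c j) \<le> 2 * K + 2" using low by (simp add: defect_def)
  have col2: "?c c0 = 2" and rest: "(\<Sum>j\<in>{..<L} - {c0}. ?c j) = 0" and rs2: "(\<Sum>i<K. ?r i) = 2 * K"
    using rs c0 cs sums by linarith+
  have row2: "?r x = 2" if "x < K" for x
  proof (rule ccontr)
    assume "?r x \<noteq> 2"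
    with row_ge[OF that] have "2 < ?r x" by simp
    then have "(\<Sum>i<K. 2) < (\<Sum>i<K. ?r i)"
      using that row_ge by (intro sum_strict_mono_ex1) auto
    with rs2 show False by simp
  qed
  define F where "F y = \<sigma> (0, y)" for y
  define G where "G x = \<sigma> (x, c0)" for x
  have F: "\<sigma> (x, y) = F y" if "x < K" "y < L" "y \<noteq> c0" for x y
  proof -
    have "?c y = 0" using rest that by auto
    then have "\<not> mixed K (col \<sigma> y)" using mixed_changes by fastforce
    from not_mixedD[OF this, of x 0] show ?thesis using that K0 by (simp add: F_def)
  qed
  define f where "f k = F ((c0 + k) mod L)" for k
  have shift_ne: "(c0 + k) mod L \<noteq> c0" if "0 < k" "k < L" for k
    using rotation_eq_iff[of k L 0 c0] that col(1) by auto
  \<comment> \<open>The changes of a row that do not involve the column \<open>c0\<close>.\<close>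
  define P where "P = {k. 0 < k \<and> k < L - 1 \<and> f k \<noteq> f (Suc k)}"
  have count: "card P + of_bool (G x \<noteq> f 1) + of_bool (f (L - 1) \<noteq> G x) = (2::nat)" if x: "x < K" for x
  proof -
    define g where "g k = (if k = 0 then G x else f k)" for k
    have "cyclic_changes L (\<lambda>k. \<sigma> (x, (c0 + k) mod L)) = 2"
      using cyclic_changes_rotate[OF L0, of "row \<sigma> x" c0] row2[OF x] by simp
    moreover have "cyclic_changes L (\<lambda>k. \<sigma> (x, (c0 + k) mod L)) = cyclic_changes L g"
      using F[OF x] shift_ne L0 col(1) by (intro cyclic_changes_cong) (auto simp: g_def f_def G_def)
    ultimately have "card {k. k < L \<and> g k \<noteq> g (Suc k mod L)} = 2" by (simp add: cyclic_changes_def)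
    moreover have "{k. k < L \<and> g k \<noteq> g (Suc k mod L)} =
        P \<union> (if G x \<noteq> f 1 then {0} else {}) \<union> (if f (L - 1) \<noteq> G x then {L - 1} else {})" (is "_ = ?U")
    proof (rule set_eqI)
      fix k
      consider "k = 0" | "0 < k" "k < L - 1" | "k = L - 1" | "L \<le> k" by linarith
      then show "k \<in> {k. k < L \<and> g k \<noteq> g (Suc k mod L)} \<longleftrightarrow> k \<in> ?U"
        using L_ge_4 by cases (auto simp: g_def P_def)
    qed
    moreover have "card ?U = card P + of_bool (G x \<noteq> f 1) + of_bool (f (L - 1) \<noteq> G x)"
    proof -
      have "finite P" "0 \<notin> P" "L - 1 \<notin> P" by (auto simp: P_def)
      then show ?thesis using L_ge_4 by auto
    qed
    ultimately show ?thesis by simp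
  qed
  have mixG: "\<exists>x<K. \<exists>x'<K. G x \<noteq> G x'" using col by (auto simp: mixed_def G_def)
  \<comment> \<open>The situation common to bars attached after and before the strip.\<close>
  have finish: thesis
    if abM: "a \<notin> M" "b \<in> M" and jw: "j < L" "0 < w" "w + 2 \<le> L"
      and c: "c = j + w \<or> c = j + L - 1" "c mod L = c0"
      and c0J: "c0 \<notin> arc L j w" and FJ: "\<And>y. y < L \<Longrightarrow> y \<noteq> c0 \<Longrightarrow> F y = (if y \<in> arc L j w then b else a)"
      and Gab: "\<And>x. x < K \<Longrightarrow> G x = a \<or> G x = b" for a b j w c
  proof -
    define B where "B = {x. x < K \<and> G x = b}"
    have ab: "a \<noteq> b" using abM by auto
    have "cyclic_changes K (\<lambda>x. x \<in> B) = cyclic_changes K (\<lambda>x. G x = b)"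
      by (intro cyclic_changes_cong) (auto simp: B_def)
    also have "\<dots> \<le> 2" using cyclic_changes_comp_le[of K "\<lambda>v. v = b" G] col2
      by (simp add: G_def[abs_def])
    finally obtain p where p: "p < K" "B = arc K p (card B)"
      using arc_if_cyclic_changes_le_2[OF K0, of B] by (auto simp: B_def)
    define h where "h = card B"
    have "B \<subseteq> {..<K}" "B \<noteq> {}" "B \<noteq> {..<K}" using mixG Gab ab by (auto simp: B_def)
    then have h: "0 < h" "h < K"
      using psubset_card_mono[of "{..<K}" B] finite_subset[of B "{..<K}"] by (auto simp: h_def card_gt_0_iff)
    have shape: "\<sigma> (x, y) = (if (x, y) \<in> {..<K} \<times> arc L j w \<union> arc K p h \<times> {c mod L} then b else a)"
      if xy: "x < K" "y < L" for x y
    proof (cases "y = c0")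
      case True
      have "x \<in> arc K p h \<longleftrightarrow> G x = b" unfolding p(2)[folded h_def, symmetric] using xy by (simp add: B_def)
      with True c(2) c0J show ?thesis using Gab[of x] xy by (auto simp: G_def)
    next
      case False
      with c(2) show ?thesis using F[of x y] FJ[of y] xy by simp
    qed
    have "{v \<in> verts K L. \<sigma> v \<in> M} = {..<K} \<times> arc L j w \<union> arc K p h \<times> {c0}"
      using shape abM c(2) col(1) arc_subset[OF K0, of p h] arc_subset[OF L0, of j w]
      by (auto split: if_splits)
    moreover have "card ({..<K} \<times> arc L j w \<union> arc K p h \<times> {c0}) = K * w + h"
    proof -
      have "card ({..<K} \<times> arc L j w \<union> arc K p h \<times> {c0}) = 
          card ({..<K} \<times> arc L j w) + card (arc K p h \<times> {c0})"
        using c0J by (intro card_Un_disjoint) auto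
      then show ?thesis using jw h by (simp add: card_cartesian_product card_arc)
    qed
    ultimately have "area K L M \<sigma> = w * K + h" by (simp add: area_def mult.commute)
    with shape show thesis using abM jw c p h by (intro obt[of a b j w p h c]) auto
  qed
  have other: "\<exists>k. 0 < k \<and> k < L \<and> y = (c0 + k) mod L" if y: "y < L" "y \<noteq> c0" for y
  proof -
    obtain k where "k < L" "y = (c0 + k) mod L" using rotation_surj[OF y(1)] by blast
    with y col(1) show ?thesis by (cases "k = 0") auto
  qed
  have f_step: "f k = f (Suc k)" if "0 < k" "k < L - 1" "k \<notin> P" for k using that by (auto simp: P_def)
  have const_on: "f k = f l" if "0 < k" "k \<le> l" "l < L" "\<And>m. k \<le> m \<Longrightarrow> m < l \<Longrightarrow> m \<notin> P" for k l
    using that(2,3,4)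
  proof (induction l rule: dec_induct)
    case (step l)
    then show ?case using f_step[of l] that(1) by auto
  qed simp
  have whole: "area K L M \<sigma> = K * L" if "\<And>x y. x < K \<Longrightarrow> y < L \<Longrightarrow> \<sigma> (x, y) \<in> M"
  proof -
    have "{v \<in> verts K L. \<sigma> v \<in> M} = verts K L" using that by auto
    then show ?thesis by (simp add: area_def card_verts)
  qed
  have none: "area K L M \<sigma> = 0" if "\<And>x y. x < K \<Longrightarrow> y < L \<Longrightarrow> \<sigma> (x, y) \<notin> M"
    using that by (auto simp: area_def)
  consider "card P = 0" | "card P = 1" | "2 \<le> card P" by linarith
  then show thesis
  proof cases
    case 1
    then have "P = {}" by (simp add: P_def)
    have "F y = f 1" if y: "y < L" "y \<noteq> c0" for y
    proof -
      obtain k where "0 < k" "k < L" "y = (c0 + k) mod L" using other[OF y] by blast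
      with const_on[of 1 k] \<open>P = {}\<close> show ?thesis by (simp add: f_def)
    qed
    then have A: "\<sigma> (x, y) = f 1" if "x < K" "y < L" "y \<noteq> c0" for x y using F that by simp
    show thesis
    proof (cases "f 1 \<in> M")
      case True
      then have "{..<K} \<times> ({..<L} - {c0}) \<subseteq> {v \<in> verts K L. \<sigma> v \<in> M}" using A by auto
      from card_mono[OF _ this] have "K * (L - 1) \<le> area K L M \<sigma>"
        using col(1) by (simp add: area_def card_cartesian_product)
      with upper show thesis by simp
    next
      case False
      with A have "y = c0" if "x < K" "y < L" "\<sigma> (x, y) \<in> M" for x y using that by metis
      then have "{v \<in> verts K L. \<sigma> v \<in> M} \<subseteq> {..<K} \<times> {c0}" by auto
      from card_mono[OF _ this] have "area K L M \<sigma> \<le> K"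
        by (simp add: area_def card_cartesian_product)
      with lower show thesis by simp
    qed
  next
    case 3
    then have "G x = f 1" if "x < K" for x using count[OF that] by (cases "G x = f 1") auto
    with mixG show thesis by metis
  next
    case 2
    then obtain k0 where k0: "P = {k0}" by (auto simp: card_1_singleton_iff)
    then have k0b: "0 < k0" "k0 < L - 1" "f k0 \<noteq> f (Suc k0)" by (auto simp: P_def)
    define \<alpha> where "\<alpha> = f 1"
    define \<beta> where "\<beta> = f (L - 1)"
    have fa: "f k = \<alpha>" if "0 < k" "k \<le> k0" for k
      using const_on[of 1 k] that k0 k0b by (auto simp: \<alpha>_def)
    have fb: "f k = \<beta>" if "k0 < k" "k < L" for k
      using const_on[of k "L - 1"] that k0 k0b by (auto simp: \<beta>_def)
    have ne: "\<alpha> \<noteq> \<beta>" using k0b fa[of k0] fb[of "Suc k0"] by auto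
    have Gab: "G x = \<alpha> \<or> G x = \<beta>" if "x < K" for x
      using count[OF that] 2 unfolding \<alpha>_def \<beta>_def
      by (cases "G x = f 1"; cases "G x = f (L - 1)") auto
    have vals: "\<sigma> (x, y) = \<alpha> \<or> \<sigma> (x, y) = \<beta>" if "x < K" "y < L" for x y
    proof (cases "y = c0")
      case True then show ?thesis using Gab that by (simp add: G_def)
    next
      case False
      then obtain k where k: "0 < k" "k < L" "y = (c0 + k) mod L" using other \<open>y < L\<close> by blast
      have "f k = \<alpha> \<or> f k = \<beta>" using fa[of k] fb[of k] k by linarith
      then show ?thesis using F[OF that False] k by (simp add: f_def)
    qed
    consider "\<alpha> \<in> M" "\<beta> \<in> M" | "\<alpha> \<notin> M" "\<beta> \<notin> M" | "\<alpha> \<notin> M" "\<beta> \<in> M" | "\<alpha> \<in> M" "\<beta> \<notin> M" by blast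
    then show thesis
    proof cases
      case 1
      with whole vals have "area K L M \<sigma> = K * L" by metis
      moreover have "K * (L - 1) \<le> K * L" by simp
      ultimately show thesis using upper by linarith
    next
      case 2
      with none vals have "area K L M \<sigma> = 0" by metis
      with lower show thesis by simp
    next
      case 3
      define j where "j = (c0 + Suc k0) mod L"
      define w where "w = L - 1 - k0"
      have J: "(c0 + k) mod L \<in> arc L j w \<longleftrightarrow> k0 < k" if "k < L" for k
      proof -
        have "(j + x) mod L = (c0 + (Suc k0 + x)) mod L" for x
          unfolding j_def by (metis add.assoc mod_add_left_eq)
        then have "(c0 + k) mod L \<in> arc L j w \<longleftrightarrow> (\<exists>x<w. (c0 + k) mod L = (c0 + (Suc k0 + x)) mod L)"
          by (auto simp: arc_def)
        also have "\<dots> \<longleftrightarrow> (\<exists>x<w. k = Suc k0 + x)"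
          using that by (intro ex_cong1 conj_cong refl rotation_eq_iff) (auto simp: w_def)
        also have "\<dots> \<longleftrightarrow> k0 < k" using that by (auto simp: w_def intro!: exI[of _ "k - Suc k0"])
        finally show ?thesis .
      qed
      show thesis
      proof (rule finish[of \<alpha> \<beta> j w "j + w"])
        show "(j + w) mod L = c0"
        proof -
          have "(j + w) mod L = (c0 + Suc k0 + w) mod L" unfolding j_def by (rule mod_add_left_eq)
          also have "c0 + Suc k0 + w = c0 + L" using k0b by (simp add: w_def)
          finally show ?thesis using col(1) by simp
        qed
        show "c0 \<notin> arc L j w" using J[of 0] col(1) L0 by simp
        show "F y = (if y \<in> arc L j w then \<beta> else \<alpha>)" if "y < L" "y \<noteq> c0" for y
        proof -
          obtain k where k: "0 < k" "k < L" "y = (c0 + k) mod L" using other[OF \<open>y < L\<close> \<open>y \<noteq> c0\<close>] by blast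
          with J[of k] fa[of k] fb[of k] show ?thesis by (simp add: f_def)
        qed
      qed (use 3 k0b L0 Gab in \<open>auto simp: w_def j_def\<close>)
    next
      case 4
      define j where "j = (c0 + 1) mod L"
      have J: "(c0 + k) mod L \<in> arc L j k0 \<longleftrightarrow> 0 < k \<and> k \<le> k0" if "k < L" for k
      proof -
        have "(j + x) mod L = (c0 + (1 + x)) mod L" for x
          unfolding j_def by (metis add.assoc mod_add_left_eq)
        then have "(c0 + k) mod L \<in> arc L j k0 \<longleftrightarrow> (\<exists>x<k0. (c0 + k) mod L = (c0 + (1 + x)) mod L)"
          by (auto simp: arc_def)
        also have "\<dots> \<longleftrightarrow> (\<exists>x<k0. k = 1 + x)"
          using that k0b by (intro ex_cong1 conj_cong refl rotation_eq_iff) auto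
        also have "\<dots> \<longleftrightarrow> 0 < k \<and> k \<le> k0" by (auto intro!: exI[of _ "k - 1"])
        finally show ?thesis .
      qed
      show thesis
      proof (rule finish[of \<beta> \<alpha> j k0 "j + L - 1"])
        show "(j + L - 1) mod L = c0"
        proof -
          have "(j + L - 1) mod L = (j + (L - 1)) mod L" using L0 by simp
          also have "\<dots> = (c0 + 1 + (L - 1)) mod L" unfolding j_def by (rule mod_add_left_eq)
          also have "c0 + 1 + (L - 1) = c0 + L" using L0 by simp
          finally show ?thesis using col(1) by simp
        qed
        show "c0 \<notin> arc L j k0" using J[of 0] col(1) L0 by simp
        show "F y = (if y \<in> arc L j k0 then \<alpha> else \<beta>)" if "y < L" "y \<noteq> c0" for y
        proof -
          obtain k where k: "0 < k" "k < L" "y = (c0 + k) mod L" using other[OF \<open>y < L\<close> \<open>y \<noteq> c0\<close>] by blast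
          with J[of k] fa[of k] fb[of k] show ?thesis by (simp add: f_def)
        qed
      qed (use 4 k0b L0 Gab in \<open>auto simp: j_def\<close>)
    qed
  qed
qed

end

section \<open>Updates of single spins, and rectangles as products of arcs\<close>

lemma rectangle_eq: "rectangle K L i j a b = arc K i b \<times> arc L j a"
  by (auto simp: rectangle_def arc_def)

lemma config_eq_two_spin:
  assumes "\<sigma> \<in> configs q K L" "\<And>x y. x < K \<Longrightarrow> y < L \<Longrightarrow> \<sigma> (x, y) = (if (x, y) \<in> A then b else a)"
  shows "\<sigma> = two_spin_config K L a b A"
proof
  fix v :: vertex
  show "\<sigma> v = two_spin_config K L a b A v"
  proof (cases "v \<in> verts K L")
    case True
    then obtain x y where "v = (x, y)" "x < K" "y < L" by (auto simp: verts_def)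
    then show ?thesis using assms(2)[of x y] by (simp add: two_spin_config_def)
  next
    case False
    then show ?thesis using assms(1) by (auto simp: configs_def two_spin_config_def)
  qed
qed

lemma two_spin_apply: "x < K \<Longrightarrow> y < L \<Longrightarrow> two_spin_config K L a b A (x, y) = (if (x, y) \<in> A then b else a)"
  by (simp add: two_spin_config_def)

definition adjacent :: "nat \<Rightarrow> nat \<Rightarrow> config \<Rightarrow> config \<Rightarrow> bool" where
  "adjacent K L \<sigma> \<eta> \<longleftrightarrow> (\<exists>v\<in>verts K L. \<forall>w\<in>verts K L. w \<noteq> v \<longrightarrow> \<sigma> w = \<eta> w)"

lemma adjacent_sym: "adjacent K L \<sigma> \<eta> \<Longrightarrow> adjacent K L \<eta> \<sigma>"
  unfolding adjacent_def by metis

lemma adjacentE: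
  assumes "adjacent K L \<sigma> \<eta>"
  obtains x y where "x < K" "y < L"
    "\<And>x' y'. x' < K \<Longrightarrow> y' < L \<Longrightarrow> x' \<noteq> x \<or> y' \<noteq> y \<Longrightarrow> \<sigma> (x', y') = \<eta> (x', y')"
proof -
  obtain v where v: "v \<in> verts K L" "\<forall>w\<in>verts K L. w \<noteq> v \<longrightarrow> \<sigma> w = \<eta> w"
    using assms by (auto simp: adjacent_def)
  show thesis by (rule that[of "fst v" "snd v"]) (use v in \<open>auto simp: verts_def\<close>)
qed

lemma area_adjacent_le:
  assumes "adjacent K L \<sigma> \<eta>"
  shows "area K L M \<eta> \<le> area K L M \<sigma> + 1"
proof -
  obtain v where v: "v \<in> verts K L" "\<forall>w\<in>verts K L. w \<noteq> v \<longrightarrow> \<sigma> w = \<eta> w"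
    using assms by (auto simp: adjacent_def)
  then have "{w \<in> verts K L. \<eta> w \<in> M} \<subseteq> insert v {w \<in> verts K L. \<sigma> w \<in> M}" by auto
  then have "area K L M \<eta> \<le> card (insert v {w \<in> verts K L. \<sigma> w \<in> M})"
    unfolding area_def by (intro card_mono) auto
  also have "\<dots> \<le> area K L M \<sigma> + 1" by (simp add: area_def card_insert_if)
  finally show ?thesis .
qed

lemma arc_skip:
  assumes "0 < n" "x < n"
  shows "arc n (Suc x) (n - 1) = {..<n} - {x}"
proof (rule card_subset_eq)
  have "(Suc x + (n - 1)) mod n \<notin> arc n (Suc x) (n - 1)"
    using assms rotation_in_arc_iff[of "n - 1" n "n - 1" "Suc x"] by simp
  moreover have "(Suc x + (n - 1)) mod n = x" using assms by simp
  ultimately show "arc n (Suc x) (n - 1) \<subseteq> {..<n} - {x}" using arc_subset[OF assms(1)] by fastforce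
  show "card (arc n (Suc x) (n - 1)) = card ({..<n} - {x})" using assms by (simp add: card_arc)
qed simp

text \<open>An arc that misses \<open>x\<close> lies in the arc of length \<open>n - 1\<close> that starts behind \<open>x\<close>. It provides
  the offset of a bar next to a column from which the row \<open>x\<close> is missing.\<close>

lemma arc_inside:
  assumes "x < n" "p < n" "h < n" "x \<notin> arc n p h"
  shows "\<exists>m. m + h \<le> n - 1 \<and> p = (Suc x mod n + m) mod n"
proof -
  obtain m where m: "m < n" "p = (Suc x mod n + m) mod n" using rotation_surj[OF assms(2)] by blast
  have "m + h \<le> n - 1"
  proof (rule ccontr)
    assume "\<not> ?thesis"
    then have in_arc: "(p + (n - 1 - m)) mod n \<in> arc n p h"
      using rotation_in_arc_iff[of "n - 1 - m" n h p] m assms(3) by auto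
    have "(p + (n - 1 - m)) mod n = (Suc x mod n + m + (n - 1 - m)) mod n" unfolding m(2) by (rule mod_add_left_eq)
    also have "Suc x mod n + m + (n - 1 - m) = Suc x mod n + (n - 1)" using m by simp
    also have "(Suc x mod n + (n - 1)) mod n = (Suc x + (n - 1)) mod n" by (rule mod_add_left_eq)
    also have "\<dots> = x" using assms(1) by simp
    finally show False using in_arc assms(4) by simp
  qed
  with m show ?thesis by blast
qed

context torus
begin

lemma K0 [simp]: "0 < K" and L0 [simp]: "0 < L"
  using K_ge_3 K_less_L by auto

text \<open>If all columns were constant, the vertices with spin in \<open>M\<close> would form a union of columns.\<close>

lemma exists_mixed_col:
  assumes indiv: "\<not> K dvd area K L M \<sigma>"
  shows "\<exists>c0<L. mixed K (col \<sigma> c0)"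
proof (rule ccontr)
  assume none: "\<not> ?thesis"
  have "K dvd card {i. i < K \<and> \<sigma> (i, j) \<in> M}" if "j < L" for j
  proof -
    obtain d where d: "\<sigma> (i, j) = d" if "i < K" for i
      using none \<open>j < L\<close> unfolding mixed_def by blast
    show ?thesis
    proof (cases "d \<in> M")
      case True
      with d have "{i. i < K \<and> \<sigma> (i, j) \<in> M} = {..<K}" by auto
      then show ?thesis by simp
    next
      case False
      with d have "{i. i < K \<and> \<sigma> (i, j) \<in> M} = {}" by auto
      then show ?thesis by (simp only: card.empty dvd_0_right)
    qed
  qed
  then have "K dvd area K L M \<sigma>" unfolding area_cols by (intro dvd_sum) auto
  with indiv show False by blast
qed

lemma strip_shape_indivisible:
  assumes low: "defect K L \<sigma> \<le> 2 * K + 2" and rows: "rows_mixed \<sigma>"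
    and lower: "K < area K L M \<sigma>" and upper: "area K L M \<sigma> < K * (L - 1)"
    and indiv: "\<not> K dvd area K L M \<sigma>"
  obtains a b j w p h c where "a \<notin> M" "b \<in> M" "j < L" "0 < w" "w + 2 \<le> L" "p < K" "0 < h" "h < K"
    "c = j + w \<or> c = j + L - 1" "area K L M \<sigma> = w * K + h"
    "\<And>x y. x < K \<Longrightarrow> y < L \<Longrightarrow>
       \<sigma> (x, y) = (if (x, y) \<in> {..<K} \<times> arc L j w \<union> arc K p h \<times> {c mod L} then b else a)"
proof -
  obtain c0 where c0: "c0 < L" "mixed K (col \<sigma> c0)" using exists_mixed_col[OF indiv] by blast
  show thesis by (rule strip_shape[OF low rows lower upper c0]) (rule that)
qed

text \<open>The shape of a strip with a bar, put into the form of the gates: the width and the height of the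
  bar are quotient and remainder of the area.\<close>

lemma strip_config:
  assumes conf: "\<sigma> \<in> configs q K L"
    and low: "defect K L \<sigma> \<le> 2 * K + 2" and rows: "rows_mixed \<sigma>"
    and lower: "K < area K L M \<sigma>" and upper: "area K L M \<sigma> < K * (L - 1)"
    and indiv: "\<not> K dvd area K L M \<sigma>"
  obtains a b where "a \<in> spins q - M" "b \<in> spins q \<inter> M"
    "\<sigma> \<in> B_bar K L (area K L M \<sigma> mod K) (area K L M \<sigma> div K) K a b"
proof -
  obtain a b j w p h c where ab: "a \<notin> M" "b \<in> M" and j: "j < L" "0 < w" "w + 2 \<le> L" "p < K" "0 < h" "h < K"
    and c: "c = j + w \<or> c = j + L - 1" and ar: "area K L M \<sigma> = w * K + h"
    and shape: "\<And>x y. x < K \<Longrightarrow> y < L \<Longrightarrow>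
       \<sigma> (x, y) = (if (x, y) \<in> {..<K} \<times> arc L j w \<union> arc K p h \<times> {c mod L} then b else a)"
    by (rule strip_shape_indivisible[OF low rows lower upper indiv]) (rule that)
  have spin: "\<sigma> v \<in> spins q" if "v \<in> verts K L" for v using conf that by (auto simp: configs_def)
  have val: "\<sigma> v = a \<or> \<sigma> v = b" if "v \<in> verts K L" for v
    using shape[of "fst v" "snd v"] that by (auto simp: verts_def split: if_splits)
  have "{v \<in> verts K L. \<sigma> v \<in> M} \<noteq> {}"
  proof
    assume "{v \<in> verts K L. \<sigma> v \<in> M} = {}"
    then have "area K L M \<sigma> = 0" by (simp only: area_def card.empty)
    with lower show False by simp
  qed
  then obtain v where "v \<in> verts K L" "\<sigma> v \<in> M" by blast
  then have b: "b \<in> spins q" using spin val ab by metis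
  have "{v \<in> verts K L. \<sigma> v \<in> M} \<noteq> verts K L"
  proof
    assume "{v \<in> verts K L. \<sigma> v \<in> M} = verts K L"
    then have "area K L M \<sigma> = K * L" by (simp add: area_def card_verts)
    moreover have "K * (L - 1) \<le> K * L" by simp
    ultimately show False using upper by linarith
  qed
  then obtain v where "v \<in> verts K L" "\<sigma> v \<notin> M" by blast
  then have a: "a \<in> spins q" using spin val ab by metis
  have "\<sigma> = two_spin_config K L a b (rectangle K L p j w K \<union> rectangle K L (p + 0) c 1 h)"
    by (rule config_eq_two_spin[OF conf]) (use shape in \<open>simp add: rectangle_eq arc_full\<close>)
  then have "\<sigma> \<in> B_bar K L h w K a b"
    unfolding B_bar_def using j c by fastforce
  moreover have "area K L M \<sigma> mod K = h" "area K L M \<sigma> div K = w" using ar j by auto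
  ultimately show thesis using that a b ab by auto
qed

section \<open>How a low path enters the strips\<close>

text \<open>How many vertices of one row have their spin in \<open>M\<close>. This tells which spin a row had before it
  became mixed: at least \<open>L - 1\<close> of its vertices have not changed.\<close>

lemma row_counts:
  assumes low: "defect K L \<sigma> \<le> 2 * K + 2" and rows: "rows_mixed \<sigma>"
    and lower: "2 * K \<le> area K L M \<sigma>" and upper: "area K L M \<sigma> < K * (L - 1)" and x: "x < K"
  defines "r \<equiv> card {y. y < L \<and> \<sigma> (x, y) \<in> M}"
  shows "2 \<le> r" "r < L" "L \<le> r + 1 \<Longrightarrow> K * (L - 2) < area K L M \<sigma>"
proof -
  have "2 \<le> r \<and> r < L \<and> (L \<le> r + 1 \<longrightarrow> K * (L - 2) < area K L M \<sigma>)"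
  proof (cases "\<exists>c0<L. mixed K (col \<sigma> c0)")
    case False
    have "{y. y < L \<and> \<sigma> (x', y) \<in> M} = {y. y < L \<and> \<sigma> (x, y) \<in> M}" if "x' < K" for x'
    proof -
      have "\<sigma> (x', y) = \<sigma> (x, y)" if "y < L" for y
        using False that \<open>x' < K\<close> x unfolding mixed_def by blast
      then show ?thesis by (intro Collect_cong conj_cong refl) simp
    qed
    then have "area K L M \<sigma> = K * r" by (simp add: area_rows r_def)
    with lower upper have "2 \<le> r" "r < L - 1" by (auto simp: mult.commute[of 2])
    then show ?thesis by auto
  next
    case True
    then obtain c0 where c0: "c0 < L" "mixed K (col \<sigma> c0)" by blast
    have lower': "K < area K L M \<sigma>" using lower K_ge_3 by linarith
    obtain a b j w p h c where ab: "a \<notin> M" "b \<in> M" and j: "j < L" "0 < w" "w + 2 \<le> L" "p < K" "0 < h" "h < K"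
    and c: "c = j + w \<or> c = j + L - 1" and ar: "area K L M \<sigma> = w * K + h"
    and shape: "\<And>x y. x < K \<Longrightarrow> y < L \<Longrightarrow>
       \<sigma> (x, y) = (if (x, y) \<in> {..<K} \<times> arc L j w \<union> arc K p h \<times> {c mod L} then b else a)"
      by (rule strip_shape[OF low rows lower' upper c0]) (rule that)
    have w: "2 \<le> w"
    proof (rule ccontr)
      assume "\<not> 2 \<le> w"
      then have "w * K \<le> 1 * K" by (intro mult_right_mono) auto
      with ar lower j show False by simp
    qed
    have "arc L j w \<subseteq> {y. y < L \<and> \<sigma> (x, y) \<in> M}"
      using shape ab x arc_subset[OF L0, of j w] by auto
    from card_mono[OF _ this] have wr: "w \<le> r" using j by (simp add: r_def card_arc)
    have "{y. y < L \<and> \<sigma> (x, y) \<in> M} \<subseteq> insert (c mod L) (arc L j w)"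
      using shape ab x by (auto split: if_splits)
    from card_mono[OF _ this] have rw: "r \<le> w + 1" using j by (simp add: r_def card_arc card_insert_if split: if_splits)
    have big: "K * (L - 2) < area K L M \<sigma>" if "L \<le> w + 2"
    proof -
      have "w = L - 2" using that j by simp
      with ar j show ?thesis by (simp add: mult.commute)
    qed
    show ?thesis
    proof (intro conjI impI)
      show "2 \<le> r" using w wr by simp
      show "r < L" using rw j by simp
      show "K * (L - 2) < area K L M \<sigma>" if "L \<le> r + 1" by (rule big) (use that rw in simp)
    qed
  qed
  then show "2 \<le> r" "r < L" "L \<le> r + 1 \<Longrightarrow> K * (L - 2) < area K L M \<sigma>" by auto
qed

text \<open>If the area were at least \<open>2 * K\<close>, every row would contain two vertices with spin in \<open>M\<close>, so the
  row that becomes mixed was constant with a spin in \<open>M\<close>. Then the strip nearly fills the torus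
  and the area dropped in this step, contrary to the bound on the previous area.\<close>

lemma entering_area:
  assumes adj: "adjacent K L \<sigma> \<eta>" and const: "\<not> rows_mixed \<sigma>"
    and low: "defect K L \<eta> \<le> 2 * K + 2" and rows: "rows_mixed \<eta>"
    and small: "area K L M \<sigma> < m" "area K L M \<eta> \<le> m" and m: "m \<le> K * (L - 2) + 2"
  shows "area K L M \<eta> < 2 * K"
proof (rule ccontr)
  assume "\<not> ?thesis"
  then have lower: "2 * K \<le> area K L M \<eta>" by simp
  have "K * (L - 2) + K = K * (L - 1)"
  proof -
    have "L - 1 = Suc (L - 2)" using L_ge_4 by simp
    then show ?thesis by simp
  qed
  then have upper: "area K L M \<eta> < K * (L - 1)" using small m K_ge_3 by linarith
  obtain x d where x: "x < K" and d: "\<And>y. y < L \<Longrightarrow> \<sigma> (x, y) = d"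
    using const unfolding mixed_def by blast
  obtain x1 y1 where v: "x1 < K" "y1 < L" and eq: "\<And>x' y'. x' < K \<Longrightarrow> y' < L \<Longrightarrow> x' \<noteq> x1 \<or> y' \<noteq> y1 \<Longrightarrow> \<sigma> (x', y') = \<eta> (x', y')"
    using adjacentE[OF adj] by metis
  have row: "\<eta> (x, y) = d" if "y < L" "y \<noteq> y1" for y using eq[OF x, of y] d[of y] that by simp
  let ?S = "{y. y < L \<and> \<eta> (x, y) \<in> M}"
  note counts = row_counts[OF low rows lower upper x]
  show False
  proof (cases "d \<in> M")
    case False
    with row have "?S \<subseteq> {y1}" by auto
    from card_mono[OF _ this] have "card ?S \<le> 1" by simp
    with counts(1) show False by simp
  next
    case True
    with row have sub: "{..<L} - {y1} \<subseteq> ?S" by auto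
    from card_mono[OF _ this] have "L - 1 \<le> card ?S" using v by simp
    then have big: "K * (L - 2) < area K L M \<eta>" using counts(3) by simp
    have "?S \<noteq> {..<L}" using counts(2) by (metis card_lessThan less_irrefl)
    with sub have y1: "\<eta> (x, y1) \<notin> M" by auto
    then have "x1 = x" using eq[of x y1] d[of y1] True x v by metis
    then have "insert (x, y1) {v \<in> verts K L. \<eta> v \<in> M} \<subseteq> {v \<in> verts K L. \<sigma> v \<in> M}"
    proof -
      have "\<sigma> w \<in> M" if "w \<in> verts K L" "\<eta> w \<in> M" for w
      proof -
        have "w \<noteq> (x, y1)" using that y1 by auto
        then have "\<sigma> w = \<eta> w" using that(1) eq[of "fst w" "snd w"] \<open>x1 = x\<close> by (cases w) auto
        with that show ?thesis by simp
      qed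
      then show ?thesis using x v d True by auto
    qed
    then have "card (insert (x, y1) {v \<in> verts K L. \<eta> v \<in> M}) \<le> area K L M \<sigma>"
      unfolding area_def by (intro card_mono) auto
    then have "area K L M \<eta> + 1 \<le> area K L M \<sigma>" using y1 by (simp add: area_def)
    with big small m show False by linarith
  qed
qed

text \<open>Backwards in time: the strip is one column wide, and the only way to make a row constant by one
  update is to remove the vertex of the column in a row that the bar does not touch. A column of
  length \<open>K - 1\<close> with a bar beside it remains.\<close>

lemma entering_from_B:
  assumes adj: "adjacent K L \<sigma> \<eta>" and const: "\<not> rows_mixed \<sigma>"
    and conf: "\<sigma> \<in> configs q K L" "\<eta> \<in> configs q K L"
    and low: "defect K L \<eta> \<le> 2 * K + 2" and rows: "rows_mixed \<eta>"
    and ar: "area K L M \<eta> = K + h" and h: "0 < h" "h < K"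
  obtains a b where "a \<in> spins q - M" "b \<in> spins q \<inter> M" "\<sigma> \<in> B_bar K L h 1 (K - 1) a b"
proof -
  have upper: "area K L M \<eta> < K * (L - 1)"
  proof -
    have "K * 3 \<le> K * (L - 1)" using L_ge_4 by (intro mult_left_mono) auto
    with ar h show ?thesis by linarith
  qed
  have lower: "K < area K L M \<eta>" using ar h by simp
  have indiv: "\<not> K dvd area K L M \<eta>" using ar h by (simp add: dvd_add_right_iff nat_dvd_not_less)
  obtain a0 b0 where ab0: "a0 \<in> spins q - M" "b0 \<in> spins q \<inter> M"
    "\<eta> \<in> B_bar K L (area K L M \<eta> mod K) (area K L M \<eta> div K) K a0 b0"
    using strip_config[OF conf(2) low rows lower upper indiv] by blast
  obtain a b j w p h' c where ab: "a \<notin> M" "b \<in> M" and j: "j < L" "0 < w" "w + 2 \<le> L" "p < K" "0 < h'" "h' < K"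
    and c: "c = j + w \<or> c = j + L - 1" and ar': "area K L M \<eta> = w * K + h'"
    and shape': "\<And>x y. x < K \<Longrightarrow> y < L \<Longrightarrow>
       \<eta> (x, y) = (if (x, y) \<in> {..<K} \<times> arc L j w \<union> arc K p h' \<times> {c mod L} then b else a)"
    by (rule strip_shape_indivisible[OF low rows lower upper indiv]) (rule that)
  have "w * K + h' = 1 * K + h" using ar ar' by simp
  then have "(w * K + h') div K = (1 * K + h) div K" "(w * K + h') mod K = (1 * K + h) mod K" by simp_all
  then have w: "w = 1" and h': "h' = h" using j h by auto
  have "c = j + 1 \<or> c = j + (L - 1)" using c w L_ge_4 by auto
  then have cj: "c mod L \<noteq> j"
    using rotation_eq_iff[of 1 L 0 j] rotation_eq_iff[of "L - 1" L 0 j] j(1) L_ge_4 by auto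
  have shape: "\<eta> (x, y) = (if y = j \<or> (x \<in> arc K p h \<and> y = c mod L) then b else a)"
    if "x < K" "y < L" for x y using shape' that j by (auto simp: w h')
  have spin: "\<eta> v \<in> spins q" if "v \<in> verts K L" for v using conf that by (auto simp: configs_def)
  obtain x d where x: "x < K" and d: "\<And>y. y < L \<Longrightarrow> \<sigma> (x, y) = d"
    using const unfolding mixed_def by blast
  obtain x1 y1 where v: "x1 < K" "y1 < L" and eq: "\<And>x' y'. x' < K \<Longrightarrow> y' < L \<Longrightarrow> x' \<noteq> x1 \<or> y' \<noteq> y1 \<Longrightarrow> \<sigma> (x', y') = \<eta> (x', y')"
    using adjacentE[OF adj] by metis
  have "\<not> {..<L} \<subseteq> {j, c mod L, y1}"
  proof
    assume "{..<L} \<subseteq> {j, c mod L, y1}"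
    then have "card {..<L} \<le> card {j, c mod L, y1}" by (intro card_mono) auto
    moreover have "card {j, c mod L, y1} \<le> 3" by (simp add: card_insert_if)
    ultimately show False using L_ge_4 by simp
  qed
  then obtain y2 where y2: "y2 < L" "y2 \<noteq> j" "y2 \<noteq> c mod L" "y2 \<noteq> y1" by auto
  have "\<sigma> (x, y2) = \<eta> (x, y2)" using eq[OF x y2(1)] y2(4) by simp
  then have da: "d = a" unfolding d[OF y2(1)] shape[OF x y2(1)] using y2 by simp
  have "\<eta> (x, j) \<noteq> \<sigma> (x, j)" unfolding shape[OF x j(1)] d[OF j(1)] using da ab by auto
  then have v_eq: "x1 = x" "y1 = j" using eq[OF x j(1)] by metis+
  have x_arc: "x \<notin> arc K p h"
  proof
    assume "x \<in> arc K p h"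
    then have "\<eta> (x, c mod L) = b" using shape[OF x, of "c mod L"] by simp
    moreover have "\<sigma> (x, c mod L) = \<eta> (x, c mod L)" 
    proof (rule eq[OF x])
      show "x \<noteq> x1 \<or> c mod L \<noteq> y1" using cj v_eq by auto
    qed simp
    moreover have "\<sigma> (x, c mod L) = d" by (rule d) simp
    ultimately show False using da ab by simp
  qed
  define i where "i = Suc x mod K"
  obtain m where m: "m + h \<le> K - 1" "p = (i + m) mod K"
    using arc_inside[OF x j(4) h(2) x_arc] unfolding i_def by blast
  have arcs: "arc K i (K - 1) = {..<K} - {x}" "arc K (i + m) h = arc K p h"
    using arc_skip[OF K0 x] m(2) by (simp_all add: i_def)
  have "\<sigma> = two_spin_config K L a b (rectangle K L i j 1 (K - 1) \<union> rectangle K L (i + m) c 1 h)"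
  proof (rule config_eq_two_spin[OF conf(1)])
    fix x' y' assume xy: "x' < K" "y' < L"
    show "\<sigma> (x', y') = (if (x', y') \<in> rectangle K L i j 1 (K - 1) \<union> rectangle K L (i + m) c 1 h then b else a)"
    proof (cases "x' = x \<and> y' = j")
      case True
      then have "\<sigma> (x', y') = a" using d[OF j(1)] da by simp
      with True cj show ?thesis unfolding rectangle_eq arcs by simp
    next
      case False
      then have "\<sigma> (x', y') = \<eta> (x', y')" using eq[OF xy] v_eq by auto
      with shape[OF xy] have "\<sigma> (x', y') = (if y' = j \<or> (x' \<in> arc K p h \<and> y' = c mod L) then b else a)"
        by simp
      with False j xy show ?thesis unfolding rectangle_eq arcs by auto
    qed
  qed
  moreover have "i < K" by (simp add: i_def)
  ultimately have "\<sigma> \<in> B_bar K L h 1 (K - 1) a b"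
    unfolding B_bar_def using j c w m(1) by fastforce
  moreover have "a \<in> spins q" using spin[of "(x, y2)"] shape[OF x y2(1)] x y2 by simp
  moreover have "b \<in> spins q" using spin[of "(x, j)"] shape[OF x j(1)] x j by simp
  ultimately show thesis using that ab by auto
qed

lemma B_bar_square: "B_bar K L (K - 1) 1 (K - 1) a b \<subseteq> R_bar K L 2 (K - 1) a b"
proof
  fix \<sigma> assume "\<sigma> \<in> B_bar K L (K - 1) 1 (K - 1) a b"
  then obtain i j m c where \<sigma>: "\<sigma> = two_spin_config K L a b (rectangle K L i j 1 (K - 1) \<union> rectangle K L (i + m) c 1 (K - 1))"
    and ij: "i < K" "j < L" "m + (K - 1) \<le> K - 1" "c = j + 1 \<or> c = j + L - 1"
    unfolding B_bar_def by blast
  have A: "rectangle K L i j 1 (K - 1) \<union> rectangle K L (i + m) c 1 (K - 1) = arc K i (K - 1) \<times> {j, c mod L}"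
  proof -
    have "m = 0" using ij(3) by simp
    then show ?thesis using ij(2) by (auto simp: rectangle_eq)
  qed
  from ij(4) have "\<exists>j'<L. arc L j' 2 = {j, c mod L}"
  proof
    assume "c = j + 1"
    then show ?thesis using ij by (auto simp: numeral_2_eq_2 arc_Suc intro!: exI[of _ j])
  next
    assume c: "c = j + L - 1"
    have "(c + 1) mod L = j" using c ij by simp
    then have "arc L (c mod L) 2 = {j, c mod L}" by (auto simp: numeral_2_eq_2 arc_Suc mod_Suc_eq)
    then show ?thesis by (intro exI[of _ "c mod L"]) auto
  qed
  then obtain j' where "j' < L" "arc L j' 2 = {j, c mod L}" by blast
  then have "\<sigma> = two_spin_config K L a b (rectangle K L i j' 2 (K - 1))"
    using \<sigma> A by (simp add: rectangle_eq)
  then show "\<sigma> \<in> R_bar K L 2 (K - 1) a b" unfolding R_bar_def using ij \<open>j' < L\<close> by blast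
qed


text \<open>A low configuration next to a rectangle \<open>R_bar\<close> that has a constant row. The rectangle has
  \<open>K - 1\<close> mixed rows and two mixed columns, which exhausts the defect; so the updated vertex lies in
  one of the two columns, its new spin is the background spin, and it is an end of that column, for
  otherwise the column would break into two pieces.\<close>

lemma entering_R:
  assumes \<eta>R: "\<eta> \<in> R_bar K L 2 (K - 1) a b" and ab: "a \<noteq> b"
    and adj: "adjacent K L \<sigma> \<eta>" and const: "\<not> rows_mixed \<sigma>" and ne: "\<sigma> \<noteq> \<eta>"
    and conf: "\<sigma> \<in> configs q K L" "\<eta> \<in> configs q K L" and low: "defect K L \<sigma> \<le> 2 * K + 2"
  shows "\<sigma> \<in> B_bar K L (K - 2) 1 (K - 1) a b"
proof -
  obtain i j where ij: "i < K" "j < L" and \<eta>: "\<eta> = two_spin_config K L a b (rectangle K L i j 2 (K - 1))"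
    using \<eta>R unfolding R_bar_def by blast
  define x0 where "x0 = (i + (K - 1)) mod K"
  define j2 where "j2 = Suc j mod L"
  have x0: "x0 < K" by (simp add: x0_def)
  have "Suc x0 mod K = (Suc i + (K - 1)) mod K" by (simp add: x0_def mod_Suc_eq)
  also have "\<dots> = i" using ij by simp
  finally have Suc_x0: "Suc x0 mod K = i" .
  have arc_x0: "arc K i (K - 1) = {..<K} - {x0}"
    using arc_skip[OF K0 x0] arc_mod[of K "Suc x0" "K - 1"] Suc_x0 by simp
  have arc_j: "arc L j 2 = {j, j2}" using ij by (auto simp: numeral_2_eq_2 arc_Suc j2_def)
  have j2: "j2 < L" "j2 \<noteq> j" using ij L_ge_4 by (auto simp: j2_def mod_Suc)
  have \<eta>_val: "\<eta> (x, y) = (if x \<noteq> x0 \<and> (y = j \<or> y = j2) then b else a)" if "x < K" "y < L" for x y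
    unfolding \<eta> two_spin_apply[OF that] rectangle_eq arc_x0 arc_j using that by auto
  obtain x1 y1 where v: "x1 < K" "y1 < L" and eq: "\<And>x' y'. x' < K \<Longrightarrow> y' < L \<Longrightarrow> x' \<noteq> x1 \<or> y' \<noteq> y1 \<Longrightarrow> \<sigma> (x', y') = \<eta> (x', y')"
    using adjacentE[OF adj] by metis
  have changed: "\<sigma> (x1, y1) \<noteq> \<eta> (x1, y1)"
  proof
    assume same: "\<sigma> (x1, y1) = \<eta> (x1, y1)"
    have "\<sigma> w = \<eta> w" if "w \<in> verts K L" for w
    proof (cases w)
      case (Pair x y)
      then show ?thesis using same eq[of x y] that by (cases "x = x1 \<and> y = y1") auto
    qed
    then have "\<sigma> = \<eta>" using conf unfolding configs_def by (intro PiE_ext) auto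
    with ne show False by simp
  qed
  have val: "\<sigma> (x, y) = (if x \<noteq> x0 \<and> (y = j \<or> y = j2) then b else a)"
    if "x < K" "y < L" "x \<noteq> x1 \<or> y \<noteq> y1" for x y
    using eq[OF that] \<eta>_val[OF that(1,2)] by simp
  have "\<exists>y<L. y \<noteq> j \<and> y \<noteq> j2 \<and> y \<noteq> y1"
  proof (rule ccontr)
    assume "\<not> ?thesis"
    then have "{..<L} \<subseteq> {j, j2, y1}" by auto
    then have "card {..<L} \<le> card {j, j2, y1}" by (intro card_mono) auto
    moreover have "card {j, j2, y1} \<le> 3" by (simp add: card_insert_if)
    ultimately show False using L_ge_4 by simp
  qed
  \<comment> \<open>A column that neither the rectangle nor the update touches.\<close>
  then obtain y3 where y3: "y3 < L" "y3 \<noteq> j" "y3 \<noteq> j2" "y3 \<noteq> y1" by blast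
  have rows: "mixed L (row \<sigma> x)" if x: "x < K" "x \<noteq> x0" for x
  proof -
    define y where "y = (if y1 = j then j2 else j)"
    have y: "y < L" "y \<noteq> y1" "y = j \<or> y = j2" using ij j2 by (auto simp: y_def)
    have "\<sigma> (x, y) = b" using val[of x y] x y by auto
    moreover have "\<sigma> (x, y3) = a" using val[of x y3] x y3 by auto
    ultimately show ?thesis using y(1) y3(1) ab by (intro mixedI[of y L y3]) auto
  qed
  have x1: "x1 \<noteq> x0"
  proof
    assume "x1 = x0"
    then have "\<sigma> (x0, y1) \<noteq> a" using changed \<eta>_val[OF v] by simp
    moreover have "\<sigma> (x0, y3) = a" using val[of x0 y3] x0 y3 by auto
    ultimately have "mixed L (row \<sigma> x0)" using v y3 by (intro mixedI[of y1 L y3]) auto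
    with rows const show False by metis
  qed
  have col_x0: "\<sigma> (x0, y) = a" if "y < L" for y using val[of x0 y] x0 x1 that by auto
  have "\<exists>x<K. x \<noteq> x0 \<and> x \<noteq> x1"
  proof (rule ccontr)
    assume "\<not> ?thesis"
    then have "{..<K} \<subseteq> {x0, x1}" by auto
    then have "card {..<K} \<le> card {x0, x1}" by (intro card_mono) auto
    moreover have "card {x0, x1} \<le> 2" by (simp add: card_insert_if)
    ultimately show False using K_ge_3 by simp
  qed
  then obtain x3 where x3: "x3 < K" "x3 \<noteq> x0" "x3 \<noteq> x1" by blast
  have col_x3: "\<sigma> (x3, y) = b" if "y = j \<or> y = j2" for y using val[of x3 y] x3 that ij j2 by auto
  have cols: "mixed K (col \<sigma> y)" if "y = j \<or> y = j2" for y
    using col_x0[of y] col_x3[OF that] that ij j2 x0 x3 ab by (intro mixedI[of x0 K x3]) auto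
  let ?R = "{x. x < K \<and> mixed L (row \<sigma> x)}" and ?C = "{y. y < L \<and> mixed K (col \<sigma> y)}"
  have RC: "card ?R + card ?C \<le> K + 1" using defect_ge[of K L \<sigma>] low by simp
  have "{..<K} - {x0} \<subseteq> ?R" using rows by auto
  from card_mono[OF _ this] have cR: "K - 1 \<le> card ?R" using x0 by simp
  have y1: "y1 = j \<or> y1 = j2"
  proof (rule ccontr)
    assume y1: "\<not> ?thesis"
    then have "\<sigma> (x1, y1) \<noteq> a" using changed \<eta>_val[OF v] by simp
    then have "mixed K (col \<sigma> y1)" using col_x0[OF v(2)] v x0 by (intro mixedI[of x1 K x0]) auto
    then have "{j, j2, y1} \<subseteq> ?C" using cols ij j2 v by auto
    from card_mono[OF _ this] have "3 \<le> card ?C" using y1 j2 by simp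
    with cR RC show False by simp
  qed
  have changes_y1: "cyclic_changes K (col \<sigma> y1) \<le> 2"
  proof -
    define y2 where "y2 = (if y1 = j then j2 else j)"
    have y2: "y2 \<noteq> y1" "y2 < L" "y2 = j \<or> y2 = j2" using y1 ij j2 by (auto simp: y2_def)
    have "2 * (K - 1) \<le> (\<Sum>x<K. cyclic_changes L (row \<sigma> x))"
      using sum_ge_card[of K "\<lambda>x. mixed L (row \<sigma> x)" "\<lambda>x. cyclic_changes L (row \<sigma> x)"] cR mixed_changes
      by force
    moreover have "(\<Sum>y\<in>{y1, y2}. cyclic_changes K (col \<sigma> y)) \<le> (\<Sum>y<L. cyclic_changes K (col \<sigma> y))"
      using v y2 by (intro sum_mono2) auto
    moreover have "2 \<le> cyclic_changes K (col \<sigma> y2)" by (intro mixed_changes cols y2)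
    ultimately show ?thesis using low y2(1) K_ge_3 by (simp add: defect_def)
  qed
  have u: "\<sigma> (x1, y1) = a"
  proof (rule ccontr)
    assume "\<sigma> (x1, y1) \<noteq> a"
    moreover have "\<sigma> (x1, y1) \<noteq> b" using changed \<eta>_val[OF v] x1 y1 by simp
    ultimately have "3 \<le> cyclic_changes K (col \<sigma> y1)"
      using col_x0[OF v(2)] col_x3[OF y1] ab v x0 x3 by (intro cyclic_changes_ge_3[of x1 K x0 x3]) auto
    with changes_y1 show False by simp
  qed
  define B where "B = {..<K} - {x0, x1}"
  have B: "\<sigma> (x, y1) = b \<longleftrightarrow> x \<in> B" if "x < K" for x
  proof (cases "x = x1")
    case True with u ab show ?thesis by (simp add: B_def)
  next
    case False
    with val[of x y1] that v y1 ab show ?thesis by (auto simp: B_def)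
  qed
  have "cyclic_changes K (\<lambda>x. x \<in> B) = cyclic_changes K (\<lambda>x. \<sigma> (x, y1) = b)"
    by (intro cyclic_changes_cong) (simp add: B)
  also have "\<dots> \<le> 2" using cyclic_changes_comp_le[of K "\<lambda>v. v = b" "col \<sigma> y1"] changes_y1 by simp
  finally obtain p where p: "p < K" "B = arc K p (card B)"
    using arc_if_cyclic_changes_le_2[OF K0, of B] by (auto simp: B_def)
  have "card B = K - 2" using x0 v x1 by (simp add: B_def card_Diff_subset)
  with p have p': "arc K p (K - 2) = B" by simp
  have "x0 \<notin> arc K p (K - 2)" unfolding p' by (simp add: B_def)
  then obtain m where m: "m + (K - 2) \<le> K - 1" "p = (i + m) mod K"
    using arc_inside[OF x0 p(1), of "K - 2"] K_ge_3 unfolding Suc_x0 by auto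
  obtain y2 c where y2: "y2 < L" "y2 \<noteq> y1" "c = y2 + 1 \<or> c = y2 + L - 1" "c mod L = y1" "{y1, y2} = {j, j2}"
  proof (cases "y1 = j")
    case True
    have "(j2 + L - 1) mod L = (j2 + (L - 1)) mod L" using L_ge_4 by simp
    also have "\<dots> = (Suc j + (L - 1)) mod L" unfolding j2_def by (rule mod_add_left_eq)
    also have "\<dots> = j" using ij by simp
    finally show ?thesis using True j2 that[of j2 "j2 + L - 1"] by auto
  next
    case False
    then have "y1 = j2" using y1 by simp
    with ij j2 show ?thesis using that[of j "j + 1"] by (auto simp: j2_def)
  qed
  have arcs: "arc K (i + m) (K - 2) = B" using p' m(2) by simp
  have "\<sigma> = two_spin_config K L a b (rectangle K L i y2 1 (K - 1) \<union> rectangle K L (i + m) c 1 (K - 2))"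
  proof (rule config_eq_two_spin[OF conf(1)])
    fix x y assume xy: "x < K" "y < L"
    have one: "arc L y2 1 = {y2}" "arc L c 1 = {y1}" using y2 by simp_all
    have "\<sigma> (x, y) = (if (x, y) \<in> ({..<K} - {x0}) \<times> {y2} \<union> B \<times> {y1} then b else a)"
    proof (cases "y = y1")
      case True
      have "\<sigma> (x, y1) = a \<or> \<sigma> (x, y1) = b" using val[of x y1] u xy v by (cases "x = x1") auto
      with True B[OF xy(1)] y2(2) ab show ?thesis by auto
    next
      case False
      have "y = j \<or> y = j2 \<longleftrightarrow> y = y2" using False y2(5) by blast
      with False val[OF xy] xy show ?thesis by auto
    qed
    then show "\<sigma> (x, y) = (if (x, y) \<in> rectangle K L i y2 1 (K - 1) \<union> rectangle K L (i + m) c 1 (K - 2) then b else a)"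
      unfolding rectangle_eq arc_x0 arcs one .
  qed
  then show ?thesis unfolding B_bar_def using ij y2 m(1) by fastforce
qed

end

section \<open>Every low path passes the gates\<close>

lemma successively_invariant:
  assumes "successively P \<omega>" "\<omega> \<noteq> []" "I (hd \<omega>)"
    and "\<And>\<sigma> \<eta>. \<sigma> \<in> set \<omega> \<Longrightarrow> \<eta> \<in> set \<omega> \<Longrightarrow> P \<sigma> \<eta> \<Longrightarrow> I \<sigma> \<Longrightarrow> I \<eta>"
  shows "I (last \<omega>)"
  using assms
proof (induction \<omega> rule: induct_list012)
  case (3 x y zs)
  have "I y" by (rule "3.prems"(4)[of x]) (use "3.prems" in auto)
  have "I (last (y # zs))"
    by (rule "3.IH"(2)) (use "3.prems" \<open>I y\<close> in auto)
  then show ?case by simp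
qed auto

context torus
begin

definition low_walk :: "nat \<Rightarrow> config list \<Rightarrow> bool" where
  "low_walk q \<omega> \<longleftrightarrow> \<omega> \<noteq> [] \<and> set \<omega> \<subseteq> configs q K L \<and>
     (\<forall>\<sigma>\<in>set \<omega>. defect K L \<sigma> \<le> 2 * K + 2) \<and> successively (adjacent K L) \<omega>"

text \<open>The areas at which every low configuration has mixed rows and at which a path cannot
  have come down from a nearly full torus.\<close>

definition medium :: "nat \<Rightarrow> bool" where
  "medium m \<longleftrightarrow> (K + 1) ^ 2 < 4 * m \<and> (K + 1) ^ 2 < 4 * (K * L - m) \<and>
     2 * K - 1 \<le> m \<and> m \<le> K * (L - 2) + 2 \<and> (L = K + 1 \<longrightarrow> \<not> L dvd m)"

lemma medium_less: "medium m \<Longrightarrow> m < K * L"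
  by (auto simp: medium_def intro: ccontr)

text \<open>The common argument for all gates. A path that avoids the mixed configurations of area \<open>n0\<close> keeps
  the invariant that it has a constant row or an area below \<open>n0\<close>, and hence can never reach the area
  \<open>m\<close>, where all rows are mixed. Rows can become mixed only at an area below \<open>2 * K\<close>; for \<open>n0\<close>
  below that bound, the steps that enter the strips above \<open>n0\<close> must be excluded by
  \<open>enter\<close>, for which a further invariant \<open>J\<close> may be carried along.\<close>

lemma low_walk_hits:
  assumes walk: "low_walk q \<omega>" and start: "area K L M (hd \<omega>) = 0" and stop: "area K L M (last \<omega>) = K * L"
    and m: "medium m" and n0: "0 < n0" "n0 \<le> m"
    and start_J: "J (hd \<omega>)"
    and enter: "\<And>\<sigma> \<eta>. \<lbrakk>\<sigma> \<in> set \<omega>; \<eta> \<in> set \<omega>; \<sigma> \<in> configs q K L; \<eta> \<in> configs q K L; 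
        defect K L \<sigma> \<le> 2 * K + 2; defect K L \<eta> \<le> 2 * K + 2; adjacent K L \<sigma> \<eta>;
        \<not> rows_mixed \<sigma>; rows_mixed \<eta>; J \<sigma>; n0 < area K L M \<eta>; area K L M \<eta> < 2 * K\<rbrakk> \<Longrightarrow> False"
    and keep: "\<And>\<sigma> \<eta>. \<lbrakk>\<sigma> \<in> set \<omega>; \<eta> \<in> set \<omega>; \<sigma> \<in> configs q K L; \<eta> \<in> configs q K L; 
        defect K L \<sigma> \<le> 2 * K + 2; defect K L \<eta> \<le> 2 * K + 2; adjacent K L \<sigma> \<eta>;
        \<not> rows_mixed \<sigma> \<or> area K L M \<sigma> < n0; J \<sigma>\<rbrakk> \<Longrightarrow> J \<eta>"
  shows "\<exists>\<sigma>\<in>set \<omega>. rows_mixed \<sigma> \<and> area K L M \<sigma> = n0"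
proof (rule ccontr)
  assume avoid: "\<not> ?thesis"
  let ?I = "\<lambda>\<sigma>. area K L M \<sigma> < m \<and> J \<sigma> \<and> (\<not> rows_mixed \<sigma> \<or> area K L M \<sigma> < n0)"
  have "?I (last \<omega>)"
  proof (rule successively_invariant[where P = "adjacent K L" and I = ?I])
    show "?I (hd \<omega>)" using start start_J n0 by simp
    fix \<sigma> \<eta> assume in\<omega>: "\<sigma> \<in> set \<omega>" "\<eta> \<in> set \<omega>" and adj: "adjacent K L \<sigma> \<eta>" and I: "?I \<sigma>"
    have conf: "\<sigma> \<in> configs q K L" "\<eta> \<in> configs q K L"
      and low: "defect K L \<sigma> \<le> 2 * K + 2" "defect K L \<eta> \<le> 2 * K + 2"
      using walk in\<omega> by (auto simp: low_walk_def)
    have J: "J \<eta>" using keep[OF in\<omega> conf low adj] I by blast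
    have step: "area K L M \<eta> \<le> area K L M \<sigma> + 1" by (rule area_adjacent_le[OF adj])
    have less: "area K L M \<eta> < n0" if mix: "rows_mixed \<eta>"
    proof (cases "rows_mixed \<sigma>")
      case True
      with I have "area K L M \<eta> \<le> n0" using step by auto
      with avoid in\<omega> mix show ?thesis by force
    next
      case False
      have "area K L M \<eta> < 2 * K"
        using entering_area[OF adj False low(2) mix, of M m] I step m by (auto simp: medium_def)
      then have "\<not> n0 < area K L M \<eta>" using enter[OF in\<omega> conf low adj False mix] I by blast
      with avoid in\<omega> mix show ?thesis by force
    qed
    have "area K L M \<eta> \<noteq> m"
    proof
      assume "area K L M \<eta> = m"
      then have "rows_mixed \<eta>"
        using m unfolding medium_def by (intro rows_mixed_if_medium_area[OF low(2), of M]) simp_all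
      from less[OF this] show False using \<open>area K L M \<eta> = m\<close> n0 by simp
    qed
    with less J I step show "?I \<eta>" by auto
  qed (use walk in \<open>auto simp: low_walk_def\<close>)
  with stop medium_less[OF m] show False by simp
qed

lemma low_walk_hits_area:
  assumes walk: "low_walk q \<omega>" and start: "area K L M (hd \<omega>) = 0" and stop: "area K L M (last \<omega>) = K * L"
    and m: "medium m" and n0: "2 * K - 1 \<le> n0" "n0 \<le> m"
  shows "\<exists>\<sigma>\<in>set \<omega>. rows_mixed \<sigma> \<and> area K L M \<sigma> = n0"
  by (rule low_walk_hits[OF walk start stop m, where J = "\<lambda>_. True"]) (use n0 K_ge_3 in auto)

text \<open>A path that does not enter the strips at or below the area \<open>2 * K - 2\<close> enters them at area
  \<open>2 * K - 1\<close>, and then comes from a rectangle \<open>R_bar\<close>.\<close>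

lemma low_walk_hits_Q:
  assumes walk: "low_walk q \<omega>" and start: "area K L M (hd \<omega>) = 0" and stop: "area K L M (last \<omega>) = K * L"
    and m: "medium m"
  shows "\<exists>a\<in>spins q - M. \<exists>b\<in>spins q \<inter> M. set \<omega> \<inter> Q_bar K L a b \<noteq> {}"
proof (rule ccontr)
  assume avoid: "\<not> ?thesis"
  have "\<exists>\<sigma>\<in>set \<omega>. rows_mixed \<sigma> \<and> area K L M \<sigma> = 2 * K - 2"
  proof (rule low_walk_hits[OF walk start stop m, where J = "\<lambda>_. True"])
    show "0 < 2 * K - 2" using K_ge_3 by simp
    have "2 * K - 1 \<le> m" using m by (simp add: medium_def)
    then show "2 * K - 2 \<le> m" by linarith
    fix \<sigma> \<eta> assume *: "\<sigma> \<in> set \<omega>" "\<eta> \<in> set \<omega>" "\<sigma> \<in> configs q K L" "\<eta> \<in> configs q K L"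
        "defect K L \<sigma> \<le> 2 * K + 2" "defect K L \<eta> \<le> 2 * K + 2" "adjacent K L \<sigma> \<eta>"
        "\<not> rows_mixed \<sigma>" "rows_mixed \<eta>" and ar: "2 * K - 2 < area K L M \<eta>" "area K L M \<eta> < 2 * K"
    have ar': "area K L M \<eta> = K + (K - 1)" using ar by simp
    obtain a b where "a \<in> spins q - M" "b \<in> spins q \<inter> M" "\<sigma> \<in> B_bar K L (K - 1) 1 (K - 1) a b"
      using entering_from_B[OF *(7,8,3,4,6,9) ar'] K_ge_3 by auto
    then show False using avoid *(1) B_bar_square[of a b] unfolding Q_bar_def by blast
  qed auto
  then obtain \<sigma> where \<sigma>: "\<sigma> \<in> set \<omega>" "rows_mixed \<sigma>" "area K L M \<sigma> = 2 * K - 2" by blast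
  have conf: "\<sigma> \<in> configs q K L" and low: "defect K L \<sigma> \<le> 2 * K + 2"
    using walk \<sigma> by (auto simp: low_walk_def)
  define k where "k = K - 2"
  have k: "area K L M \<sigma> = K + k" "k < K" using \<sigma>(3) K_ge_3 by (simp_all add: k_def)
  then have dm: "area K L M \<sigma> div K = 1" "area K L M \<sigma> mod K = K - 2"
    by (simp_all add: k_def[symmetric])
  have upper: "area K L M \<sigma> < K * (L - 1)"
  proof -
    have "K * 3 \<le> K * (L - 1)" using L_ge_4 by (intro mult_left_mono) auto
    with \<sigma> K_ge_3 show ?thesis by linarith
  qed
  have lower: "K < area K L M \<sigma>" using \<sigma> K_ge_3 by simp
  have indiv: "\<not> K dvd area K L M \<sigma>" using dm K_ge_3 by (simp add: dvd_eq_mod_eq_0)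
  obtain a b where "a \<in> spins q - M" "b \<in> spins q \<inter> M" "\<sigma> \<in> B_bar K L (K - 2) 1 K a b"
    using strip_config[OF conf low \<sigma>(2) lower upper indiv] dm by auto
  with avoid \<sigma>(1) show False unfolding Q_bar_def by blast
qed

text \<open>A path that enters the strips above the area \<open>K + i\<close> comes from a short column with a bar of height
  \<open>h > i\<close>. This is an element of \<open>H_bar\<close> unless \<open>h = K - 1\<close>, when it is a rectangle \<open>R_bar\<close>;
  so the invariant also keeps track of not having reached such a rectangle, which is possible
  only through \<open>h = K - 2\<close> or from the strips.\<close>

lemma low_walk_hits_H:
  assumes walk: "low_walk q \<omega>" and start: "area K L M (hd \<omega>) = 0" and stop: "area K L M (last \<omega>) = K * L"
    and m: "medium m" and i: "1 \<le> i" "i \<le> K - 3"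
  shows "\<exists>a\<in>spins q - M. \<exists>b\<in>spins q \<inter> M. set \<omega> \<inter> H_bar K L i a b \<noteq> {}"
proof (rule ccontr)
  assume avoid: "\<not> ?thesis"
  define R where "R = (\<Union>a\<in>spins q - M. \<Union>b\<in>spins q \<inter> M. R_bar K L 2 (K - 1) a b)"
  have area_R: "area K L M \<sigma> = 2 * (K - 1)" if R: "\<sigma> \<in> R" for \<sigma>
  proof -
    obtain a b i j where ab: "a \<in> spins q - M" "b \<in> spins q \<inter> M" and \<sigma>: "\<sigma> = two_spin_config K L a b (rectangle K L i j 2 (K - 1))"
      using R unfolding R_def R_bar_def by blast
    have cell: "(x, y) \<in> {v \<in> verts K L. \<sigma> v \<in> M} \<longleftrightarrow> (x, y) \<in> arc K i (K - 1) \<times> arc L j 2" for x y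
    proof (cases "x < K \<and> y < L")
      case True
      then show ?thesis using ab by (auto simp: \<sigma> two_spin_apply rectangle_eq)
    next
      case False
      then show ?thesis using arc_subset[OF K0, of i "K - 1"] arc_subset[OF L0, of j 2] by auto
    qed
    have "{v \<in> verts K L. \<sigma> v \<in> M} = arc K i (K - 1) \<times> arc L j 2"
    proof (rule set_eqI)
      fix v show "v \<in> {v \<in> verts K L. \<sigma> v \<in> M} \<longleftrightarrow> v \<in> arc K i (K - 1) \<times> arc L j 2"
        by (cases v) (simp only: cell)
    qed
    then show ?thesis using L_ge_4 by (simp add: area_def card_cartesian_product card_arc)
  qed
  have "\<exists>\<sigma>\<in>set \<omega>. rows_mixed \<sigma> \<and> area K L M \<sigma> = K + i"
  proof (rule low_walk_hits[OF walk start stop m, where J = "\<lambda>\<sigma>. \<sigma> \<notin> R"])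
    show "0 < K + i" by simp
    have "2 * K - 1 \<le> m" using m by (simp add: medium_def)
    then show "K + i \<le> m" using i by linarith
    show "hd \<omega> \<notin> R" using area_R start K_ge_3 by fastforce
    fix \<sigma> \<eta> assume *: "\<sigma> \<in> set \<omega>" "\<eta> \<in> set \<omega>" "\<sigma> \<in> configs q K L" "\<eta> \<in> configs q K L"
        "defect K L \<sigma> \<le> 2 * K + 2" "defect K L \<eta> \<le> 2 * K + 2" "adjacent K L \<sigma> \<eta>" and J: "\<sigma> \<notin> R"
    show "\<eta> \<notin> R" if pre: "\<not> rows_mixed \<sigma> \<or> area K L M \<sigma> < K + i"
    proof
      assume \<eta>: "\<eta> \<in> R"
      have "\<not> area K L M \<sigma> < K + i" using area_R[OF \<eta>] area_adjacent_le[OF *(7), of M] i by linarith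
      with pre have const: "\<not> rows_mixed \<sigma>" by simp
      obtain a b where ab: "a \<in> spins q - M" "b \<in> spins q \<inter> M" "\<eta> \<in> R_bar K L 2 (K - 1) a b"
        using \<eta> unfolding R_def by blast
      have "a \<noteq> b" "\<sigma> \<noteq> \<eta>" using ab \<eta> J by auto
      from entering_R[OF ab(3) this(1) *(7) const this(2) *(3,4,5)] have "\<sigma> \<in> B_bar K L (K - 2) 1 (K - 1) a b" .
      then have "\<sigma> \<in> H_bar K L i a b" unfolding H_bar_def using i by auto
      with avoid ab *(1) show False by blast
    qed
    assume **: "\<not> rows_mixed \<sigma>" "rows_mixed \<eta>" and ar: "K + i < area K L M \<eta>" "area K L M \<eta> < 2 * K"
    define h where "h = area K L M \<eta> - K"
    have h: "i < h" "h < K" "area K L M \<eta> = K + h" using ar i by (auto simp: h_def)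
    obtain a b where ab: "a \<in> spins q - M" "b \<in> spins q \<inter> M" "\<sigma> \<in> B_bar K L h 1 (K - 1) a b"
      using entering_from_B[OF *(7) **(1) *(3,4,6) **(2) h(3)] h by auto
    show False
    proof (cases "h = K - 1")
      case True
      then have "\<sigma> \<in> R" using ab B_bar_square[of a b] unfolding R_def by blast
      with J show False by simp
    next
      case False
      then have "h \<in> {i + 1..K - 2}" using h by auto
      then have "\<sigma> \<in> H_bar K L i a b" unfolding H_bar_def using ab(3) by blast
      with avoid ab *(1) show False by blast
    qed
  qed
  then obtain \<sigma> where \<sigma>: "\<sigma> \<in> set \<omega>" "rows_mixed \<sigma>" "area K L M \<sigma> = K + i" by blast
  have conf: "\<sigma> \<in> configs q K L" and low: "defect K L \<sigma> \<le> 2 * K + 2"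
    using walk \<sigma> by (auto simp: low_walk_def)
  have dm: "area K L M \<sigma> div K = 1" "area K L M \<sigma> mod K = i" using \<sigma> i K_ge_3 by simp_all
  have upper: "area K L M \<sigma> < K * (L - 1)"
  proof -
    have "K * 3 \<le> K * (L - 1)" using L_ge_4 by (intro mult_left_mono) auto
    with \<sigma> i show ?thesis by linarith
  qed
  have lower: "K < area K L M \<sigma>" using \<sigma> i by simp
  have indiv: "\<not> K dvd area K L M \<sigma>" using dm i by (simp add: dvd_eq_mod_eq_0)
  obtain a b where "a \<in> spins q - M" "b \<in> spins q \<inter> M" "\<sigma> \<in> B_bar K L i 1 K a b"
    using strip_config[OF conf low \<sigma>(2) lower upper indiv] dm by auto
  with avoid \<sigma>(1) show False unfolding H_bar_def by blast
qed

end

section \<open>Growing one phase inside another\<close>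

lemma const_config_eq: "const_config K L a = two_spin_config K L a b {}"
  by (simp add: const_config_def two_spin_config_def)

lemma const_config_full: "const_config K L b = two_spin_config K L a b ({..<K} \<times> {..<L})"
  by (auto simp: const_config_def two_spin_config_def fun_eq_iff restrict_def verts_def)

lemma two_spin_in_configs: "a \<in> spins q \<Longrightarrow> b \<in> spins q \<Longrightarrow> two_spin_config K L a b A \<in> configs q K L"
  by (auto simp: two_spin_config_def configs_def)

lemma adjacent_two_spin:
  assumes "v \<in> verts K L" "A \<subseteq> insert v B" "B \<subseteq> insert v A"
  shows "adjacent K L (two_spin_config K L a b A) (two_spin_config K L a b B)"
  unfolding adjacent_def using assms by (intro bexI[of _ v]) (auto simp: two_spin_config_def)

lemma area_two_spin:
  assumes "a \<notin> M" "b \<in> M" "A \<subseteq> verts K L"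
  shows "area K L M (two_spin_config K L a b A) = card A"
proof -
  have "{v \<in> verts K L. two_spin_config K L a b A v \<in> M} = A"
    using assms by (auto simp: two_spin_config_def)
  then show ?thesis by (simp add: area_def)
qed

lemma arc_pred:
  assumes "0 < n"
  shows "arc n (j + n - 1) (Suc w) = insert ((j + n - 1) mod n) (arc n j w)"
proof -
  have shift: "(j + n - 1 + Suc x) mod n = (j + x) mod n" for x
  proof -
    have "j + n - 1 + Suc x = (j + x) + n" using assms by simp
    then show ?thesis by (simp only: mod_add_self2)
  qed
  have "{..<Suc w} = insert 0 (Suc ` {..<w})" by (rule lessThan_Suc_eq_insert_0)
  then show ?thesis unfolding arc_eq_image using shift by (simp add: image_image)
qed

definition linked :: "nat \<Rightarrow> nat \<Rightarrow> config set \<Rightarrow> config \<Rightarrow> config \<Rightarrow> bool" where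
  "linked K L G = (\<lambda>\<sigma> \<eta>. \<sigma> \<in> G \<and> \<eta> \<in> G \<and> adjacent K L \<sigma> \<eta>)\<^sup>*\<^sup>*"

lemma linked_refl [simp]: "linked K L G \<sigma> \<sigma>"
  by (simp add: linked_def)

lemma linked_trans: "linked K L G \<sigma> \<eta> \<Longrightarrow> linked K L G \<eta> \<zeta> \<Longrightarrow> linked K L G \<sigma> \<zeta>"
  unfolding linked_def by (rule rtranclp_trans)

lemma linked_step: "\<sigma> \<in> G \<Longrightarrow> \<eta> \<in> G \<Longrightarrow> adjacent K L \<sigma> \<eta> \<Longrightarrow> linked K L G \<sigma> \<eta>"
  unfolding linked_def by (rule r_into_rtranclp) simp

lemma linked_walk:
  assumes "linked K L G \<sigma> \<eta>" "\<sigma> \<in> G"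
  shows "\<exists>\<omega>. \<omega> \<noteq> [] \<and> hd \<omega> = \<sigma> \<and> last \<omega> = \<eta> \<and> set \<omega> \<subseteq> G \<and> successively (adjacent K L) \<omega>"
  using assms(1) unfolding linked_def
proof (induction rule: rtranclp_induct)
  case base
  show ?case by (rule exI[of _ "[\<sigma>]"]) (use assms(2) in simp)
next
  case (step \<eta> \<zeta>)
  then obtain \<omega> where \<omega>: "\<omega> \<noteq> []" "hd \<omega> = \<sigma>" "last \<omega> = \<eta>" "set \<omega> \<subseteq> G" "successively (adjacent K L) \<omega>" by blast
  show ?case
    by (rule exI[of _ "\<omega> @ [\<zeta>]"]) (use \<omega> step in \<open>auto simp: successively_append_iff\<close>)
qed

context torus
begin

text \<open>The converse of the lower bound on the defect: when all sections are arcs, each mixed row and each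
  mixed column costs at most two.\<close>

lemma defect_two_spin_le:
  assumes rows: "\<And>x. x < K \<Longrightarrow> \<exists>p h. h \<le> L \<and> {y. y < L \<and> (x, y) \<in> A} = arc L p h"
    and cols: "\<And>y. y < L \<Longrightarrow> \<exists>p h. h \<le> K \<and> {x. x < K \<and> (x, y) \<in> A} = arc K p h"
    and R: "\<And>x y y'. x < K \<Longrightarrow> x \<notin> R \<Longrightarrow> y < L \<Longrightarrow> y' < L \<Longrightarrow> (x, y) \<in> A \<Longrightarrow> (x, y') \<in> A"
    and C: "\<And>x x' y. y < L \<Longrightarrow> y \<notin> C \<Longrightarrow> x < K \<Longrightarrow> x' < K \<Longrightarrow> (x, y) \<in> A \<Longrightarrow> (x', y) \<in> A"
    and fin: "finite R" "finite C"
  shows "defect K L (two_spin_config K L a b A) \<le> 2 * card R + 2 * card C"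
proof -
  let ?\<sigma> = "two_spin_config K L a b A"
  have arc_word: "cyclic_changes n f \<le> 2"
    if n: "0 < n" and ex: "\<exists>p h. h \<le> n \<and> {k. k < n \<and> P k} = arc n p h"
      and f: "\<And>k. k < n \<Longrightarrow> f k = (if P k then b else a)" 
    for n and f :: "nat \<Rightarrow> nat" and P
  proof -
    obtain p h where ph: "h \<le> n" "{k. k < n \<and> P k} = arc n p h" using ex by blast
    have "cyclic_changes n f = cyclic_changes n (\<lambda>k. if k \<in> arc n p h then b else a)"
      unfolding ph(2)[symmetric] using f by (intro cyclic_changes_cong) auto
    then show ?thesis using cyclic_changes_arc_le_2[OF n ph(1)] by simp
  qed
  have row_le: "cyclic_changes L (row ?\<sigma> x) \<le> (if x \<in> R then 2 else 0)" if "x < K" for x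
  proof (cases "x \<in> R")
    case True
    have "cyclic_changes L (row ?\<sigma> x) \<le> 2"
      by (rule arc_word[OF L0 rows[OF that]]) (use that in \<open>simp add: two_spin_apply\<close>)
    then show ?thesis using True by simp
  next
    case False
    have "cyclic_changes L (row ?\<sigma> x) = 0"
      by (rule cyclic_changes_const[where c = "?\<sigma> (x, 0)"]) (use R[OF that False] that in \<open>auto simp: two_spin_apply\<close>)
    then show ?thesis by simp
  qed
  have col_le: "cyclic_changes K (col ?\<sigma> y) \<le> (if y \<in> C then 2 else 0)" if "y < L" for y
  proof (cases "y \<in> C")
    case True
    have "cyclic_changes K (col ?\<sigma> y) \<le> 2"
      by (rule arc_word[OF K0 cols[OF that]]) (use that in \<open>simp add: two_spin_apply\<close>)
    then show ?thesis using True by simp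
  next
    case False
    have "cyclic_changes K (col ?\<sigma> y) = 0"
      by (rule cyclic_changes_const[where c = "?\<sigma> (0, y)"]) (use C[OF that False] that in \<open>auto simp: two_spin_apply\<close>)
    then show ?thesis by simp
  qed
  have bound: "(\<Sum>k<n. if k \<in> S then 2 else 0) \<le> 2 * card S" if "finite S" for n :: nat and S
  proof -
    have "(\<Sum>k<n. if k \<in> S then 2 else 0) = 2 * card ({..<n} \<inter> S)" by (simp add: sum.If_cases)
    also have "\<dots> \<le> 2 * card S" using that by (intro mult_left_mono card_mono) auto
    finally show ?thesis .
  qed
  have "(\<Sum>x<K. cyclic_changes L (row ?\<sigma> x)) \<le> 2 * card R"
    by (rule order_trans[OF sum_mono bound[OF fin(1), of K]]) (simp add: row_le)
  moreover have "(\<Sum>y<L. cyclic_changes K (col ?\<sigma> y)) \<le> 2 * card C"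
    by (rule order_trans[OF sum_mono bound[OF fin(2), of L]]) (simp add: col_le)
  ultimately show ?thesis unfolding defect_def by simp
qed

text \<open>The two kinds of sets that occur during growth: a strip of full columns with a bar in column \<open>c\<close>,
  and two partial columns side by side.\<close>

definition strip_bar :: "nat \<Rightarrow> nat \<Rightarrow> nat \<Rightarrow> nat \<Rightarrow> nat \<Rightarrow> vertex set" where
  "strip_bar j w p h c = {..<K} \<times> arc L j w \<union> arc K p h \<times> {c mod L}"

definition two_columns :: "nat \<Rightarrow> nat \<Rightarrow> nat \<Rightarrow> nat \<Rightarrow> nat \<Rightarrow> nat \<Rightarrow> vertex set" where
  "two_columns j i u p h c = arc K i u \<times> {j} \<union> arc K p h \<times> {c mod L}"

text \<open>The column of a bar, on either side, extends the strip to one that is wider by one.\<close>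

lemma beside_strip:
  assumes "w < L" "c = j + w \<or> c = j + L - 1"
  obtains j' where "j' < L" "arc L j' (Suc w) = insert (c mod L) (arc L j w)" "c mod L \<notin> arc L j w"
proof -
  obtain j' where j': "arc L j' (Suc w) = insert (c mod L) (arc L j w)"
    using assms(2)
  proof
    assume "c = j + w"
    then show ?thesis using that[of j] by (simp add: arc_Suc)
  next
    assume "c = j + L - 1"
    then show ?thesis using that[of "j + L - 1"] arc_pred[OF L0, of j w] by simp
  qed
  have "c mod L \<notin> arc L j w"
  proof
    assume "c mod L \<in> arc L j w"
    then have "card (arc L j' (Suc w)) = card (arc L j w)" using j' by (simp add: insert_absorb)
    with assms(1) show False by (simp add: card_arc)
  qed
  with j' show thesis using that[of "j' mod L"] by simp
qed

lemma strip_bar_subset: "strip_bar j w p h c \<subseteq> verts K L"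
  using arc_subset[OF K0, of p h] arc_subset[OF L0, of j w] by (auto simp: strip_bar_def)

lemma card_strip_bar:
  assumes "w < L" "h \<le> K" "c = j + w \<or> c = j + L - 1"
  shows "card (strip_bar j w p h c) = w * K + h"
proof -
  have "c mod L \<notin> arc L j w" using beside_strip[OF assms(1,3)] by metis
  then have "card (strip_bar j w p h c) = card ({..<K} \<times> arc L j w) + card (arc K p h \<times> {c mod L})"
    unfolding strip_bar_def by (intro card_Un_disjoint) auto
  then show ?thesis using assms by (simp add: card_cartesian_product card_arc mult.commute)
qed

lemma defect_strip_bar:
  assumes "w < L" "h \<le> K" "c = j + w \<or> c = j + L - 1"
  shows "defect K L (two_spin_config K L a b (strip_bar j w p h c)) \<le> 2 * K + 2"
proof -
  obtain j' where j': "arc L j' (Suc w) = insert (c mod L) (arc L j w)" "c mod L \<notin> arc L j w"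
    using beside_strip[OF assms(1,3)] by metis
  have "defect K L (two_spin_config K L a b (strip_bar j w p h c)) \<le> 2 * card {..<K} + 2 * card {c mod L}"
  proof (rule defect_two_spin_le)
    fix x assume x: "x < K"
    show "\<exists>p' h'. h' \<le> L \<and> {y. y < L \<and> (x, y) \<in> strip_bar j w p h c} = arc L p' h'"
    proof (cases "x \<in> arc K p h")
      case True
      then have "{y. y < L \<and> (x, y) \<in> strip_bar j w p h c} = arc L j' (Suc w)"
        unfolding j' using x arc_subset[OF L0, of j w] by (auto simp: strip_bar_def)
      then show ?thesis using assms(1) by (intro exI[of _ j'] exI[of _ "Suc w"]) simp
    next
      case False
      then have "{y. y < L \<and> (x, y) \<in> strip_bar j w p h c} = arc L j w"
        using x arc_subset[OF L0, of j w] by (auto simp: strip_bar_def)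
      then show ?thesis using assms(1) by (intro exI[of _ j] exI[of _ w]) simp
    qed
  next
    fix y assume y: "y < L"
    consider "y \<in> arc L j w" | "y = c mod L" "y \<notin> arc L j w" | "y \<notin> arc L j w" "y \<noteq> c mod L" by blast
    then show "\<exists>p' h'. h' \<le> K \<and> {x. x < K \<and> (x, y) \<in> strip_bar j w p h c} = arc K p' h'"
    proof cases
      case 1
      then have "{x. x < K \<and> (x, y) \<in> strip_bar j w p h c} = arc K 0 K"
        by (auto simp: strip_bar_def arc_full)
      then show ?thesis by blast
    next
      case 2
      then have "{x. x < K \<and> (x, y) \<in> strip_bar j w p h c} = arc K p h"
        using arc_subset[OF K0, of p h] by (auto simp: strip_bar_def)
      then show ?thesis using assms(2) by blast
    next
      case 3
      then have "{x. x < K \<and> (x, y) \<in> strip_bar j w p h c} = arc K 0 0"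
        by (auto simp: strip_bar_def)
      then show ?thesis by blast
    qed
  qed (auto simp: strip_bar_def)
  then show ?thesis by simp
qed

lemma two_columns_subset: "j < L \<Longrightarrow> two_columns j i u p h c \<subseteq> verts K L"
  using arc_subset[OF K0, of p h] arc_subset[OF K0, of i u] by (auto simp: two_columns_def)

lemma beside_column:
  assumes "j < L" "c = j + 1 \<or> c = j + L - 1"
  shows "c mod L \<noteq> j"
  using beside_strip[of 1 c j] assms L_ge_4 by auto

lemma card_two_columns:
  assumes "u \<le> K" "h \<le> K" "j < L" "c = j + 1 \<or> c = j + L - 1"
  shows "card (two_columns j i u p h c) = u + h"
proof -
  have "card (two_columns j i u p h c) = card (arc K i u \<times> {j}) + card (arc K p h \<times> {c mod L})"
    unfolding two_columns_def using beside_column[OF assms(3,4)] by (intro card_Un_disjoint) auto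
  then show ?thesis using assms by (simp add: card_cartesian_product card_arc)
qed

text \<open>All mixed rows meet the arc of length \<open>K - 1\<close>, and there are two mixed columns.\<close>

lemma defect_two_columns:
  assumes "u < K" "h < K" "j < L" "c = j + 1 \<or> c = j + L - 1" and bar: "arc K p h \<subseteq> arc K i (K - 1)"
  shows "defect K L (two_spin_config K L a b (two_columns j i u p h c)) \<le> 2 * K + 2"
proof -
  have ne: "c mod L \<noteq> j" by (rule beside_column[OF assms(3,4)])
  have "1 < L" using L_ge_4 by simp
  obtain j' where j': "arc L j' (Suc 1) = insert (c mod L) (arc L j 1)"
    using beside_strip[OF \<open>1 < L\<close> assms(4)] by metis
  have arc_u: "arc K i u \<subseteq> arc K i (K - 1)" using assms(1) by (intro arc_mono) simp
  have "defect K L (two_spin_config K L a b (two_columns j i u p h c)) \<le> 2 * card (arc K i (K - 1)) + 2 * card {j, c mod L}"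
  proof (rule defect_two_spin_le)
    fix x assume x: "x < K"
    consider "x \<in> arc K i u" "x \<in> arc K p h" | "x \<in> arc K i u" "x \<notin> arc K p h"
      | "x \<notin> arc K i u" "x \<in> arc K p h" | "x \<notin> arc K i u" "x \<notin> arc K p h" by blast
    then show "\<exists>p' h'. h' \<le> L \<and> {y. y < L \<and> (x, y) \<in> two_columns j i u p h c} = arc L p' h'"
    proof cases
      case 1
      then have "{y. y < L \<and> (x, y) \<in> two_columns j i u p h c} = arc L j' (Suc 1)"
        unfolding j' using assms(3) by (auto simp: two_columns_def)
      moreover have "Suc 1 \<le> L" using L_ge_4 by simp
      ultimately show ?thesis by blast
    next
      case 2
      then have "{y. y < L \<and> (x, y) \<in> two_columns j i u p h c} = arc L j 1"
        using assms(3) by (auto simp: two_columns_def)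
      with \<open>1 < L\<close> show ?thesis by (metis less_imp_le)
    next
      case 3
      then have "{y. y < L \<and> (x, y) \<in> two_columns j i u p h c} = arc L c 1"
        using assms(3) by (auto simp: two_columns_def)
      with \<open>1 < L\<close> show ?thesis by (metis less_imp_le)
    next
      case 4
      then have "{y. y < L \<and> (x, y) \<in> two_columns j i u p h c} = arc L j 0"
        by (auto simp: two_columns_def)
      then show ?thesis by blast
    qed
  next
    fix y assume y: "y < L"
    consider "y = j" | "y = c mod L" | "y \<noteq> j" "y \<noteq> c mod L" by blast
    then show "\<exists>p' h'. h' \<le> K \<and> {x. x < K \<and> (x, y) \<in> two_columns j i u p h c} = arc K p' h'"
    proof cases
      case 1
      then have "{x. x < K \<and> (x, y) \<in> two_columns j i u p h c} = arc K i u"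
        using arc_subset[OF K0, of i u] ne by (auto simp: two_columns_def)
      with assms(1) show ?thesis by (metis less_imp_le)
    next
      case 2
      then have "{x. x < K \<and> (x, y) \<in> two_columns j i u p h c} = arc K p h"
        using arc_subset[OF K0, of p h] ne by (auto simp: two_columns_def)
      with assms(2) show ?thesis by (metis less_imp_le)
    next
      case 3
      then have "{x. x < K \<and> (x, y) \<in> two_columns j i u p h c} = arc K 0 0"
        by (auto simp: two_columns_def)
      then show ?thesis by blast
    qed
  qed (use bar arc_u in \<open>auto simp: two_columns_def\<close>)
  then show ?thesis using ne K_ge_3 by (simp add: card_arc)
qed

lemma linked_grow:
  assumes "y < L" "h0 \<le> h"
    and "\<And>x. h0 \<le> x \<Longrightarrow> x \<le> h \<Longrightarrow> two_spin_config K L a b (A \<union> arc K p x \<times> {y}) \<in> G"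
  shows "linked K L G (two_spin_config K L a b (A \<union> arc K p h0 \<times> {y})) (two_spin_config K L a b (A \<union> arc K p h \<times> {y}))"
  using assms(2,3)
proof (induction h rule: dec_induct)
  case base show ?case by simp
next
  case (step h)
  have "linked K L G (two_spin_config K L a b (A \<union> arc K p h \<times> {y})) (two_spin_config K L a b (A \<union> arc K p (Suc h) \<times> {y}))"
  proof (rule linked_step)
    show "adjacent K L (two_spin_config K L a b (A \<union> arc K p h \<times> {y})) (two_spin_config K L a b (A \<union> arc K p (Suc h) \<times> {y}))"
      by (rule adjacent_two_spin[of "((p + h) mod K, y)"]) (use assms(1) in \<open>auto simp: arc_Suc\<close>)
  qed (use step in auto)
  moreover have "linked K L G (two_spin_config K L a b (A \<union> arc K p h0 \<times> {y})) (two_spin_config K L a b (A \<union> arc K p h \<times> {y}))"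
    by (rule step.IH) (use step.prems in auto)
  ultimately show ?case by (rule linked_trans[rotated])
qed

lemma linked_strips:
  assumes "w \<le> w'"
    and "\<And>v x. w \<le> v \<Longrightarrow> v < w' \<Longrightarrow> x \<le> K \<Longrightarrow> two_spin_config K L a b (strip_bar j v 0 x (j + v)) \<in> G"
  shows "linked K L G (two_spin_config K L a b ({..<K} \<times> arc L j w)) (two_spin_config K L a b ({..<K} \<times> arc L j w'))"
  using assms
proof (induction w' rule: dec_induct)
  case base show ?case by simp
next
  case (step v)
  have "linked K L G (two_spin_config K L a b ({..<K} \<times> arc L j v \<union> arc K 0 0 \<times> {(j + v) mod L}))
      (two_spin_config K L a b ({..<K} \<times> arc L j v \<union> arc K 0 K \<times> {(j + v) mod L}))"
    by (rule linked_grow) (use step in \<open>auto simp: strip_bar_def\<close>)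
  moreover have "{..<K} \<times> arc L j v \<union> arc K 0 K \<times> {(j + v) mod L} = {..<K} \<times> arc L j (Suc v)"
    by (auto simp: arc_full arc_Suc)
  ultimately have "linked K L G (two_spin_config K L a b ({..<K} \<times> arc L j v)) (two_spin_config K L a b ({..<K} \<times> arc L j (Suc v)))"
    by simp
  moreover have "linked K L G (two_spin_config K L a b ({..<K} \<times> arc L j w)) (two_spin_config K L a b ({..<K} \<times> arc L j v))"
    by (rule step.IH) (use step.prems in auto)
  ultimately show ?case by (rule linked_trans[rotated])
qed

lemma linked_from_strip:
  assumes w: "w < L" and c: "c = j + w \<or> c = j + L - 1" and h: "h \<le> K"
    and bars: "\<And>x. h \<le> x \<Longrightarrow> x \<le> K \<Longrightarrow> two_spin_config K L a b (strip_bar j w p x c) \<in> G"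
    and wider: "\<And>j v x. w < v \<Longrightarrow> v < L \<Longrightarrow> x \<le> K \<Longrightarrow> two_spin_config K L a b (strip_bar j v 0 x (j + v)) \<in> G"
  shows "linked K L G (two_spin_config K L a b (strip_bar j w p h c)) (const_config K L b)"
proof -
  obtain j' where j': "arc L j' (Suc w) = insert (c mod L) (arc L j w)"
    using beside_strip[OF w c] by metis
  have "linked K L G (two_spin_config K L a b ({..<K} \<times> arc L j w \<union> arc K p h \<times> {c mod L}))
      (two_spin_config K L a b ({..<K} \<times> arc L j w \<union> arc K p K \<times> {c mod L}))"
    by (rule linked_grow) (use h bars in \<open>auto simp: strip_bar_def\<close>)
  moreover have "{..<K} \<times> arc L j w \<union> arc K p K \<times> {c mod L} = {..<K} \<times> arc L j' (Suc w)"
    unfolding j' by (auto simp: arc_full)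
  moreover have "linked K L G (two_spin_config K L a b ({..<K} \<times> arc L j' (Suc w))) (two_spin_config K L a b ({..<K} \<times> arc L j' L))"
    by (rule linked_strips) (use w wider in auto)
  ultimately show ?thesis
    unfolding strip_bar_def const_config_full[of K L b a] by (simp add: arc_full) (rule linked_trans)
qed

lemma linked_column_by_column:
  assumes w: "w < L" and c: "c = j + w \<or> c = j + L - 1"
    and narrower: "\<And>v x. v < w \<Longrightarrow> x \<le> K \<Longrightarrow> two_spin_config K L a b (strip_bar j v 0 x (j + v)) \<in> G"
    and bars: "\<And>x. x \<le> K \<Longrightarrow> two_spin_config K L a b (strip_bar j w p x c) \<in> G"
    and wider: "\<And>j v x. w < v \<Longrightarrow> v < L \<Longrightarrow> x \<le> K \<Longrightarrow> two_spin_config K L a b (strip_bar j v 0 x (j + v)) \<in> G"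
  shows "linked K L G (const_config K L a) (const_config K L b)"
proof -
  have "linked K L G (two_spin_config K L a b ({..<K} \<times> arc L j 0)) (two_spin_config K L a b ({..<K} \<times> arc L j w))"
    by (rule linked_strips) (use narrower in auto)
  moreover have "linked K L G (two_spin_config K L a b (strip_bar j w p 0 c)) (const_config K L b)"
    by (rule linked_from_strip[OF w c]) (use bars wider in auto)
  ultimately show ?thesis
    unfolding strip_bar_def const_config_eq[of K L a b] by (simp add: arc_full) (rule linked_trans)
qed

text \<open>Growth in a different order: a partial column first, then a bar beside it, then the rest of the
  column, and from there on as usual.\<close>

lemma linked_two_columns:
  assumes u: "u \<le> K" and h: "h \<le> K" and j: "j < L" and c: "c = j + 1 \<or> c = j + L - 1"
    and first: "\<And>x. x \<le> u \<Longrightarrow> two_spin_config K L a b (two_columns j i x p 0 c) \<in> G"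
    and second: "\<And>x. x \<le> h \<Longrightarrow> two_spin_config K L a b (two_columns j i u p x c) \<in> G"
    and finish: "\<And>x. u \<le> x \<Longrightarrow> x \<le> K \<Longrightarrow> two_spin_config K L a b (two_columns j i x p h c) \<in> G"
    and bars: "\<And>x. h \<le> x \<Longrightarrow> x \<le> K \<Longrightarrow> two_spin_config K L a b (strip_bar j 1 p x c) \<in> G"
    and wider: "\<And>j v x. 1 < v \<Longrightarrow> v < L \<Longrightarrow> x \<le> K \<Longrightarrow> two_spin_config K L a b (strip_bar j v 0 x (j + v)) \<in> G"
  shows "linked K L G (const_config K L a) (const_config K L b)"
proof -
  let ?t = "two_spin_config K L a b"
  have "linked K L G (?t ({} \<union> arc K i 0 \<times> {j})) (?t ({} \<union> arc K i u \<times> {j}))"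
    by (rule linked_grow) (use j first in \<open>auto simp: two_columns_def\<close>)
  then have 1: "linked K L G (const_config K L a) (?t (arc K i u \<times> {j}))"
    by (simp add: const_config_eq[of K L a b])
  have "linked K L G (?t (arc K i u \<times> {j} \<union> arc K p 0 \<times> {c mod L})) (?t (arc K i u \<times> {j} \<union> arc K p h \<times> {c mod L}))"
    by (rule linked_grow) (use second in \<open>auto simp: two_columns_def\<close>)
  then have 2: "linked K L G (?t (arc K i u \<times> {j})) (?t (arc K p h \<times> {c mod L} \<union> arc K i u \<times> {j}))"
    by (simp add: Un_commute)
  have "linked K L G (?t (arc K p h \<times> {c mod L} \<union> arc K i u \<times> {j})) (?t (arc K p h \<times> {c mod L} \<union> arc K i K \<times> {j}))"
    by (rule linked_grow) (use j u finish in \<open>auto simp: two_columns_def Un_commute\<close>)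
  moreover have "arc K p h \<times> {c mod L} \<union> arc K i K \<times> {j} = strip_bar j 1 p h c"
    using j by (auto simp: strip_bar_def arc_full)
  ultimately have 3: "linked K L G (?t (arc K p h \<times> {c mod L} \<union> arc K i u \<times> {j})) (?t (strip_bar j 1 p h c))"
    by simp
  have 4: "linked K L G (?t (strip_bar j 1 p h c)) (const_config K L b)"
    by (rule linked_from_strip) (use L_ge_4 c h bars wider in auto)
  from 1 2 3 4 show ?thesis by (meson linked_trans)
qed


lemma defect_ge_if_indivisible:
  assumes "rows_mixed \<sigma>" "\<not> K dvd area K L M \<sigma>"
  shows "2 * K + 2 \<le> defect K L \<sigma>"
proof -
  obtain c0 where c0: "c0 < L" "mixed K (col \<sigma> c0)" using exists_mixed_col[OF assms(2)] by blast
  have "{i. i < K \<and> mixed L (row \<sigma> i)} = {..<K}" using assms(1) by auto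
  moreover have "card {c0} \<le> card {j. j < L \<and> mixed K (col \<sigma> j)}" using c0 by (intro card_mono) auto
  ultimately show ?thesis using defect_ge[of K L \<sigma>] by simp
qed

section \<open>Low paths that cross a gate once\<close>

text \<open>The configurations available to a path between \<open>a\<close> and \<open>b\<close> that is to meet \<open>X\<close> in \<open>\<xi>\<close> only.\<close>

definition low_phase :: "nat \<Rightarrow> nat \<Rightarrow> config set \<Rightarrow> config \<Rightarrow> config set" where
  "low_phase a b X \<xi> = {\<sigma>. (\<exists>A. \<sigma> = two_spin_config K L a b A) \<and> defect K L \<sigma> \<le> 2 * K + 2 \<and> (\<sigma> \<in> X \<longrightarrow> \<sigma> = \<xi>)}"

text \<open>The property of the gates by which growing configurations avoid them: below the area \<open>n\<close> they
  have no elements, and above it none that contain a full column.\<close>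

definition threshold :: "nat \<Rightarrow> nat \<Rightarrow> config set \<Rightarrow> bool" where
  "threshold b n X \<longleftrightarrow> (\<forall>\<eta>\<in>X. n \<le> area K L {b} \<eta> \<and>
     ((\<exists>y<L. \<forall>x<K. \<eta> (x, y) = b) \<longrightarrow> area K L {b} \<eta> = n))"

lemma strip_bar_low_phase:
  assumes "a \<noteq> b" "threshold b n X" "v < L" "x \<le> K" "c = j + v \<or> c = j + L - 1"
    and "v * K + x < n \<or> 0 < v \<and> n < v * K + x \<or> two_spin_config K L a b (strip_bar j v p x c) = \<xi>"
  shows "two_spin_config K L a b (strip_bar j v p x c) \<in> low_phase a b X \<xi>"
proof -
  let ?\<eta> = "two_spin_config K L a b (strip_bar j v p x c)"
  have ar: "area K L {b} ?\<eta> = v * K + x"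
    using assms(1,3,4,5) by (simp add: area_two_spin strip_bar_subset card_strip_bar)
  have "?\<eta> = \<xi>" if X: "?\<eta> \<in> X"
    using assms(6)
  proof (elim disjE)
    assume "v * K + x < n"
    with X assms(2) ar show ?thesis by (auto simp: threshold_def)
  next
    assume v: "0 < v \<and> n < v * K + x"
    have "j mod L \<in> arc L j v" using v by (auto simp: arc_def intro!: exI[of _ 0])
    then have "\<forall>x<K. ?\<eta> (x, j mod L) = b" by (simp add: two_spin_apply strip_bar_def)
    with X assms(2) ar v show ?thesis unfolding threshold_def by (metis L0 less_irrefl mod_less_divisor)
  qed simp
  then show ?thesis unfolding low_phase_def using defect_strip_bar[OF assms(3,4,5)] by blast
qed

text \<open>Before the bar reaches the height \<open>h\<close> the area is below the threshold; afterwards it is above, and a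
  full column is present.\<close>

lemma linked_through_strip:
  assumes ab: "a \<noteq> b" and X: "threshold b (w * K + h) X" and w: "0 < w" "w < L" and h: "0 < h" "h < K"
    and c: "c = j + w \<or> c = j + L - 1"
  shows "linked K L (low_phase a b X (two_spin_config K L a b (strip_bar j w p h c))) (const_config K L a) (const_config K L b)"
proof (rule linked_column_by_column[OF w(2) c])
  fix v x assume v: "v < w" and x: "x \<le> K"
  have "v * K + K = Suc v * K" by simp
  also have "\<dots> \<le> w * K" using v by (intro mult_right_mono) auto
  finally have "v * K + x < w * K + h" using x h by linarith
  then show "two_spin_config K L a b (strip_bar j v 0 x (j + v)) \<in> low_phase a b X (two_spin_config K L a b (strip_bar j w p h c))"
    using v w x by (intro strip_bar_low_phase[OF ab X]) auto
next
  fix x assume "x \<le> K"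
  then show "two_spin_config K L a b (strip_bar j w p x c) \<in> low_phase a b X (two_spin_config K L a b (strip_bar j w p h c))"
    using c w by (intro strip_bar_low_phase[OF ab X]) (auto simp: nat_neq_iff)
next
  fix j' v x assume v: "w < v" "v < L" and x: "x \<le> K"
  have "w * K + K = Suc w * K" by simp
  also have "\<dots> \<le> v * K" using v by (intro mult_right_mono) auto
  finally have "w * K + h < v * K + x" using h by linarith
  then show "two_spin_config K L a b (strip_bar j' v 0 x (j' + v)) \<in> low_phase a b X (two_spin_config K L a b (strip_bar j w p h c))"
    using v x by (intro strip_bar_low_phase[OF ab X]) auto
qed

lemma two_columns_full: "j < L \<Longrightarrow> two_columns j i K p h c = strip_bar j 1 p h c"
  by (auto simp: two_columns_def strip_bar_def arc_full)

lemma two_columns_section: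
  assumes "j < L" "c = j + 1 \<or> c = j + L - 1"
  shows "{x. (x, y) \<in> two_columns j i u p h c} \<subseteq> arc K i u \<or> {x. (x, y) \<in> two_columns j i u p h c} \<subseteq> arc K p h"
  using beside_column[OF assms] by (cases "y = j") (auto simp: two_columns_def)

lemma two_columns_low_phase:
  assumes "u < K" "h < K" "j < L" "c = j + 1 \<or> c = j + L - 1" "arc K p h \<subseteq> arc K i (K - 1)"
    and "two_spin_config K L a b (two_columns j i u p h c) \<in> X \<Longrightarrow> two_spin_config K L a b (two_columns j i u p h c) = \<xi>"
  shows "two_spin_config K L a b (two_columns j i u p h c) \<in> low_phase a b X \<xi>"
  unfolding low_phase_def using defect_two_columns[OF assms(1-5)] assms(6) by blast

lemma area_two_columns:
  assumes "a \<noteq> b" "u \<le> K" "h \<le> K" "j < L" "c = j + 1 \<or> c = j + L - 1"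
  shows "area K L {b} (two_spin_config K L a b (two_columns j i u p h c)) = u + h"
  using assms by (simp add: area_two_spin two_columns_subset card_two_columns)

text \<open>The bar grows beside a column of length \<open>K - 1\<close> until the rectangle is complete, which happens
  exactly at the threshold; the next vertex completes a full column.\<close>

lemma linked_through_R:
  assumes ab: "a \<noteq> b" and X: "threshold b (2 * K - 2) X" and j: "j < L"
  shows "linked K L (low_phase a b X (two_spin_config K L a b (two_columns j i (K - 1) i (K - 1) (j + 1)))) (const_config K L a) (const_config K L b)"
    (is "linked K L ?G _ _")
proof -
  have c: "j + 1 = j + 1 \<or> j + 1 = j + L - 1" by simp
  have small: "two_spin_config K L a b (two_columns j i u i h (j + 1)) \<in> ?G"
    if uh: "u < K" "h < K" "u + h < 2 * K - 2 \<or> u = K - 1 \<and> h = K - 1" for u h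
  proof (rule two_columns_low_phase[OF uh(1,2) j c])
    show "arc K i h \<subseteq> arc K i (K - 1)" using uh by (intro arc_mono) simp
    assume "two_spin_config K L a b (two_columns j i u i h (j + 1)) \<in> X"
    with X have "2 * K - 2 \<le> u + h"
      using area_two_columns[OF ab less_imp_le[OF uh(1)] less_imp_le[OF uh(2)] j c] by (auto simp: threshold_def)
    with uh(3) show "two_spin_config K L a b (two_columns j i u i h (j + 1)) =
        two_spin_config K L a b (two_columns j i (K - 1) i (K - 1) (j + 1))" by auto
  qed
  have large: "two_spin_config K L a b (strip_bar j' v p x (j' + v)) \<in> ?G"
    if v: "0 < v" "v < L" "x \<le> K" "v = 1 \<longrightarrow> K - 1 \<le> x" for j' v p x
  proof (rule strip_bar_low_phase[OF ab X])
    have "2 * K - 2 < v * K + x"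
    proof (cases "v = 1")
      case True with v K_ge_3 show ?thesis by auto
    next
      case False
      then have "2 * K \<le> v * K" using v by (intro mult_right_mono) auto
      with K_ge_3 show ?thesis by linarith
    qed
    with v show "v * K + x < 2 * K - 2 \<or> 0 < v \<and> 2 * K - 2 < v * K + x \<or>
      two_spin_config K L a b (strip_bar j' v p x (j' + v)) = two_spin_config K L a b (two_columns j i (K - 1) i (K - 1) (j + 1))"
      by blast
  qed (use v in auto)
  show ?thesis
  proof (rule linked_two_columns[where u = "K - 1" and h = "K - 1" and j = j and i = i and p = i and c = "j + 1"])
    fix x assume "x \<le> K - 1"
    then show "two_spin_config K L a b (two_columns j i x i 0 (j + 1)) \<in> ?G" using K_ge_3 by (intro small) auto
  next
    fix x assume "x \<le> K - 1"
    then show "two_spin_config K L a b (two_columns j i (K - 1) i x (j + 1)) \<in> ?G" using K_ge_3 by (intro small) auto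
  next
    fix x assume x: "K - 1 \<le> x" "x \<le> K"
    show "two_spin_config K L a b (two_columns j i x i (K - 1) (j + 1)) \<in> ?G"
    proof (cases "x = K")
      case True
      then show ?thesis using large[of 1 "K - 1" j i] L_ge_4 j by (simp add: two_columns_full)
    next
      case False
      then show ?thesis using x K_ge_3 by (intro small) auto
    qed
  next
    fix x assume "K - 1 \<le> x" "x \<le> K"
    then show "two_spin_config K L a b (strip_bar j 1 i x (j + 1)) \<in> ?G" using L_ge_4 by (intro large) auto
  next
    fix j' v x assume "1 < v" "v < L" "x \<le> K"
    then show "two_spin_config K L a b (strip_bar j' v 0 x (j' + v)) \<in> ?G" by (intro large) auto
  qed (use j in auto)
qed

text \<open>The bar grows beside a column of length \<open>K - 2\<close>, so that no column contains \<open>K - 1\<close> vertices, as one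
  does in all elements of \<open>X\<close>, before \<open>\<xi>\<close>; after \<open>\<xi>\<close> the column is completed at once.\<close>

lemma linked_through_short_column:
  assumes ab: "a \<noteq> b" and X: "threshold b n X"
    and tall: "\<And>\<eta>. \<eta> \<in> X \<Longrightarrow> \<exists>y<L. K - 1 \<le> card {x. x < K \<and> \<eta> (x, y) = b}"
    and j: "j < L" and c: "c = j + 1 \<or> c = j + L - 1" and h: "h \<le> K - 2" "n < K + h"
    and bar: "arc K p h \<subseteq> arc K i (K - 1)"
  shows "linked K L (low_phase a b X (two_spin_config K L a b (two_columns j i (K - 1) p h c))) (const_config K L a) (const_config K L b)"
    (is "linked K L ?G _ _")
proof -
  have hK: "h < K" using h K_ge_3 by simp
  have small: "two_spin_config K L a b (two_columns j i u p h' c) \<in> ?G"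
    if uh: "u < K" "h' \<le> h" "u \<noteq> K - 1 \<or> h' = h" for u h'
  proof (rule two_columns_low_phase[OF uh(1) _ j c])
    show "h' < K" using uh hK by simp
    show "arc K p h' \<subseteq> arc K i (K - 1)" using arc_mono[OF uh(2), of K p] bar by blast
    assume in_X: "two_spin_config K L a b (two_columns j i u p h' c) \<in> X" (is "?\<eta> \<in> X")
    have "u = K - 1"
    proof (rule ccontr)
      assume "u \<noteq> K - 1"
      then have u: "u \<le> K - 2" using uh by simp
      obtain y where y: "y < L" "K - 1 \<le> card {x. x < K \<and> ?\<eta> (x, y) = b}" using tall[OF in_X] by blast
      have "{x. x < K \<and> ?\<eta> (x, y) = b} \<subseteq> arc K i u \<or> {x. x < K \<and> ?\<eta> (x, y) = b} \<subseteq> arc K p h'"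
      proof -
        have "{x. x < K \<and> ?\<eta> (x, y) = b} \<subseteq> {x. (x, y) \<in> two_columns j i u p h' c}"
          using y(1) ab by (auto simp: two_spin_apply split: if_splits)
        then show ?thesis using two_columns_section[OF j c, of y i u p h'] by blast
      qed
      then have "card {x. x < K \<and> ?\<eta> (x, y) = b} \<le> card (arc K i u) \<or> card {x. x < K \<and> ?\<eta> (x, y) = b} \<le> card (arc K p h')"
        using card_mono[OF finite_arc] by blast
      moreover have "card (arc K i u) = u" "card (arc K p h') = h'" using uh hK by (simp_all add: card_arc)
      ultimately show False using y(2) u uh(2) h K_ge_3 by linarith
    qed
    with uh show "?\<eta> = two_spin_config K L a b (two_columns j i (K - 1) p h c)" by simp
  qed
  have large: "two_spin_config K L a b (strip_bar j' v p' x c') \<in> ?G"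
    if v: "0 < v" "v < L" "x \<le> K" "v = 1 \<longrightarrow> h \<le> x" "c' = j' + v \<or> c' = j' + L - 1" for j' v p' x c'
  proof (rule strip_bar_low_phase[OF ab X])
    have "n < v * K + x"
    proof (cases "v = 1")
      case True with v h show ?thesis by auto
    next
      case False
      then have "2 * K \<le> v * K" using v by (intro mult_right_mono) auto
      with hK h show ?thesis by linarith
    qed
    with v show "v * K + x < n \<or> 0 < v \<and> n < v * K + x \<or>
      two_spin_config K L a b (strip_bar j' v p' x c') = two_spin_config K L a b (two_columns j i (K - 1) p h c)"
      by blast
  qed (use v in auto)
  show ?thesis
  proof (rule linked_two_columns[where u = "K - 2" and h = h and j = j and i = i and p = p and c = c])
    fix x assume "x \<le> K - 2"
    then show "two_spin_config K L a b (two_columns j i x p 0 c) \<in> ?G" using K_ge_3 by (intro small) auto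
  next
    fix x assume "x \<le> h"
    then show "two_spin_config K L a b (two_columns j i (K - 2) p x c) \<in> ?G" using K_ge_3 by (intro small) auto
  next
    fix x assume x: "K - 2 \<le> x" "x \<le> K"
    show "two_spin_config K L a b (two_columns j i x p h c) \<in> ?G"
    proof (cases "x = K")
      case True
      then show ?thesis using large[of 1 h c j p] L_ge_4 j c hK by (simp add: two_columns_full)
    next
      case False
      then show ?thesis using x K_ge_3 by (intro small) auto
    qed
  next
    fix x assume "h \<le> x" "x \<le> K"
    then show "two_spin_config K L a b (strip_bar j 1 p x c) \<in> ?G" using L_ge_4 c by (intro large) auto
  next
    fix j' v x assume "1 < v" "v < L" "x \<le> K"
    then show "two_spin_config K L a b (strip_bar j' v 0 x (j' + v)) \<in> ?G" by (intro large) auto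
  qed (use j c hK in auto)
qed

section \<open>Families of gates\<close>

text \<open>What makes the unions of the sets \<open>X a b\<close> minimal gates: the elements are two-spin configurations
  of defect at least \<open>2 * K + 2\<close>, each can be crossed alone, and no low walk avoids them all. The last part
  speaks of an arbitrary set \<open>M\<close> of spins, so that it covers both the departure from \<open>r\<close>
  (\<open>M = - {r}\<close>) and the arrival at \<open>s\<close> (\<open>M = {s}\<close>).\<close>

definition gate_family :: "nat \<Rightarrow> (nat \<Rightarrow> nat \<Rightarrow> config set) \<Rightarrow> bool" where
  "gate_family q X \<longleftrightarrow>
     (\<forall>a b. a \<noteq> b \<longrightarrow> (\<forall>\<xi>\<in>X a b. (\<exists>A. \<xi> = two_spin_config K L a b A) \<and> 2 * K + 2 \<le> defect K L \<xi> \<and>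
        linked K L (low_phase a b (X a b) \<xi>) (const_config K L a) (const_config K L b))) \<and>
     (\<forall>M \<omega>. low_walk q \<omega> \<longrightarrow> area K L M (hd \<omega>) = 0 \<longrightarrow> area K L M (last \<omega>) = K * L \<longrightarrow>
        (\<exists>a\<in>spins q - M. \<exists>b\<in>spins q \<inter> M. set \<omega> \<inter> X a b \<noteq> {}))"

lemma B_bar_strip:
  assumes "\<xi> \<in> B_bar K L h w K a b"
  obtains j p c where "\<xi> = two_spin_config K L a b (strip_bar j w p h c)" "c = j + w \<or> c = j + L - 1"
proof -
  obtain i j m c where \<xi>: "\<xi> = two_spin_config K L a b (rectangle K L i j w K \<union> rectangle K L (i + m) c 1 h)"
    and c: "c = j + w \<or> c = j + L - 1"
    using assms unfolding B_bar_def by blast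
  have "rectangle K L i j w K \<union> rectangle K L (i + m) c 1 h = strip_bar j w (i + m) h c"
    by (simp add: rectangle_eq strip_bar_def arc_full)
  with \<xi> c show thesis using that by metis
qed

lemma B_bar_columns:
  assumes "\<xi> \<in> B_bar K L h 1 (K - 1) a b"
  obtains i j p c where "\<xi> = two_spin_config K L a b (two_columns j i (K - 1) p h c)" "j < L"
    "c = j + 1 \<or> c = j + L - 1" "arc K p h \<subseteq> arc K i (K - 1)"
proof -
  obtain i j m c where \<xi>: "\<xi> = two_spin_config K L a b (rectangle K L i j 1 (K - 1) \<union> rectangle K L (i + m) c 1 h)"
    and c: "j < L" "c = j + 1 \<or> c = j + L - 1" "m + h \<le> K - 1"
    using assms unfolding B_bar_def by blast
  have "rectangle K L i j 1 (K - 1) \<union> rectangle K L (i + m) c 1 h = two_columns j i (K - 1) (i + m) h c"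
    using c(1) by (simp add: rectangle_eq two_columns_def)
  moreover have "arc K (i + m) h \<subseteq> arc K i (K - 1)"
  proof
    fix z assume "z \<in> arc K (i + m) h"
    then obtain x where "x < h" "z = (i + (m + x)) mod K" by (auto simp: arc_def add.assoc)
    then show "z \<in> arc K i (K - 1)" using c(3) unfolding arc_def by (intro CollectI exI[of _ "m + x"]) auto
  qed
  ultimately show thesis using that \<xi> c by metis
qed

lemma R_bar_columns:
  assumes "\<xi> \<in> R_bar K L 2 (K - 1) a b"
  obtains i j where "\<xi> = two_spin_config K L a b (two_columns j i (K - 1) i (K - 1) (j + 1))" "j < L"
proof -
  obtain i j where \<xi>: "\<xi> = two_spin_config K L a b (rectangle K L i j 2 (K - 1))" and j: "j < L"
    using assms unfolding R_bar_def by blast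
  have "arc L j 2 = {j, (j + 1) mod L}" using j by (auto simp: numeral_2_eq_2 arc_Suc)
  then have "rectangle K L i j 2 (K - 1) = two_columns j i (K - 1) i (K - 1) (j + 1)"
    by (auto simp: rectangle_eq two_columns_def)
  with \<xi> j show thesis using that by metis
qed

lemma defect_ge_strip_bar:
  assumes "a \<noteq> b" "0 < w" "w + 2 \<le> L" "0 < h" "h < K" "c = j + w \<or> c = j + L - 1"
  shows "2 * K + 2 \<le> defect K L (two_spin_config K L a b (strip_bar j w p h c))"
proof (rule defect_ge_if_indivisible)
  let ?\<xi> = "two_spin_config K L a b (strip_bar j w p h c)"
  show "rows_mixed ?\<xi>"
  proof (intro allI impI)
    fix x assume x: "x < K"
    have "\<not> {..<L} \<subseteq> insert (c mod L) (arc L j w)"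
    proof
      assume "{..<L} \<subseteq> insert (c mod L) (arc L j w)"
      then have "card {..<L} \<le> card (insert (c mod L) (arc L j w))" by (intro card_mono) auto
      also have "\<dots> \<le> w + 1" using assms(3) by (simp add: card_insert_if card_arc)
      finally show False using assms(3) by simp
    qed
    then obtain y where y: "y < L" "y \<noteq> c mod L" "y \<notin> arc L j w" by auto
    have "j mod L \<in> arc L j w" using assms(2) by (auto simp: arc_def intro!: exI[of _ 0])
    then have "?\<xi> (x, j mod L) = b" "?\<xi> (x, y) = a" using x y by (auto simp: two_spin_apply strip_bar_def)
    then show "mixed L (row ?\<xi> x)" using assms(1) y(1) by (intro mixedI[of "j mod L" L y]) auto
  qed
  have "area K L {b} ?\<xi> = w * K + h"
    using assms by (simp add: area_two_spin strip_bar_subset card_strip_bar)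
  then show "\<not> K dvd area K L {b} ?\<xi>" using assms by (simp add: dvd_add_right_iff nat_dvd_not_less)
qed

lemma defect_ge_two_columns:
  assumes ab: "a \<noteq> b" and h: "0 < h" "h < K" and j: "j < L" and c: "c = j + 1 \<or> c = j + L - 1"
  shows "2 * K + 2 \<le> defect K L (two_spin_config K L a b (two_columns j i (K - 1) p h c))"
proof -
  let ?\<xi> = "two_spin_config K L a b (two_columns j i (K - 1) p h c)"
  have ne: "c mod L \<noteq> j" by (rule beside_column[OF j c])
  let ?R = "{x. x < K \<and> mixed L (row ?\<xi> x)}" and ?C = "{y. y < L \<and> mixed K (col ?\<xi> y)}"
  have "\<not> {..<L} \<subseteq> {j, c mod L}"
  proof
    assume "{..<L} \<subseteq> {j, c mod L}"
    then have "card {..<L} \<le> card {j, c mod L}" by (intro card_mono) auto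
    with ne L_ge_4 show False by simp
  qed
  then obtain y where y: "y < L" "y \<noteq> j" "y \<noteq> c mod L" by auto
  have "arc K i (K - 1) \<subseteq> ?R"
  proof
    fix x assume x: "x \<in> arc K i (K - 1)"
    then have xK: "x < K" using arc_subset[OF K0] by blast
    have "?\<xi> (x, j) = b" "?\<xi> (x, y) = a" using x xK j y by (auto simp: two_spin_apply two_columns_def)
    then show "x \<in> ?R" using xK j y ab by (auto intro: mixedI[of j L y])
  qed
  from card_mono[OF _ this] have R: "K - 1 \<le> card ?R" by (simp add: card_arc)
  have short: "mixed K (col ?\<xi> z)" if z: "z < L" and S: "\<And>x. x < K \<Longrightarrow> (x, z) \<in> two_columns j i (K - 1) p h c \<longleftrightarrow> x \<in> arc K q u"
    and u: "0 < u" "u < K" for z q u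
  proof -
    have "\<not> {..<K} \<subseteq> arc K q u"
    proof
      assume "{..<K} \<subseteq> arc K q u"
      then have "card {..<K} \<le> card (arc K q u)" by (intro card_mono) auto
      with u show False by (simp add: card_arc)
    qed
    then obtain x where x: "x < K" "x \<notin> arc K q u" by auto
    have "q mod K \<in> arc K q u" using u by (auto simp: arc_def intro!: exI[of _ 0])
    then have "?\<xi> (q mod K, z) = b" "?\<xi> (x, z) = a" using x z S by (simp_all add: two_spin_apply)
    then show ?thesis using x ab by (intro mixedI[of "q mod K" K x]) auto
  qed
  have "mixed K (col ?\<xi> j)" by (rule short[of j i "K - 1"]) (use j ne K_ge_3 in \<open>auto simp: two_columns_def\<close>)
  moreover have "mixed K (col ?\<xi> (c mod L))" by (rule short[of "c mod L" p h]) (use ne h in \<open>auto simp: two_columns_def\<close>)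
  ultimately have "{j, c mod L} \<subseteq> ?C" using j by auto
  from card_mono[OF _ this] have "2 \<le> card ?C" using ne by simp
  with R defect_ge[of K L ?\<xi>] K_ge_3 show ?thesis by simp
qed

lemma threshold_B: 
  assumes "a \<noteq> b" "w < L" "h \<le> K"
  shows "threshold b (w * K + h) (B_bar K L h w K a b)"
  unfolding threshold_def
proof (intro ballI)
  fix \<eta> assume "\<eta> \<in> B_bar K L h w K a b"
  then obtain j p c where "\<eta> = two_spin_config K L a b (strip_bar j w p h c)" "c = j + w \<or> c = j + L - 1"
    by (rule B_bar_strip)
  then have "area K L {b} \<eta> = w * K + h"
    using assms by (simp add: area_two_spin strip_bar_subset card_strip_bar)
  then show "w * K + h \<le> area K L {b} \<eta> \<and> ((\<exists>y<L. \<forall>x<K. \<eta> (x, y) = b) \<longrightarrow> area K L {b} \<eta> = w * K + h)" by simp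
qed

lemma threshold_Q:
  assumes "a \<noteq> b"
  shows "threshold b (2 * K - 2) (Q_bar K L a b)"
proof -
  have "area K L {b} \<eta> = 2 * K - 2" if \<eta>: "\<eta> \<in> R_bar K L 2 (K - 1) a b" for \<eta>
    using \<eta>
  proof (rule R_bar_columns)
    fix i j assume "\<eta> = two_spin_config K L a b (two_columns j i (K - 1) i (K - 1) (j + 1))" "j < L"
    then show ?thesis using assms by (simp add: area_two_columns)
  qed
  moreover have "1 * K + (K - 2) = 2 * K - 2" using K_ge_3 by simp
  then have "threshold b (2 * K - 2) (B_bar K L (K - 2) 1 K a b)"
    using threshold_B[OF assms, of 1 "K - 2"] L_ge_4 by simp
  ultimately show ?thesis by (auto simp: threshold_def Q_bar_def)
qed

lemma threshold_H:
  assumes "a \<noteq> b" "i \<le> K - 3"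
  shows "threshold b (K + i) (H_bar K L i a b)"
proof -
  have "K + i \<le> area K L {b} \<eta> \<and> \<not> (\<exists>y<L. \<forall>x<K. \<eta> (x, y) = b)"
    if h: "h \<in> {i + 1..K - 2}" and \<eta>: "\<eta> \<in> B_bar K L h 1 (K - 1) a b" for h \<eta>
    using \<eta>
  proof (rule B_bar_columns)
    fix i' j p c assume \<eta>: "\<eta> = two_spin_config K L a b (two_columns j i' (K - 1) p h c)" and j: "j < L" and
      c: "c = j + 1 \<or> c = j + L - 1"
    have hK: "h < K" using h K_ge_3 by auto
    have "area K L {b} \<eta> = K - 1 + h" using assms j c hK by (simp add: \<eta> area_two_columns)
    then have "K + i \<le> area K L {b} \<eta>" using h K_ge_3 by auto
    moreover have "\<not> (\<exists>y<L. \<forall>x<K. \<eta> (x, y) = b)"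
    proof clarify
      fix y assume y: "y < L" "\<forall>x<K. \<eta> (x, y) = b"
      then have "{..<K} \<subseteq> arc K i' (K - 1) \<or> {..<K} \<subseteq> arc K p h"
      proof -
        have "{..<K} \<subseteq> {x. (x, y) \<in> two_columns j i' (K - 1) p h c}"
          using y assms(1) by (auto simp: \<eta> two_spin_apply split: if_splits)
        then show ?thesis using two_columns_section[OF j c, of y i' "K - 1" p h] by blast
      qed
      then have "card {..<K} \<le> card (arc K i' (K - 1)) \<or> card {..<K} \<le> card (arc K p h)"
        using card_mono[OF finite_arc] by blast
      with hK K_ge_3 show False by (auto simp: card_arc)
    qed
    ultimately show ?thesis by blast
  qed
  moreover have "threshold b (K + i) (B_bar K L i 1 K a b)"
    using threshold_B[OF assms(1), of 1 i] L_ge_4 assms(2) by simp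
  ultimately show ?thesis unfolding threshold_def H_bar_def by blast
qed

lemma tall_H:
  assumes "a \<noteq> b" "\<eta> \<in> H_bar K L i a b"
  shows "\<exists>y<L. K - 1 \<le> card {x. x < K \<and> \<eta> (x, y) = b}"
proof -
  from assms(2) consider "\<eta> \<in> B_bar K L i 1 K a b" | h where "\<eta> \<in> B_bar K L h 1 (K - 1) a b"
    unfolding H_bar_def by blast
  then show ?thesis
  proof cases
    case 1
    then obtain j p c where \<eta>: "\<eta> = two_spin_config K L a b (strip_bar j 1 p i c)" by (rule B_bar_strip)
    have "{x. x < K \<and> \<eta> (x, j mod L) = b} = {..<K}" by (auto simp: \<eta> two_spin_apply strip_bar_def)
    then show ?thesis by (intro exI[of _ "j mod L"]) simp
  next
    case 2
    then obtain i' j p c where \<eta>: "\<eta> = two_spin_config K L a b (two_columns j i' (K - 1) p h c)" and j: "j < L"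
      by (rule B_bar_columns)
    have "arc K i' (K - 1) \<subseteq> {x. x < K \<and> \<eta> (x, j) = b}"
      using arc_subset[OF K0, of i' "K - 1"] j by (auto simp: \<eta> two_spin_apply two_columns_def)
    from card_mono[OF _ this] have "K - 1 \<le> card {x. x < K \<and> \<eta> (x, j) = b}" by (simp add: card_arc)
    then show ?thesis using j by blast
  qed
qed


text \<open>Roughly half of the torus, shifted by one so that \<open>L\<close> does not divide it when \<open>L = K + 1\<close>. The
  complementary area is needed to follow a path backwards from its end.\<close>

lemma medium_exists: "\<exists>m. medium m \<and> medium (K * L - m)"
proof -
  define l where "l = L div 2"
  define T where "T = K * l"
  define m where "m = T + 1"
  define n where "n = K * L - m"
  have l: "2 \<le> l" "L = 2 * l \<or> L = 2 * l + 1" using L_ge_4 by (auto simp: l_def)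
  have T: "2 * K \<le> T" using mult_left_mono[OF l(1), of K] by (simp add: T_def)
  have KL: "K * L = (if L = 2 * l then 2 * T else 2 * T + K)"
    using l(2) by (auto simp: T_def algebra_simps)
  have m_less: "m < K * L" using T K_ge_3 by (simp add: KL m_def)
  have n: "n = (if L = 2 * l then T - 1 else T + K - 1)" by (simp add: n_def KL m_def)
  have n_compl: "K * L - n = m" using m_less by (simp add: n_def)
  have KK: "3 * K \<le> K * K" using K_ge_3 by (intro mult_right_mono) auto
  have "K * (K + 1) \<le> K * L" using K_less_L by (intro mult_left_mono) auto
  then have sq: "K * K + K \<le> K * L" by simp
  have pow: "(K + 1) ^ 2 = K * K + 2 * K + 1" by (simp add: power2_eq_square)
  have m_large: "(K + 1) ^ 2 < 4 * m"
    using sq KK T K_ge_3 unfolding pow KL m_def by (cases "L = 2 * l") auto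
  have n_large: "(K + 1) ^ 2 < 4 * n"
    using sq KK T K_ge_3 unfolding pow KL n by (cases "L = 2 * l") auto
  have "K * L = K * (L - 2) + 2 * K"
  proof -
    obtain L2 where "L = L2 + 2" using L_ge_4 by (metis add.commute le_Suc_ex numeral_Bit0 add_leD1 one_add_one)
    then show ?thesis by (simp add: algebra_simps)
  qed
  then have upper: "m \<le> K * (L - 2) + 2" "n \<le> K * (L - 2) + 2"
    using T K_ge_3 by (auto simp: KL n m_def split: if_splits)
  have lower: "2 * K - 1 \<le> m" "2 * K - 1 \<le> n" using T K_ge_3 unfolding n m_def by auto
  have m_ndvd: "\<not> L dvd m" if "L = K + 1"
  proof -
    have "m + l = L * l + 1" using that by (simp add: m_def T_def)
    moreover have "L * l = L * (l - 1) + L" using l by (cases l) auto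
    ultimately have eq: "m = L * (l - 1) + (L + 1 - l)" using l by linarith
    have "m mod L = (L + 1 - l) mod L" unfolding eq by (rule mod_mult_self4)
    also have "\<dots> = L + 1 - l" using l by (intro mod_less) linarith
    finally show ?thesis using l by (auto simp: dvd_eq_mod_eq_0)
  qed
  have n_ndvd: "\<not> L dvd n" if "L = K + 1"
    using m_ndvd[OF that] m_less unfolding n_def by (metis dvd_diffD1 dvd_triv_right less_imp_le)
  have "medium m" unfolding medium_def n_def[symmetric]
    using m_large n_large lower(1) upper(1) m_ndvd by blast
  moreover have "medium n" unfolding medium_def n_compl
    using m_large n_large lower(2) upper(2) n_ndvd by blast
  ultimately show ?thesis unfolding n_def by blast
qed

lemma low_walk_rev: "low_walk q \<omega> \<Longrightarrow> low_walk q (rev \<omega>)"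
  unfolding low_walk_def using adjacent_sym by (auto simp: successively_rev intro: successively_mono)

text \<open>An area beyond the middle is handled by running the path backwards and exchanging \<open>M\<close> with its
  complement.\<close>

lemma low_walk_hits_B:
  assumes walk: "low_walk q \<omega>" and start: "area K L M (hd \<omega>) = 0" and stop: "area K L M (last \<omega>) = K * L"
    and w: "1 \<le> w" "w + 3 \<le> L" and h: "1 \<le> h" "h < K" and large: "2 * K - 1 \<le> w * K + h"
  shows "\<exists>a\<in>spins q - M. \<exists>b\<in>spins q \<inter> M. set \<omega> \<inter> B_bar K L h w K a b \<noteq> {}"
proof -
  obtain m where m: "medium m" "medium (K * L - m)" using medium_exists by blast
  define n where "n = w * K + h"
  have "(w + 3) * K \<le> L * K" using w by (intro mult_right_mono) auto
  then have nL: "n + 2 * K < K * L" "n < K * (L - 1)" using h by (simp_all add: n_def algebra_simps)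
  have "\<exists>\<sigma>\<in>set \<omega>. rows_mixed \<sigma> \<and> area K L M \<sigma> = n"
  proof (cases "n \<le> m")
    case True
    then show ?thesis using low_walk_hits_area[OF walk start stop m(1)] large by (simp add: n_def)
  next
    case False
    have "\<exists>\<sigma>\<in>set (rev \<omega>). rows_mixed \<sigma> \<and> area K L (- M) \<sigma> = K * L - n"
    proof (rule low_walk_hits_area[OF low_walk_rev[OF walk] _ _ m(2)])
      show "area K L (- M) (hd (rev \<omega>)) = 0" "area K L (- M) (last (rev \<omega>)) = K * L"
        using start stop walk by (simp_all add: area_compl hd_rev last_rev)
    qed (use False nL in auto)
    then obtain \<sigma> where \<sigma>: "\<sigma> \<in> set \<omega>" "rows_mixed \<sigma>" "K * L - area K L M \<sigma> = K * L - n"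
      by (auto simp: area_compl)
    have "area K L M \<sigma> = n" using \<sigma>(3) nL area_le[of K L M \<sigma>] by linarith
    with \<sigma> show ?thesis by blast
  qed
  then obtain \<sigma> where \<sigma>: "\<sigma> \<in> set \<omega>" "rows_mixed \<sigma>" "area K L M \<sigma> = n" by blast
  have conf: "\<sigma> \<in> configs q K L" and low: "defect K L \<sigma> \<le> 2 * K + 2"
    using walk \<sigma> by (auto simp: low_walk_def)
  have dm: "n div K = w" "n mod K = h" using h by (simp_all add: n_def)
  have lower: "K < n" using large K_ge_3 by (simp add: n_def)
  have indiv: "\<not> K dvd n" using dm h by (simp add: dvd_eq_mod_eq_0)
  obtain a b where "a \<in> spins q - M" "b \<in> spins q \<inter> M" "\<sigma> \<in> B_bar K L h w K a b"
    using strip_config[OF conf low \<sigma>(2), of M] lower nL(2) indiv unfolding \<sigma>(3) dm by blast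
  with \<sigma>(1) show ?thesis by blast
qed

lemma gate_family_B:
  assumes w: "1 \<le> w" "w + 3 \<le> L" and h: "1 \<le> h" "h < K" and large: "2 * K - 1 \<le> w * K + h"
  shows "gate_family q (B_bar K L h w K)"
  unfolding gate_family_def
proof (intro conjI allI impI ballI)
  fix a b :: nat and \<xi> assume ab: "a \<noteq> b" and \<xi>: "\<xi> \<in> B_bar K L h w K a b"
  then obtain j p c where eq: "\<xi> = two_spin_config K L a b (strip_bar j w p h c)" and c: "c = j + w \<or> c = j + L - 1"
    by (elim B_bar_strip)
  show "\<exists>A. \<xi> = two_spin_config K L a b A" using eq by blast
  show "2 * K + 2 \<le> defect K L \<xi>" unfolding eq using w h c ab by (intro defect_ge_strip_bar) auto
  show "linked K L (low_phase a b (B_bar K L h w K a b) \<xi>) (const_config K L a) (const_config K L b)"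
    unfolding eq using w h c ab by (intro linked_through_strip threshold_B) auto
qed (rule low_walk_hits_B[OF _ _ _ w h large])

lemma gate_family_Q: "gate_family q (Q_bar K L)"
  unfolding gate_family_def
proof (intro conjI allI impI ballI)
  fix a b :: nat and \<xi> assume ab: "a \<noteq> b" and \<xi>: "\<xi> \<in> Q_bar K L a b"
  then consider (R) "\<xi> \<in> R_bar K L 2 (K - 1) a b" | (B) "\<xi> \<in> B_bar K L (K - 2) 1 K a b"
    unfolding Q_bar_def by blast
  then have "(\<exists>A. \<xi> = two_spin_config K L a b A) \<and> 2 * K + 2 \<le> defect K L \<xi> \<and>
      linked K L (low_phase a b (Q_bar K L a b) \<xi>) (const_config K L a) (const_config K L b)"
  proof cases
    case R
    then obtain i j where eq: "\<xi> = two_spin_config K L a b (two_columns j i (K - 1) i (K - 1) (j + 1))" and j: "j < L"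
      by (rule R_bar_columns)
    have "2 * K + 2 \<le> defect K L \<xi>" unfolding eq using ab j K_ge_3 by (intro defect_ge_two_columns) auto
    then show ?thesis unfolding eq using linked_through_R[OF ab threshold_Q[OF ab] j] by blast
  next
    case B
    then obtain j p c where eq: "\<xi> = two_spin_config K L a b (strip_bar j 1 p (K - 2) c)" and c: "c = j + 1 \<or> c = j + L - 1"
      by (rule B_bar_strip)
    have "2 * K + 2 \<le> defect K L \<xi>" unfolding eq using c ab K_ge_3 L_ge_4 by (intro defect_ge_strip_bar) auto
    moreover have "1 * K + (K - 2) = 2 * K - 2" using K_ge_3 by simp
    then have "linked K L (low_phase a b (Q_bar K L a b) \<xi>) (const_config K L a) (const_config K L b)"
      unfolding eq using c ab K_ge_3 L_ge_4 threshold_Q[OF ab] by (intro linked_through_strip) auto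
    ultimately show ?thesis unfolding eq by blast
  qed
  then show "\<exists>A. \<xi> = two_spin_config K L a b A" "2 * K + 2 \<le> defect K L \<xi>"
    "linked K L (low_phase a b (Q_bar K L a b) \<xi>) (const_config K L a) (const_config K L b)" by blast+
next
  fix M \<omega> assume "low_walk q \<omega>" "area K L M (hd \<omega>) = 0" "area K L M (last \<omega>) = K * L"
  moreover obtain m where "medium m" using medium_exists by blast
  ultimately show "\<exists>a\<in>spins q - M. \<exists>b\<in>spins q \<inter> M. set \<omega> \<inter> Q_bar K L a b \<noteq> {}"
    by (rule low_walk_hits_Q)
qed

lemma gate_family_H:
  assumes i: "1 \<le> i" "i \<le> K - 3"
  shows "gate_family q (H_bar K L i)"
  unfolding gate_family_def
proof (intro conjI allI impI ballI)
  fix a b :: nat and \<xi> assume ab: "a \<noteq> b" and \<xi>: "\<xi> \<in> H_bar K L i a b"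
  then have "\<xi> \<in> B_bar K L i 1 K a b \<or> (\<exists>h. i < h \<and> h \<le> K - 2 \<and> \<xi> \<in> B_bar K L h 1 (K - 1) a b)"
    unfolding H_bar_def by (auto simp: Suc_le_eq)
  then consider (B) "\<xi> \<in> B_bar K L i 1 K a b" | (C) h where "i < h" "h \<le> K - 2" "\<xi> \<in> B_bar K L h 1 (K - 1) a b"
    by blast
  then have "(\<exists>A. \<xi> = two_spin_config K L a b A) \<and> 2 * K + 2 \<le> defect K L \<xi> \<and>
      linked K L (low_phase a b (H_bar K L i a b) \<xi>) (const_config K L a) (const_config K L b)"
  proof cases
    case B
    then obtain j p c where eq: "\<xi> = two_spin_config K L a b (strip_bar j 1 p i c)" and c: "c = j + 1 \<or> c = j + L - 1"
      by (rule B_bar_strip)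
    have iK: "i < K" using i by simp
    have "2 * K + 2 \<le> defect K L \<xi>" unfolding eq using c ab i iK L_ge_4 by (intro defect_ge_strip_bar) auto
    moreover have "linked K L (low_phase a b (H_bar K L i a b) \<xi>) (const_config K L a) (const_config K L b)"
      unfolding eq using c ab i iK L_ge_4 threshold_H[OF ab i(2)] by (intro linked_through_strip) auto
    ultimately show ?thesis unfolding eq by blast
  next
    case C
    obtain i' j p c where eq: "\<xi> = two_spin_config K L a b (two_columns j i' (K - 1) p h c)" and j: "j < L"
      and c: "c = j + 1 \<or> c = j + L - 1" and bar: "arc K p h \<subseteq> arc K i' (K - 1)"
      using C(3) by (rule B_bar_columns)
    have "2 * K + 2 \<le> defect K L \<xi>" unfolding eq using ab j c C i K_ge_3 by (intro defect_ge_two_columns) auto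
    moreover have "linked K L (low_phase a b (H_bar K L i a b) \<xi>) (const_config K L a) (const_config K L b)"
      unfolding eq
      by (rule linked_through_short_column[OF ab threshold_H[OF ab i(2)] tall_H[OF ab] j c C(2) _ bar]) (use C(1) in auto)
    ultimately show ?thesis unfolding eq by blast
  qed
  then show "\<exists>A. \<xi> = two_spin_config K L a b A" "2 * K + 2 \<le> defect K L \<xi>"
    "linked K L (low_phase a b (H_bar K L i a b) \<xi>) (const_config K L a) (const_config K L b)" by blast+
next
  fix M \<omega> assume "low_walk q \<omega>" "area K L M (hd \<omega>) = 0" "area K L M (last \<omega>) = K * L"
  moreover obtain m where "medium m" using medium_exists by blast
  ultimately show "\<exists>a\<in>spins q - M. \<exists>b\<in>spins q \<inter> M. set \<omega> \<inter> H_bar K L i a b \<noteq> {}"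
    using i by (rule low_walk_hits_H)
qed

section \<open>Optimal paths are the low walks\<close>

lemma connectivity_pos_iff:
  assumes "0 < q"
  shows "0 < connectivity q K L \<sigma> \<eta> \<longleftrightarrow> adjacent K L \<sigma> \<eta>"
proof -
  let ?D = "disagreement K L \<sigma> \<eta>"
  have fin: "finite ?D" by (simp add: disagreement_def)
  have "0 < real q * real (card (verts K L))" using assms by (simp add: card_verts)
  then have "0 < connectivity q K L \<sigma> \<eta> \<longleftrightarrow> card ?D \<le> 1"
    using assms by (auto simp: connectivity_def)
  also have "\<dots> \<longleftrightarrow> (\<exists>v\<in>verts K L. ?D \<subseteq> {v})"
  proof
    assume "card ?D \<le> 1"
    then consider "?D = {}" | v where "?D = {v}" using fin by (metis One_nat_def card_1_singletonE card_eq_0_iff le_Suc_eq le_zero_eq)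
    then show "\<exists>v\<in>verts K L. ?D \<subseteq> {v}"
    proof cases
      case 1
      have "(0, 0) \<in> verts K L" by simp
      with 1 show ?thesis by blast
    next
      case 2
      then have "v \<in> verts K L" by (auto simp: disagreement_def)
      with 2 show ?thesis by blast
    qed
  next
    assume "\<exists>v\<in>verts K L. ?D \<subseteq> {v}"
    then obtain v where "?D \<subseteq> {v}" by blast
    from card_mono[OF _ this] show "card ?D \<le> 1" by simp
  qed
  also have "\<dots> \<longleftrightarrow> adjacent K L \<sigma> \<eta>" unfolding adjacent_def disagreement_def by blast
  finally show ?thesis .
qed

lemma defect_const:
  assumes "\<And>v. v \<in> verts K L \<Longrightarrow> \<sigma> v = d"
  shows "defect K L \<sigma> = 0"
proof -
  have "cyclic_changes L (row \<sigma> i) = 0" if "i < K" for i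
    by (rule cyclic_changes_const[where c = d]) (use assms that in simp)
  moreover have "cyclic_changes K (col \<sigma> j) = 0" if "j < L" for j
    by (rule cyclic_changes_const[where c = d]) (use assms that in simp)
  ultimately show ?thesis by (simp add: defect_def)
qed

lemma energy_defect: "energy K L \<sigma> = int (defect K L \<sigma>) - 2 * int (K * L)"
  using K_ge_3 L_ge_4 by (intro energy_eq_defect) auto

lemma area_const:
  "area K L M (const_config K L d) = (if d \<in> M then K * L else 0)"
proof -
  have "{v \<in> verts K L. const_config K L d v \<in> M} = (if d \<in> M then verts K L else {})"
    by (auto simp: const_config_def)
  then show ?thesis by (simp add: area_def card_verts)
qed

text \<open>A path that stays below would be a low walk, and therefore meet the set \<open>P_bar\<close>, whose
  elements do not have a smaller defect.\<close>

lemma path_reaches_height: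
  assumes "0 < q" "r \<noteq> s" and \<omega>: "\<omega> \<in> paths q K L (const_config K L r) (const_config K L s)"
  shows "\<exists>\<sigma>\<in>set \<omega>. 2 * K + 2 \<le> defect K L \<sigma>"
proof (rule ccontr)
  assume "\<not> ?thesis"
  then have less: "defect K L \<sigma> < 2 * K + 2" if "\<sigma> \<in> set \<omega>" for \<sigma> using that by (meson not_le)
  have walk: "low_walk q \<omega>"
    using \<omega> less unfolding paths_def low_walk_def by (auto simp: connectivity_pos_iff[OF assms(1)] less_imp_le)
  have ends: "area K L {s} (hd \<omega>) = 0" "area K L {s} (last \<omega>) = K * L"
    using \<omega> assms(2) by (auto simp: paths_def area_const)
  have "2 * K - 1 \<le> 1 * K + (K - 1)" by simp
  then have "\<exists>a\<in>spins q - {s}. \<exists>b\<in>spins q \<inter> {s}. set \<omega> \<inter> B_bar K L (K - 1) 1 K a b \<noteq> {}"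
    using K_ge_3 L_ge_4 by (intro low_walk_hits_B[OF walk ends]) auto
  then obtain a b where ab: "a \<in> spins q - {s}" "b \<in> spins q \<inter> {s}" "set \<omega> \<inter> B_bar K L (K - 1) 1 K a b \<noteq> {}"
    by blast
  then obtain \<xi> where \<xi>: "\<xi> \<in> set \<omega>" "\<xi> \<in> B_bar K L (K - 1) 1 K a b" by blast
  have "gate_family q (B_bar K L (K - 1) 1 K)" using K_ge_3 L_ge_4 by (intro gate_family_B) auto
  then have "2 * K + 2 \<le> defect K L \<xi>" using ab \<xi>(2) unfolding gate_family_def by blast
  with less[OF \<xi>(1)] show False by simp
qed

lemma linked_free: 
  assumes "a \<noteq> b"
  shows "linked K L (low_phase a b {} \<xi>) (const_config K L a) (const_config K L b)"
proof -
  have "two_spin_config K L a b (strip_bar j v p x c) \<in> low_phase a b {} \<xi>"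
    if "v < L" "x \<le> K" "c = j + v \<or> c = j + L - 1" for j v p x c
    using defect_strip_bar[OF that] unfolding low_phase_def by blast
  then show ?thesis using L_ge_4 by (intro linked_column_by_column[of 1 "0 + 1" 0]) auto
qed

lemma low_walk_of_linked:
  assumes "a \<in> spins q" "b \<in> spins q" "linked K L (low_phase a b X \<xi>) (const_config K L a) (const_config K L b)"
    and X: "\<And>\<eta>. \<eta> \<in> X \<Longrightarrow> 2 * K + 2 \<le> defect K L \<eta>"
  obtains \<omega> where "low_walk q \<omega>" "hd \<omega> = const_config K L a" "last \<omega> = const_config K L b" "set \<omega> \<subseteq> low_phase a b X \<xi>"
proof -
  have zero: "defect K L (const_config K L a) = 0"
    by (rule defect_const[where d = a]) (simp add: const_config_def)
  then have "const_config K L a \<in> low_phase a b X \<xi>"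
    using X[of "const_config K L a"] const_config_eq[of K L a b] by (auto simp: low_phase_def)
  from linked_walk[OF assms(3) this] obtain \<omega> where \<omega>: "\<omega> \<noteq> []" "hd \<omega> = const_config K L a" "last \<omega> = const_config K L b"
    "set \<omega> \<subseteq> low_phase a b X \<xi>" "successively (adjacent K L) \<omega>" by blast
  have "low_phase a b X \<xi> \<subseteq> configs q K L"
    using two_spin_in_configs[OF assms(1,2)] by (auto simp: low_phase_def)
  with \<omega> have "low_walk q \<omega>" unfolding low_walk_def by (auto simp: low_phase_def)
  with \<omega> show thesis using that by blast
qed

lemma low_walk_append:
  assumes "low_walk q \<omega>" "low_walk q \<omega>'" "last \<omega> = hd \<omega>'"
  shows "low_walk q (\<omega> @ \<omega>')"
proof -
  have "(0, 0) \<in> verts K L" by simp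
  then have "adjacent K L \<sigma> \<sigma>" for \<sigma> unfolding adjacent_def by blast
  with assms show ?thesis unfolding low_walk_def by (auto simp: successively_append_iff)
qed

lemma path_height_defect:
  assumes "\<omega> \<noteq> []"
  shows "path_height K L \<omega> \<le> int d - 2 * int (K * L) \<longleftrightarrow> (\<forall>\<sigma>\<in>set \<omega>. defect K L \<sigma> \<le> d)"
  using assms by (simp add: path_height_def energy_defect)

text \<open>Growing \<open>s\<close> inside \<open>r\<close> column by column attains the lower bound of \<open>path_reaches_height\<close>; so optimal
  paths are the paths of defect at most \<open>2 * K + 2\<close>.\<close>

lemma comm_height_eq:
  assumes "r \<in> spins q" "s \<in> spins q" "r \<noteq> s"
  shows "comm_height q K L (const_config K L r) (const_config K L s) = int (2 * K + 2) - 2 * int (K * L)"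
    and "opt_paths q K L (const_config K L r) (const_config K L s) =
      {\<omega>. low_walk q \<omega> \<and> hd \<omega> = const_config K L r \<and> last \<omega> = const_config K L s}"
proof -
  let ?P = "paths q K L (const_config K L r) (const_config K L s)"
  let ?h = "int (2 * K + 2) - 2 * int (K * L)"
  have q: "0 < q" using assms by (auto simp: spins_def)
  have walk_iff: "\<omega> \<in> ?P \<and> path_height K L \<omega> \<le> ?h \<longleftrightarrow>
      low_walk q \<omega> \<and> hd \<omega> = const_config K L r \<and> last \<omega> = const_config K L s" for \<omega>
    unfolding paths_def low_walk_def using path_height_defect[of \<omega> "2 * K + 2"]
    by (auto simp: connectivity_pos_iff[OF q])
  have ge: "?h \<le> path_height K L \<omega>" if \<omega>: "\<omega> \<in> ?P" for \<omega>
  proof -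
    obtain \<sigma> where \<sigma>: "\<sigma> \<in> set \<omega>" "2 * K + 2 \<le> defect K L \<sigma>" using path_reaches_height[OF q assms(3) \<omega>] by blast
    then have "?h \<le> energy K L \<sigma>" by (simp add: energy_defect)
    also have "\<dots> \<le> path_height K L \<omega>" unfolding path_height_def using \<sigma>(1) by (intro Max_ge) auto
    finally show ?thesis .
  qed
  obtain \<omega>0 where "low_walk q \<omega>0" "hd \<omega>0 = const_config K L r" "last \<omega>0 = const_config K L s"
    using low_walk_of_linked[OF assms(1,2) linked_free[OF assms(3)]] by blast
  then have \<omega>0: "\<omega>0 \<in> ?P" "path_height K L \<omega>0 = ?h" using walk_iff[of \<omega>0] ge[of \<omega>0] by auto
  have "finite (configs q K L)" unfolding configs_def by (intro finite_PiE) (auto simp: spins_def)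
  moreover have "path_height K L ` ?P \<subseteq> energy K L ` configs q K L"
  proof
    fix x assume "x \<in> path_height K L ` ?P"
    then obtain \<omega> where \<omega>: "\<omega> \<in> ?P" "x = Max (energy K L ` set \<omega>)" by (auto simp: path_height_def)
    then have "\<omega> \<noteq> []" by (auto simp: paths_def)
    then have "x \<in> energy K L ` set \<omega>" unfolding \<omega>(2) by (intro Max_in) auto
    moreover have "set \<omega> \<subseteq> configs q K L" using \<omega>(1) by (auto simp: paths_def)
    ultimately show "x \<in> energy K L ` configs q K L" by blast
  qed
  ultimately have fin: "finite (path_height K L ` ?P)" by (meson finite_imageI finite_subset)
  show height: "comm_height q K L (const_config K L r) (const_config K L s) = ?h"
    unfolding comm_height_def by (rule Min_eqI[OF fin]) (use ge \<omega>0 in force)+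
  show "opt_paths q K L (const_config K L r) (const_config K L s) =
      {\<omega>. low_walk q \<omega> \<and> hd \<omega> = const_config K L r \<and> last \<omega> = const_config K L s}"
  proof -
    have "{\<omega> \<in> ?P. path_height K L \<omega> = ?h} = {\<omega>. \<omega> \<in> ?P \<and> path_height K L \<omega> \<le> ?h}"
      using ge by (intro Collect_cong) (metis order_antisym order_refl)
    also have "\<dots> = {\<omega>. low_walk q \<omega> \<and> hd \<omega> = const_config K L r \<and> last \<omega> = const_config K L s}"
      by (intro Collect_cong walk_iff)
    finally show ?thesis unfolding opt_paths_def height .
  qed
qed

text \<open>A path that meets \<open>W\<close> at most in \<open>\<xi>\<close> meets it exactly there, because it cannot avoid \<open>W\<close>. This
  makes \<open>\<xi>\<close> a saddle as well as indispensable.\<close>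

lemma minimal_gateI:
  assumes rs: "r \<in> spins q" "s \<in> spins q" "r \<noteq> s"
    and hit: "\<And>\<omega>. low_walk q \<omega> \<Longrightarrow> hd \<omega> = const_config K L r \<Longrightarrow> last \<omega> = const_config K L s \<Longrightarrow> set \<omega> \<inter> W \<noteq> {}"
    and single: "\<And>\<xi>. \<xi> \<in> W \<Longrightarrow> \<exists>\<omega>. low_walk q \<omega> \<and> hd \<omega> = const_config K L r \<and> last \<omega> = const_config K L s \<and> set \<omega> \<inter> W \<subseteq> {\<xi>}"
    and high: "\<And>\<xi>. \<xi> \<in> W \<Longrightarrow> 2 * K + 2 \<le> defect K L \<xi>"
  shows "minimal_gate q K L (const_config K L r) (const_config K L s) W"
proof -
  note height = comm_height_eq(1)[OF rs] and opt = comm_height_eq(2)[OF rs]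
  have saddle: "\<xi> \<in> saddles q K L (const_config K L r) (const_config K L s)" if \<xi>: "\<xi> \<in> W" for \<xi>
  proof -
    obtain \<omega> where \<omega>: "low_walk q \<omega>" "hd \<omega> = const_config K L r" "last \<omega> = const_config K L s" "set \<omega> \<inter> W \<subseteq> {\<xi>}"
      using single[OF \<xi>] by blast
    then have in\<omega>: "\<xi> \<in> set \<omega>" using hit by blast
    have w_opt: "\<omega> \<in> opt_paths q K L (const_config K L r) (const_config K L s)" using \<omega> opt by blast
    then have "Max (energy K L ` set \<omega>) = int (2 * K + 2) - 2 * int (K * L)"
      using height by (simp add: opt_paths_def path_height_def)
    moreover have "defect K L \<xi> = 2 * K + 2" using high[OF \<xi>] \<omega>(1) in\<omega> by (auto simp: low_walk_def intro: antisym)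
    moreover have "\<xi> \<in> configs q K L" using \<omega>(1) in\<omega> by (auto simp: low_walk_def)
    ultimately show ?thesis unfolding saddles_def using w_opt in\<omega> by (auto simp: energy_defect intro!: bexI[of _ \<omega>])
  qed
  show ?thesis unfolding minimal_gate_def gate_def
  proof (intro conjI ballI allI impI)
    show "W \<subseteq> saddles q K L (const_config K L r) (const_config K L s)" using saddle by blast
    show "set \<omega> \<inter> W \<noteq> {}" if "\<omega> \<in> opt_paths q K L (const_config K L r) (const_config K L s)" for \<omega>
      using that hit unfolding opt by blast
    fix W' assume "W' \<subset> W"
    then obtain \<xi> where "\<xi> \<in> W" "\<xi> \<notin> W'" "W' \<subseteq> W" by blast
    with single[OF \<open>\<xi> \<in> W\<close>] show "\<exists>\<omega>\<in>opt_paths q K L (const_config K L r) (const_config K L s). set \<omega> \<inter> W' = {}"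
      unfolding opt by blast
  qed
qed

lemma minimal_gate_rev:
  assumes rs: "r \<in> spins q" "s \<in> spins q" "r \<noteq> s"
    and W: "minimal_gate q K L (const_config K L r) (const_config K L s) W"
  shows "minimal_gate q K L (const_config K L s) (const_config K L r) W"
proof -
  have opt: "opt_paths q K L (const_config K L s) (const_config K L r) =
      rev ` opt_paths q K L (const_config K L r) (const_config K L s)"
  proof (intro subset_antisym subsetI)
    fix \<omega> assume "\<omega> \<in> opt_paths q K L (const_config K L s) (const_config K L r)"
    then have "rev \<omega> \<in> opt_paths q K L (const_config K L r) (const_config K L s)"
      unfolding comm_height_eq(2)[OF rs] comm_height_eq(2)[OF rs(2,1) not_sym[OF rs(3)]]
      by (auto simp: low_walk_rev hd_rev last_rev)
    then show "\<omega> \<in> rev ` opt_paths q K L (const_config K L r) (const_config K L s)" by force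
  next
    fix \<omega> assume "\<omega> \<in> rev ` opt_paths q K L (const_config K L r) (const_config K L s)"
    then show "\<omega> \<in> opt_paths q K L (const_config K L s) (const_config K L r)"
      unfolding comm_height_eq(2)[OF rs] comm_height_eq(2)[OF rs(2,1) not_sym[OF rs(3)]]
      by (auto simp: low_walk_rev hd_rev last_rev)
  qed
  have "saddles q K L (const_config K L s) (const_config K L r) = saddles q K L (const_config K L r) (const_config K L s)"
    unfolding saddles_def opt by auto
  then show ?thesis using W unfolding minimal_gate_def gate_def opt by simp
qed

text \<open>An element of \<open>X a b\<close> shows both spins, as a constant configuration has defect zero.\<close>

lemma gate_family_values:
  assumes "gate_family q X" "a \<noteq> b" "\<sigma> \<in> X a b" "\<sigma> = two_spin_config K L c d A"
  shows "a \<in> {c, d}" "b \<in> {c, d}"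
proof -
  obtain B where B: "\<sigma> = two_spin_config K L a b B" and high: "2 * K + 2 \<le> defect K L \<sigma>"
    using assms(1-3) unfolding gate_family_def by blast
  have "\<exists>v\<in>verts K L. \<sigma> v = a"
  proof (rule ccontr)
    assume "\<not> ?thesis"
    then have "defect K L \<sigma> = 0" by (intro defect_const[where d = b]) (auto simp: B two_spin_config_def)
    with high show False by simp
  qed
  then show "a \<in> {c, d}" using assms(4) by (auto simp: two_spin_config_def split: if_splits)
  have "\<exists>v\<in>verts K L. \<sigma> v = b"
  proof (rule ccontr)
    assume "\<not> ?thesis"
    then have "defect K L \<sigma> = 0" by (intro defect_const[where d = a]) (auto simp: B two_spin_config_def)
    with high show False by simp
  qed
  then show "b \<in> {c, d}" using assms(4) by (auto simp: two_spin_config_def split: if_splits)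
qed

lemma gate_family_walk:
  assumes X: "gate_family q X" and ab: "a \<in> spins q" "b \<in> spins q" "a \<noteq> b" and \<xi>: "\<xi> \<in> X a b"
  obtains \<omega> where "low_walk q \<omega>" "hd \<omega> = const_config K L a" "last \<omega> = const_config K L b" "set \<omega> \<subseteq> low_phase a b (X a b) \<xi>"
proof (rule low_walk_of_linked[OF ab(1,2)])
  show "linked K L (low_phase a b (X a b) \<xi>) (const_config K L a) (const_config K L b)"
    using X ab(3) \<xi> unfolding gate_family_def by blast
  show "2 * K + 2 \<le> defect K L \<eta>" if "\<eta> \<in> X a b" for \<eta>
    using X ab(3) that unfolding gate_family_def by blast
qed (rule that)

lemma free_walk:
  assumes ab: "a \<in> spins q" "b \<in> spins q"
  obtains \<omega> where "low_walk q \<omega>" "hd \<omega> = const_config K L a" "last \<omega> = const_config K L b"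
    "\<And>\<sigma>. \<sigma> \<in> set \<omega> \<Longrightarrow> \<exists>A. \<sigma> = two_spin_config K L a b A"
proof (cases "a = b")
  case False
  obtain \<omega> where "low_walk q \<omega>" "hd \<omega> = const_config K L a" "last \<omega> = const_config K L b" "set \<omega> \<subseteq> low_phase a b {} undefined"
    using low_walk_of_linked[OF ab linked_free[OF False]] by blast
  then show thesis using that unfolding low_phase_def by blast
next
  case True
  have "defect K L (const_config K L a) = 0"
    by (rule defect_const[where d = a]) (simp add: const_config_def)
  then have "low_walk q [const_config K L a]"
    using two_spin_in_configs[OF ab, of K L "{}"] const_config_eq[of K L a b] by (simp add: low_walk_def)
  then show thesis using that[of "[const_config K L a]"] True const_config_eq[of K L a b] by auto
qed

text \<open>For \<open>\<xi>\<close> in \<open>X r t\<close> the path first turns \<open>r\<close> into \<open>t\<close> through \<open>\<xi>\<close> and then \<open>t\<close> into \<open>s\<close>; the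
  second part no longer contains \<open>r\<close> and so does not meet the union. For \<open>X t s\<close> the first part does not yet
  contain \<open>s\<close>.\<close>

lemma gate_family_minimal:
  assumes X: "gate_family q X" and rs: "r \<in> spins q" "s \<in> spins q" "r \<noteq> s"
  shows "minimal_gate q K L (const_config K L r) (const_config K L s) (\<Union>t\<in>spins q - {r}. X r t)"
    and "minimal_gate q K L (const_config K L r) (const_config K L s) (\<Union>t\<in>spins q - {s}. X t s)"
proof -
  have high: "2 * K + 2 \<le> defect K L \<xi>" if "a \<noteq> b" "\<xi> \<in> X a b" for a b \<xi>
    using X that unfolding gate_family_def by blast
  have hits: "\<exists>a\<in>spins q - M. \<exists>b\<in>spins q \<inter> M. set \<omega> \<inter> X a b \<noteq> {}"
    if "low_walk q \<omega>" "area K L M (hd \<omega>) = 0" "area K L M (last \<omega>) = K * L" for M \<omega>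
    using X that unfolding gate_family_def by blast
  show "minimal_gate q K L (const_config K L r) (const_config K L s) (\<Union>t\<in>spins q - {r}. X r t)"
  proof (rule minimal_gateI[OF rs])
    fix \<omega> assume "low_walk q \<omega>" "hd \<omega> = const_config K L r" "last \<omega> = const_config K L s"
    then show "set \<omega> \<inter> (\<Union>t\<in>spins q - {r}. X r t) \<noteq> {}"
      using hits[of \<omega> "- {r}"] rs by (auto simp: area_const)
  next
    fix \<xi> assume "\<xi> \<in> (\<Union>t\<in>spins q - {r}. X r t)"
    then obtain t where t: "t \<in> spins q" "t \<noteq> r" "\<xi> \<in> X r t" by blast
    obtain \<omega>1 where \<omega>1: "low_walk q \<omega>1" "hd \<omega>1 = const_config K L r" "last \<omega>1 = const_config K L t"
      "set \<omega>1 \<subseteq> low_phase r t (X r t) \<xi>"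
      using gate_family_walk[OF X rs(1) t(1) not_sym[OF t(2)] t(3)] .
    obtain \<omega>2 where \<omega>2: "low_walk q \<omega>2" "hd \<omega>2 = const_config K L t" "last \<omega>2 = const_config K L s"
      "\<And>\<sigma>. \<sigma> \<in> set \<omega>2 \<Longrightarrow> \<exists>A. \<sigma> = two_spin_config K L t s A"
      using free_walk[OF t(1) rs(2)] by metis
    have "\<sigma> = \<xi>" if "\<sigma> \<in> set (\<omega>1 @ \<omega>2)" "t' \<in> spins q - {r}" "\<sigma> \<in> X r t'" for \<sigma> t'
    proof -
      have ne: "r \<noteq> t'" using that by auto
      show ?thesis
      proof (cases "\<sigma> \<in> set \<omega>1")
        case True
        with \<omega>1(4) obtain A where A: "\<sigma> = two_spin_config K L r t A" and sing: "\<sigma> \<in> X r t \<longrightarrow> \<sigma> = \<xi>"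
          unfolding low_phase_def by blast
        have "t' = t" using gate_family_values(2)[OF X ne that(3) A] ne by auto
        with sing that show ?thesis by simp
      next
        case False
        with \<omega>2(4) that obtain A where "\<sigma> = two_spin_config K L t s A" by auto
        then show ?thesis using gate_family_values(1)[OF X ne that(3)] t rs by auto
      qed
    qed
    then have "set (\<omega>1 @ \<omega>2) \<inter> (\<Union>t\<in>spins q - {r}. X r t) \<subseteq> {\<xi>}" by blast
    moreover have "low_walk q (\<omega>1 @ \<omega>2)" using low_walk_append \<omega>1 \<omega>2 by simp
    moreover have "\<omega>1 \<noteq> []" "\<omega>2 \<noteq> []" using \<omega>1 \<omega>2 by (auto simp: low_walk_def)
    ultimately show "\<exists>\<omega>. low_walk q \<omega> \<and> hd \<omega> = const_config K L r \<and> last \<omega> = const_config K L s \<and>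
        set \<omega> \<inter> (\<Union>t\<in>spins q - {r}. X r t) \<subseteq> {\<xi>}"
      using \<omega>1 \<omega>2 by (intro exI[of _ "\<omega>1 @ \<omega>2"]) simp
  next
    fix \<xi> assume "\<xi> \<in> (\<Union>t\<in>spins q - {r}. X r t)"
    then obtain t where "t \<noteq> r" "\<xi> \<in> X r t" by blast
    then show "2 * K + 2 \<le> defect K L \<xi>" using high[of r t \<xi>] by simp
  qed
  show "minimal_gate q K L (const_config K L r) (const_config K L s) (\<Union>t\<in>spins q - {s}. X t s)"
  proof (rule minimal_gateI[OF rs])
    fix \<omega> assume "low_walk q \<omega>" "hd \<omega> = const_config K L r" "last \<omega> = const_config K L s"
    then show "set \<omega> \<inter> (\<Union>t\<in>spins q - {s}. X t s) \<noteq> {}"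
      using hits[of \<omega> "{s}"] rs by (auto simp: area_const)
  next
    fix \<xi> assume "\<xi> \<in> (\<Union>t\<in>spins q - {s}. X t s)"
    then obtain t where t: "t \<in> spins q" "t \<noteq> s" "\<xi> \<in> X t s" by blast
    obtain \<omega>1 where \<omega>1: "low_walk q \<omega>1" "hd \<omega>1 = const_config K L r" "last \<omega>1 = const_config K L t"
      "\<And>\<sigma>. \<sigma> \<in> set \<omega>1 \<Longrightarrow> \<exists>A. \<sigma> = two_spin_config K L r t A"
      using free_walk[OF rs(1) t(1)] by metis
    obtain \<omega>2 where \<omega>2: "low_walk q \<omega>2" "hd \<omega>2 = const_config K L t" "last \<omega>2 = const_config K L s"
      "set \<omega>2 \<subseteq> low_phase t s (X t s) \<xi>"
      using gate_family_walk[OF X t(1) rs(2) t(2,3)] .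
    have "\<sigma> = \<xi>" if "\<sigma> \<in> set (\<omega>1 @ \<omega>2)" "t' \<in> spins q - {s}" "\<sigma> \<in> X t' s" for \<sigma> t'
    proof -
      have ne: "t' \<noteq> s" using that by auto
      show ?thesis
      proof (cases "\<sigma> \<in> set \<omega>2")
        case True
        with \<omega>2(4) obtain A where A: "\<sigma> = two_spin_config K L t s A" and sing: "\<sigma> \<in> X t s \<longrightarrow> \<sigma> = \<xi>"
          unfolding low_phase_def by blast
        have "t' = t" using gate_family_values(1)[OF X ne that(3) A] ne by auto
        with sing that show ?thesis by simp
      next
        case False
        with \<omega>1(4) that obtain A where "\<sigma> = two_spin_config K L r t A" by auto
        then show ?thesis using gate_family_values(2)[OF X ne that(3)] t rs by auto
      qed
    qed
    then have "set (\<omega>1 @ \<omega>2) \<inter> (\<Union>t\<in>spins q - {s}. X t s) \<subseteq> {\<xi>}" by blast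
    moreover have "low_walk q (\<omega>1 @ \<omega>2)" using low_walk_append \<omega>1 \<omega>2 by simp
    moreover have "\<omega>1 \<noteq> []" "\<omega>2 \<noteq> []" using \<omega>1 \<omega>2 by (auto simp: low_walk_def)
    ultimately show "\<exists>\<omega>. low_walk q \<omega> \<and> hd \<omega> = const_config K L r \<and> last \<omega> = const_config K L s \<and>
        set \<omega> \<inter> (\<Union>t\<in>spins q - {s}. X t s) \<subseteq> {\<xi>}"
      using \<omega>1 \<omega>2 by (intro exI[of _ "\<omega>1 @ \<omega>2"]) simp
  next
    fix \<xi> assume "\<xi> \<in> (\<Union>t\<in>spins q - {s}. X t s)"
    then obtain t where "t \<noteq> s" "\<xi> \<in> X t s" by blast
    then show "2 * K + 2 \<le> defect K L \<xi>" using high[of t s \<xi>] by simp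
  qed
qed

lemma gate_family_minimal_all:
  assumes X: "gate_family q X" and rs: "r \<in> spins q" "s \<in> spins q" "r \<noteq> s"
  shows "minimal_gate q K L (const_config K L r) (const_config K L s) (\<Union>t\<in>spins q - {r}. X r t) \<and>
    minimal_gate q K L (const_config K L r) (const_config K L s) (\<Union>t\<in>spins q - {s}. X t s) \<and>
    minimal_gate q K L (const_config K L r) (const_config K L s) (\<Union>t\<in>spins q - {r}. X t r) \<and>
    minimal_gate q K L (const_config K L r) (const_config K L s) (\<Union>t\<in>spins q - {s}. X s t)"
  using gate_family_minimal[OF X rs] gate_family_minimal[OF X rs(2,1) not_sym[OF rs(3)]]
    minimal_gate_rev[OF rs(2,1) not_sym[OF rs(3)]] by blast

end

theorem theorem3p5:
  fixes q K L r s :: nat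
  assumes "3 \<le> K" and "K < L" and "3 \<le> L" and "2 < q"
    and "r \<in> spins q" and "s \<in> spins q" and "r \<noteq> s"
  shows
    "(minimal_gate q K L (const_config K L r) (const_config K L s)
        (\<Union>t\<in>spins q - {r}. P_bar K L r t) \<and>
      minimal_gate q K L (const_config K L r) (const_config K L s)
        (\<Union>t\<in>spins q - {s}. P_bar K L t s) \<and>
      minimal_gate q K L (const_config K L r) (const_config K L s)
        (\<Union>t\<in>spins q - {r}. P_tilde K L r t) \<and>
      minimal_gate q K L (const_config K L r) (const_config K L s)
        (\<Union>t\<in>spins q - {s}. P_tilde K L t s)) \<and>
     (minimal_gate q K L (const_config K L r) (const_config K L s)
        (\<Union>t\<in>spins q - {r}. Q_bar K L r t) \<and>
      minimal_gate q K L (const_config K L r) (const_config K L s)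
        (\<Union>t\<in>spins q - {s}. Q_bar K L t s) \<and>
      minimal_gate q K L (const_config K L r) (const_config K L s)
        (\<Union>t\<in>spins q - {r}. Q_tilde K L r t) \<and>
      minimal_gate q K L (const_config K L r) (const_config K L s)
        (\<Union>t\<in>spins q - {s}. Q_tilde K L t s)) \<and>
     (\<forall>i\<in>{1..K-3}.
      minimal_gate q K L (const_config K L r) (const_config K L s)
        (\<Union>t\<in>spins q - {r}. H_bar K L i r t) \<and>
      minimal_gate q K L (const_config K L r) (const_config K L s)
        (\<Union>t\<in>spins q - {s}. H_bar K L i t s) \<and>
      minimal_gate q K L (const_config K L r) (const_config K L s)
        (\<Union>t\<in>spins q - {r}. H_tilde K L i r t) \<and>
      minimal_gate q K L (const_config K L r) (const_config K L s)
        (\<Union>t\<in>spins q - {s}. H_tilde K L i t s)) \<and>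
     (\<forall>j\<in>{2..L-3}. \<forall>h\<in>{1..K-1}.
      minimal_gate q K L (const_config K L r) (const_config K L s)
        (\<Union>t\<in>spins q - {r}. W_gate K L j h r t) \<and>
      minimal_gate q K L (const_config K L r) (const_config K L s)
        (\<Union>t\<in>spins q - {s}. W_gate K L j h t s))"
proof -
  interpret torus K L using assms(1,2) by unfold_locales
  note rs = assms(5-7)
  have tilde: "P_tilde K L a b = P_bar K L b a" "Q_tilde K L a b = Q_bar K L b a" "H_tilde K L i a b = H_bar K L i b a" for i a b
    by (simp_all add: P_tilde_def P_bar_def Q_tilde_def Q_bar_def H_tilde_def H_bar_def R_tilde_def B_tilde_def)
  have "gate_family q (P_bar K L)"
  proof -
    have "P_bar K L = B_bar K L (K - 1) 1 K" by (intro ext) (simp add: P_bar_def)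
    then show ?thesis using assms(1) L_ge_4 gate_family_B[of 1 "K - 1" q] by simp
  qed
  note P = gate_family_minimal_all[OF this rs]
  note Q = gate_family_minimal_all[OF gate_family_Q rs]
  have H: "gate_family q (H_bar K L i)" if "i \<in> {1..K-3}" for i
    using that by (intro gate_family_H) auto
  have W: "gate_family q (W_gate K L j h)" if "j \<in> {2..L-3}" "h \<in> {1..K-1}" for j h
  proof -
    have "W_gate K L j h = B_bar K L h j K" by (intro ext) (simp add: W_gate_def)
    moreover have "2 * K \<le> j * K" using that by (intro mult_right_mono) auto
    then have "2 * K - 1 \<le> j * K + h" by linarith
    then have "gate_family q (B_bar K L h j K)"
      using that assms(1) L_ge_4 by (intro gate_family_B) auto
    ultimately show ?thesis by simp
  qed
  show ?thesis unfolding tilde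
    using P Q gate_family_minimal_all[OF H rs] gate_family_minimal[OF W rs] by blast
qed

end
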